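(* Let $\mathbf{I}$ be a finitely generated category. The following are equivalent: (i) Every $\mathbf{I}$-shaped diagram in a category with the amalgamation property (AP) and the joint embedding property (JEP) has a cocone. (ii) Every $\mathbf{I}$-shaped diagram in the category $\mathbf{Inj}$ of sets and injections has a cocone (in $\mathbf{Inj}$). (When $\mathbf{I}$ is finite, it suffices to consider finite sets, i.e., (ii) is then equivalent to: every diagram $F : \mathbf{I} \to \mathbf{Inj}$ with all $F(I)$ finite has a cocone in $\mathbf{Inj}$.) (iii) $\mathbf{I}$ is upward-simply-connected. When $\mathbf{I}$ is a finite poset, these are further equivalent to: (iv) Every upward-closed subset of $\mathbf{I}$ is simply-connected. (v) $\mathbf{I}$ is forest-like. Similarly, every $\mathbf{I}$-shaped diagram in a category with the AP has a cocone if and only if $\mathbf{I}$ is connected and any (equivalently, all) of (ii), (iii) (also (iv), (v) if $\mathbf{I}$ is a poset) hold.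
   Context: A preordered set is regarded as a category with a unique arrow $I \to J$ iff $I \le J$. A category is finitely generated if there are finitely many arrows whose closure under composition is all arrows (such a category has finitely many objects; a preorder is finitely generated iff it is finite). A diagram of shape $\mathbf{I}$ in $\mathbf{C}$ is a functor $F : \mathbf{I} \to \mathbf{C}$. A cocone over $F$ is an object $X \in \mathbf{C}$ with morphisms $f_I : F(I) \to X$ for all objects $I \in \mathbf{I}$ such that $f_I = f_J \circ F(i)$ for every $i : I \to J$ in $\mathbf{I}$. A category has the AP if every diagram in it of shape $\bullet \leftarrow \bullet \rightarrow \bullet$ has a cocone, and has the JEP if every diagram of finite discrete shape (including the empty shape) in it has a cocone. A category is connected if it has exactly one connected component (under zigzags of morphisms); the empty category is not connected. Fundamental groupoid: $\pi_1(\mathbf{I})$ is the groupoid freely generated by the category $\mathbf{I}$ (same objects; morphisms are words in the morphisms of $\mathbf{I}$ and their formal inverses, modulo the relations holding in $\mathbf{I}$ and those saying that the formal inverses are inverses). $\mathbf{I}$ is simply-connected if $\pi_1(\mathbf{I})$ has at most one morphism between any two objects (connectedness is not required). An inverse category is a category in which every morphism $f : X \to Y$ has a unique pseudoinverse $f^{-1} : Y \to X$ with $f \circ f^{-1} \circ f = f$ and $f^{-1} \circ f \circ f^{-1} = f^{-1}$. The left fundamental inverse category $\mathcal{L}(\mathbf{I})$ is the inverse category freely generated by $\mathbf{I}$ such that every morphism of $\mathbf{I}$ becomes monic: there is a functor $\eta : \mathbf{I} \to \mathcal{L}(\mathbf{I})$ (identity on objects) such that $\mathcal{L}(\mathbf{I})$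 is generated by the morphisms $\eta(i), \eta(i)^{-1}$, with $\eta(i)^{-1} \circ \eta(i) = 1_I$ for each $i : I \to J$ in $\mathbf{I}$, and any functor $F : \mathbf{I} \to \mathbf{C}$ into an inverse category with $F(i)^{-1} \circ F(i) = 1_{F(I)}$ for each $i : I \to J$ factors uniquely through $\eta$. $\mathbf{I}$ is upward-simply-connected if every endomorphism $f$ in $\mathcal{L}(\mathbf{I})$ is idempotent ($f \circ f = f$). The class of finite tree-like posets is defined inductively by: if $\mathbf{K}_1, \dots, \mathbf{K}_n$ ($n \ge 0$) are finite tree-like posets and $\mathbf{U}_k \subseteq \mathbf{K}_k$ is a connected (in particular nonempty) upward-closed subset for each $k$, then a new finite tree-like poset is formed by taking the disjoint union of the $\mathbf{K}_k$ and adjoining a single point which lies below each $\mathbf{U}_k$ (i.e., below exactly the elements of $\bigcup_k \mathbf{U}_k$ and itself). A finite forest-like poset is a finite disjoint union of tree-like posets. *)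

theory Defs
  imports "HOL-Library.FuncSet" "HOL-Library.Disjoint_Sets"
begin

section \<open>Categories, functors, cocones\<close>

record ('o, 'm) precategory =
  obj :: "'o set"
  arr :: "'m set"
  src :: "'m \<Rightarrow> 'o"
  tgt :: "'m \<Rightarrow> 'o"
  idn :: "'o \<Rightarrow> 'm"
  cmp :: "'m \<Rightarrow> 'm \<Rightarrow> 'm"   \<comment> \<open>\<open>cmp C g f\<close> is \<open>g \<circ> f\<close>\<close>

definition hom :: "('o, 'm) precategory \<Rightarrow> 'o \<Rightarrow> 'o \<Rightarrow> 'm set" where
  "hom C x y = {f \<in> arr C. src C f = x \<and> tgt C f = y}"

locale category =
  fixes C :: "('o, 'm) precategory"
  assumes src_obj: "f \<in> arr C \<Longrightarrow> src C f \<in> obj C"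
    and tgt_obj: "f \<in> arr C \<Longrightarrow> tgt C f \<in> obj C"
    and idn_hom: "x \<in> obj C \<Longrightarrow> idn C x \<in> hom C x x"
    and cmp_hom: "\<lbrakk>f \<in> hom C x y; g \<in> hom C y z\<rbrakk> \<Longrightarrow> cmp C g f \<in> hom C x z"
    and cmp_idn_right: "f \<in> hom C x y \<Longrightarrow> cmp C f (idn C x) = f"
    and cmp_idn_left: "f \<in> hom C x y \<Longrightarrow> cmp C (idn C y) f = f"
    and cmp_assoc: "\<lbrakk>f \<in> hom C w x; g \<in> hom C x y; h \<in> hom C y z\<rbrakk>
      \<Longrightarrow> cmp C h (cmp C g f) = cmp C (cmp C h g) f"

text \<open>Closure is under binary composition only: identities are not supplied for free, so that a
  finitely generated category has finitely many objects.\<close>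

inductive_set arr_closure :: "('o, 'm) precategory \<Rightarrow> 'm set \<Rightarrow> 'm set"
  for C :: "('o, 'm) precategory" and G :: "'m set" where
  gen: "f \<in> G \<Longrightarrow> f \<in> arr_closure C G"
| cmp: "\<lbrakk>f \<in> arr_closure C G; g \<in> arr_closure C G; src C g = tgt C f\<rbrakk>
    \<Longrightarrow> cmp C g f \<in> arr_closure C G"

definition finitely_generated :: "('o, 'm) precategory \<Rightarrow> bool" where
  "finitely_generated C \<longleftrightarrow> (\<exists>G. finite G \<and> G \<subseteq> arr C \<and> arr_closure C G = arr C)"

definition is_functor ::
  "('o, 'm) precategory \<Rightarrow> ('p, 'n) precategory \<Rightarrow> ('o \<Rightarrow> 'p) \<Rightarrow> ('m \<Rightarrow> 'n) \<Rightarrow> bool" where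
  "is_functor A B Fo Fa \<longleftrightarrow>
     (\<forall>x\<in>obj A. Fo x \<in> obj B) \<and>
     (\<forall>f\<in>arr A. Fa f \<in> hom B (Fo (src A f)) (Fo (tgt A f))) \<and>
     (\<forall>x\<in>obj A. Fa (idn A x) = idn B (Fo x)) \<and>
     (\<forall>f\<in>arr A. \<forall>g\<in>arr A. src A g = tgt A f \<longrightarrow> Fa (cmp A g f) = cmp B (Fa g) (Fa f))"

definition is_cocone ::
  "('o, 'm) precategory \<Rightarrow> ('p, 'n) precategory \<Rightarrow> ('o \<Rightarrow> 'p) \<Rightarrow> ('m \<Rightarrow> 'n) \<Rightarrow> 'p \<Rightarrow> ('o \<Rightarrow> 'n) \<Rightarrow> bool"
  where
  "is_cocone I C Fo Fa X f \<longleftrightarrow>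
     X \<in> obj C \<and>
     (\<forall>x\<in>obj I. f x \<in> hom C (Fo x) X) \<and>
     (\<forall>i\<in>arr I. f (src I i) = cmp C (f (tgt I i)) (Fa i))"

definition has_cocone ::
  "('o, 'm) precategory \<Rightarrow> ('p, 'n) precategory \<Rightarrow> ('o \<Rightarrow> 'p) \<Rightarrow> ('m \<Rightarrow> 'n) \<Rightarrow> bool" where
  "has_cocone I C Fo Fa \<longleftrightarrow> (\<exists>X f. is_cocone I C Fo Fa X f)"

definition diagrams_have_cocones :: "('o, 'm) precategory \<Rightarrow> ('p, 'n) precategory \<Rightarrow> bool" where
  "diagrams_have_cocones I C \<longleftrightarrow> (\<forall>Fo Fa. is_functor I C Fo Fa \<longrightarrow> has_cocone I C Fo Fa)"

text \<open>A formula cannot quantify over types, so "every category" is rendered as "every category with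
  objects in \<open>'o\<close> and arrows in \<open>'m\<close>", with \<open>'o\<close> and \<open>'m\<close> arbitrary infinite types. As \<open>'o\<close> and
  \<open>'m\<close> are type variables of the theorem, this covers all categories, because a category on finite
  types can be transported to infinite ones. Sets are likewise the subsets of an arbitrary infinite
  type.\<close>

text \<open>The restriction of the preorder \<open>r\<close> to \<open>P\<close>, as a category: \<open>(x, y)\<close> is the unique arrow
  from \<open>x\<close> to \<open>y\<close>.\<close>

definition preorder_cat :: "'p set \<Rightarrow> 'p rel \<Rightarrow> ('p, 'p \<times> 'p) precategory" where
  "preorder_cat P r =
     \<lparr>obj = P, arr = r \<inter> P \<times> P, src = fst, tgt = snd,
      idn = (\<lambda>x. (x, x)), cmp = (\<lambda>g f. (fst f, snd g))\<rparr>"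

definition has_AP :: "('o, 'm) precategory \<Rightarrow> bool" where
  "has_AP C \<longleftrightarrow>
     diagrams_have_cocones (preorder_cat {0, 1, 2 :: nat} {(0,0), (1,1), (2,2), (0,1), (0,2)}) C"

text \<open>Up to isomorphism, the finite discrete shapes are those on finite sets of natural numbers.\<close>

definition has_JEP :: "('o, 'm) precategory \<Rightarrow> bool" where
  "has_JEP C \<longleftrightarrow> (\<forall>S :: nat set. finite S \<longrightarrow> diagrams_have_cocones (preorder_cat S (Id_on S)) C)"

definition components :: "('o, 'm) precategory \<Rightarrow> 'o set set" where
  "components C =
     obj C // {(x, y) \<in> obj C \<times> obj C. equivclp (\<lambda>a b. hom C a b \<noteq> {}) x y}"

definition connected_cat :: "('o, 'm) precategory \<Rightarrow> bool" where
  "connected_cat C \<longleftrightarrow> (\<exists>!K. K \<in> components C)"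

section \<open>Sets and injections\<close>

text \<open>The category of all subsets of the type \<open>'x\<close> and injections between them; an arrow
  \<open>(A, f, B)\<close> carries its domain and codomain, and \<open>f\<close> is \<open>undefined\<close> outside \<open>A\<close>.\<close>

type_synonym 'x inj_arr = "'x set \<times> ('x \<Rightarrow> 'x) \<times> 'x set"

definition Inj :: "('x set, 'x inj_arr) precategory" where
  "Inj =
     \<lparr>obj = UNIV,
      arr = {(A, f, B). f \<in> A \<rightarrow>\<^sub>E B \<and> inj_on f A},
      src = (\<lambda>(A, f, B). A),
      tgt = (\<lambda>(A, f, B). B),
      idn = (\<lambda>A. (A, \<lambda>x\<in>A. x, A)),
      cmp = (\<lambda>(B', g, D) (A, f, B). (A, compose A g f, D))\<rparr>"

section \<open>Words in arrows and formal inverses\<close>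

definition category_congruence :: "('o, 'm) precategory \<Rightarrow> 'm rel \<Rightarrow> bool" where
  "category_congruence C R \<longleftrightarrow>
     equiv (arr C) R \<and>
     (\<forall>(f, f')\<in>R. src C f = src C f' \<and> tgt C f = tgt C f') \<and>
     (\<forall>(f, f')\<in>R. \<forall>(g, g')\<in>R. src C g = tgt C f \<longrightarrow> (cmp C g f, cmp C g' f') \<in> R)"

definition quotient_cat :: "('o, 'm) precategory \<Rightarrow> 'm rel \<Rightarrow> ('o, 'm set) precategory" where
  "quotient_cat C R =
     \<lparr>obj = obj C,
      arr = arr C // R,
      src = (\<lambda>c. the_elem (src C ` c)),
      tgt = (\<lambda>c. the_elem (tgt C ` c)),
      idn = (\<lambda>x. R `` {idn C x}),
      cmp = (\<lambda>d c. \<Union>f\<in>c. \<Union>g\<in>d. R `` {cmp C g f})\<rparr>"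

datatype 'm letter = Fwd 'm | Bwd 'm

primrec flip :: "'m letter \<Rightarrow> 'm letter" where
  "flip (Fwd i) = Bwd i"
| "flip (Bwd i) = Fwd i"

text \<open>\<open>path I x w y\<close>: the word \<open>w\<close>, read from left to right, leads from \<open>x\<close> to \<open>y\<close>.\<close>

fun path :: "('o, 'm) precategory \<Rightarrow> 'o \<Rightarrow> 'm letter list \<Rightarrow> 'o \<Rightarrow> bool" where
  "path I x [] y \<longleftrightarrow> x \<in> obj I \<and> x = y"
| "path I x (Fwd i # w) y \<longleftrightarrow> i \<in> arr I \<and> src I i = x \<and> path I (tgt I i) w y"
| "path I x (Bwd i # w) y \<longleftrightarrow> i \<in> arr I \<and> tgt I i = x \<and> path I (src I i) w y"

type_synonym ('o, 'm) word = "'o \<times> 'm letter list \<times> 'o"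

definition word_cat :: "('o, 'm) precategory \<Rightarrow> ('o, ('o, 'm) word) precategory" where
  "word_cat I =
     \<lparr>obj = obj I,
      arr = {(x, w, y). path I x w y},
      src = (\<lambda>(x, w, y). x),
      tgt = (\<lambda>(x, w, y). y),
      idn = (\<lambda>x. (x, [], x)),
      cmp = (\<lambda>(y', v, z) (x, u, y). (x, u @ v, z))\<rparr>"

definition word_inv :: "('o, 'm) word \<Rightarrow> ('o, 'm) word" where
  "word_inv = (\<lambda>(x, w, y). (y, rev (map flip w), x))"

definition word_of :: "('o, 'm) precategory \<Rightarrow> 'm \<Rightarrow> ('o, 'm) word" where
  "word_of I i = (src I i, [Fwd i], tgt I i)"

section \<open>The fundamental groupoid\<close>

inductive_set pi1_rel :: "('o, 'm) precategory \<Rightarrow> ('o, 'm) word rel"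
  for I :: "('o, 'm) precategory" where
  refl: "u \<in> arr (word_cat I) \<Longrightarrow> (u, u) \<in> pi1_rel I"
| sym: "(u, v) \<in> pi1_rel I \<Longrightarrow> (v, u) \<in> pi1_rel I"
| trans: "\<lbrakk>(u, v) \<in> pi1_rel I; (v, w) \<in> pi1_rel I\<rbrakk> \<Longrightarrow> (u, w) \<in> pi1_rel I"
| cong: "\<lbrakk>(u, u') \<in> pi1_rel I; (v, v') \<in> pi1_rel I; src (word_cat I) v = tgt (word_cat I) u\<rbrakk>
    \<Longrightarrow> (cmp (word_cat I) v u, cmp (word_cat I) v' u') \<in> pi1_rel I"
| idn: "x \<in> obj I \<Longrightarrow> (word_of I (idn I x), idn (word_cat I) x) \<in> pi1_rel I"
| cmp: "\<lbrakk>i \<in> arr I; j \<in> arr I; src I j = tgt I i\<rbrakk>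
    \<Longrightarrow> (word_of I (cmp I j i), cmp (word_cat I) (word_of I j) (word_of I i)) \<in> pi1_rel I"
| inv_left: "i \<in> arr I
    \<Longrightarrow> (cmp (word_cat I) (word_inv (word_of I i)) (word_of I i), idn (word_cat I) (src I i)) \<in> pi1_rel I"
| inv_right: "i \<in> arr I
    \<Longrightarrow> (cmp (word_cat I) (word_of I i) (word_inv (word_of I i)), idn (word_cat I) (tgt I i)) \<in> pi1_rel I"

definition pi1 :: "('o, 'm) precategory \<Rightarrow> ('o, ('o, 'm) word set) precategory" where
  "pi1 I = quotient_cat (word_cat I) (pi1_rel I)"

definition simply_connected_cat :: "('o, 'm) precategory \<Rightarrow> bool" where
  "simply_connected_cat I \<longleftrightarrow>
     (\<forall>x\<in>obj I. \<forall>y\<in>obj I. \<forall>f\<in>hom (pi1 I) x y. \<forall>g\<in>hom (pi1 I) x y. f = g)"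

section \<open>The left fundamental inverse category\<close>

definition pseudoinverse :: "('o, 'm) precategory \<Rightarrow> 'm \<Rightarrow> 'm \<Rightarrow> bool" where
  "pseudoinverse C f g \<longleftrightarrow>
     g \<in> hom C (tgt C f) (src C f) \<and> cmp C f (cmp C g f) = f \<and> cmp C g (cmp C f g) = g"

locale inverse_category = category C for C :: "('o, 'm) precategory" +
  assumes ex1_pseudoinverse: "f \<in> arr C \<Longrightarrow> \<exists>!g. pseudoinverse C f g"

definition pinv :: "('o, 'm) precategory \<Rightarrow> 'm \<Rightarrow> 'm" where
  "pinv C f = (THE g. pseudoinverse C f g)"

text \<open>The least congruence on words whose quotient is an inverse category under \<open>I\<close> in which every
  arrow of \<open>I\<close> becomes monic: the rules \<open>pinv\<close> and \<open>uniq\<close> make the reversed word the unique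
  pseudoinverse of a word. The universal property is proved at the end of this theory.\<close>

inductive_set left_rel :: "('o, 'm) precategory \<Rightarrow> ('o, 'm) word rel"
  for I :: "('o, 'm) precategory" where
  refl: "u \<in> arr (word_cat I) \<Longrightarrow> (u, u) \<in> left_rel I"
| sym: "(u, v) \<in> left_rel I \<Longrightarrow> (v, u) \<in> left_rel I"
| trans: "\<lbrakk>(u, v) \<in> left_rel I; (v, w) \<in> left_rel I\<rbrakk> \<Longrightarrow> (u, w) \<in> left_rel I"
| cong: "\<lbrakk>(u, u') \<in> left_rel I; (v, v') \<in> left_rel I; src (word_cat I) v = tgt (word_cat I) u\<rbrakk>
    \<Longrightarrow> (cmp (word_cat I) v u, cmp (word_cat I) v' u') \<in> left_rel I"
| idn: "x \<in> obj I \<Longrightarrow> (word_of I (idn I x), idn (word_cat I) x) \<in> left_rel I"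
| cmp: "\<lbrakk>i \<in> arr I; j \<in> arr I; src I j = tgt I i\<rbrakk>
    \<Longrightarrow> (word_of I (cmp I j i), cmp (word_cat I) (word_of I j) (word_of I i)) \<in> left_rel I"
| pinv: "u \<in> arr (word_cat I)
    \<Longrightarrow> (cmp (word_cat I) u (cmp (word_cat I) (word_inv u) u), u) \<in> left_rel I"
| uniq: "\<lbrakk>u \<in> arr (word_cat I); v \<in> hom (word_cat I) (tgt (word_cat I) u) (src (word_cat I) u);
      (cmp (word_cat I) u (cmp (word_cat I) v u), u) \<in> left_rel I;
      (cmp (word_cat I) v (cmp (word_cat I) u v), v) \<in> left_rel I\<rbrakk>
    \<Longrightarrow> (v, word_inv u) \<in> left_rel I"
| monic: "i \<in> arr I
    \<Longrightarrow> (cmp (word_cat I) (word_inv (word_of I i)) (word_of I i), idn (word_cat I) (src I i)) \<in> left_rel I"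

definition left_fundamental :: "('o, 'm) precategory \<Rightarrow> ('o, ('o, 'm) word set) precategory" where
  "left_fundamental I = quotient_cat (word_cat I) (left_rel I)"

definition left_eta :: "('o, 'm) precategory \<Rightarrow> 'm \<Rightarrow> ('o, 'm) word set" where
  "left_eta I i = left_rel I `` {word_of I i}"

definition upward_simply_connected :: "('o, 'm) precategory \<Rightarrow> bool" where
  "upward_simply_connected I \<longleftrightarrow>
     (\<forall>x\<in>obj I. \<forall>f\<in>hom (left_fundamental I) x x. cmp (left_fundamental I) f f = f)"

section \<open>Tree-like and forest-like posets\<close>

definition upward_closed_in :: "'p set \<Rightarrow> 'p rel \<Rightarrow> 'p set \<Rightarrow> bool" where
  "upward_closed_in P r U \<longleftrightarrow> U \<subseteq> P \<and> (\<forall>x\<in>U. \<forall>y\<in>P. (x, y) \<in> r \<longrightarrow> y \<in> U)"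

text \<open>Posets are given by a carrier and a relation, and the disjoint unions are internal (unions of
  pairwise disjoint carriers in one type), so that both classes are closed under isomorphism.\<close>

inductive tree_like :: "'p set \<Rightarrow> 'p rel \<Rightarrow> bool" where
  adjoin: "\<lbrakk>\<And>k. k < n \<Longrightarrow> tree_like (K k) (r k);
    disjoint_family_on K {..<n :: nat};
    \<And>k. k < n \<Longrightarrow> upward_closed_in (K k) (r k) (U k);
    \<And>k. k < n \<Longrightarrow> connected_cat (preorder_cat (U k) (r k));
    p \<notin> (\<Union>k<n. K k)\<rbrakk>
   \<Longrightarrow> tree_like (insert p (\<Union>k<n. K k)) ((\<Union>k<n. r k) \<union> {p} \<times> insert p (\<Union>k<n. U k))"

definition forest_like :: "'p set \<Rightarrow> 'p rel \<Rightarrow> bool" where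
  "forest_like P r \<longleftrightarrow>
     (\<exists>(n :: nat) K s. (\<forall>k<n. tree_like (K k) (s k)) \<and> disjoint_family_on K {..<n} \<and>
        P = (\<Union>k<n. K k) \<and> r = (\<Union>k<n. s k))"

section \<open>The universal property of the left fundamental inverse category\<close>

lemma homI: "f \<in> arr C \<Longrightarrow> src C f = x \<Longrightarrow> tgt C f = y \<Longrightarrow> f \<in> hom C x y"
  by (simp add: hom_def)

lemma homD: "f \<in> hom C x y \<Longrightarrow> f \<in> arr C \<and> src C f = x \<and> tgt C f = y"
  by (simp add: hom_def)

context category
begin

lemma hom_obj: "f \<in> hom C x y \<Longrightarrow> x \<in> obj C \<and> y \<in> obj C"
  using src_obj tgt_obj by (auto simp: hom_def)

lemma arr_hom: "f \<in> arr C \<Longrightarrow> f \<in> hom C (src C f) (tgt C f)"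
  by (simp add: hom_def)

end

lemma category_Inj: "category (Inj :: ('x set, 'x inj_arr) precategory)"
  by unfold_locales
    (auto simp: Inj_def hom_def compose_def inj_on_def PiE_iff extensional_def fun_eq_iff, metis+)

lemma category_preorder_cat:
  assumes "preorder_on P r"
  shows "category (preorder_cat P r)"
  using assms
  by unfold_locales
    (auto simp: preorder_cat_def hom_def preorder_on_def refl_on_def dest: transD)

lemma category_quotient_cat:
  assumes "category C" and "category_congruence C R"
  shows "category (quotient_cat C R)"
    and "f \<in> arr C \<Longrightarrow> src (quotient_cat C R) (R `` {f}) = src C f"
    and "f \<in> arr C \<Longrightarrow> tgt (quotient_cat C R) (R `` {f}) = tgt C f"
    and "\<lbrakk>f \<in> arr C; g \<in> arr C; src C g = tgt C f\<rbrakk>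
      \<Longrightarrow> cmp (quotient_cat C R) (R `` {g}) (R `` {f}) = R `` {cmp C g f}"
proof -
  interpret category C by fact
  have eq: "equiv (arr C) R"
    and st: "\<And>f f'. (f, f') \<in> R \<Longrightarrow> src C f = src C f' \<and> tgt C f = tgt C f'"
    and cg: "\<And>f f' g g'. \<lbrakk>(f, f') \<in> R; (g, g') \<in> R; src C g = tgt C f\<rbrakk>
      \<Longrightarrow> (cmp C g f, cmp C g' f') \<in> R"
    using assms(2) unfolding category_congruence_def by blast+
  have self: "(f, f) \<in> R" if "f \<in> arr C" for f
    using eq that by (auto simp: equiv_def refl_on_def)
  have cls: "R `` {f} = R `` {f'}" if "(f, f') \<in> R" for f f'
    using eq that by (rule equiv_class_eq)
  show S: "src (quotient_cat C R) (R `` {f}) = src C f" if "f \<in> arr C" for f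
  proof -
    have "src C g = src C f" if "g \<in> R `` {f}" for g
      using st[of f g] that by simp
    then have "src C ` (R `` {f}) = (\<lambda>_. src C f) ` (R `` {f})" by (intro image_cong) simp_all
    also have "\<dots> = {src C f}" using self[OF that] by (intro image_constant[of f]) simp
    finally have "src C ` (R `` {f}) = {src C f}" .
    then show ?thesis by (simp add: quotient_cat_def)
  qed
  show T: "tgt (quotient_cat C R) (R `` {f}) = tgt C f" if "f \<in> arr C" for f
  proof -
    have "tgt C g = tgt C f" if "g \<in> R `` {f}" for g
      using st[of f g] that by simp
    then have "tgt C ` (R `` {f}) = (\<lambda>_. tgt C f) ` (R `` {f})" by (intro image_cong) simp_all
    also have "\<dots> = {tgt C f}" using self[OF that] by (intro image_constant[of f]) simp
    finally have "tgt C ` (R `` {f}) = {tgt C f}" .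
    then show ?thesis by (simp add: quotient_cat_def)
  qed
  show M: "cmp (quotient_cat C R) (R `` {g}) (R `` {f}) = R `` {cmp C g f}"
    if "f \<in> arr C" "g \<in> arr C" "src C g = tgt C f" for f g
  proof -
    have "R `` {cmp C g' f'} = R `` {cmp C g f}" if "(f, f') \<in> R" "(g, g') \<in> R" for f' g'
      using cls[OF cg[OF that \<open>src C g = tgt C f\<close>]] by simp
    then have "(\<Union>f'\<in>R `` {f}. \<Union>g'\<in>R `` {g}. R `` {cmp C g' f'}) =
      (\<Union>f'\<in>R `` {f}. \<Union>g'\<in>R `` {g}. R `` {cmp C g f})"
      by (intro SUP_cong) simp_all
    moreover have "R `` {f} \<noteq> {}" "R `` {g} \<noteq> {}"
      using self[OF that(1)] self[OF that(2)] by blast+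
    ultimately show ?thesis by (simp add: quotient_cat_def)
  qed
  have O: "obj (quotient_cat C R) = obj C" and I: "idn (quotient_cat C R) x = R `` {idn C x}" for x
    by (simp_all add: quotient_cat_def)
  have A: "arr (quotient_cat C R) = {R `` {f} | f. f \<in> arr C}"
    by (auto simp: quotient_cat_def quotient_def)
  have H: "hom (quotient_cat C R) x y = {R `` {f} | f. f \<in> hom C x y}" for x y
    by (auto simp: hom_def A S T)
  show "category (quotient_cat C R)"
  proof
    fix x assume "x \<in> obj (quotient_cat C R)"
    then show "idn (quotient_cat C R) x \<in> hom (quotient_cat C R) x x"
      using idn_hom by (auto simp: O I H)
  next
    fix f x y assume "f \<in> hom (quotient_cat C R) x y"
    then obtain f' where f': "f = R `` {f'}" "f' \<in> hom C x y" by (auto simp: H)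
    have ids: "idn C x \<in> hom C x x" "idn C y \<in> hom C y y"
      using hom_obj[OF f'(2)] idn_hom by auto
    show "cmp (quotient_cat C R) f (idn (quotient_cat C R) x) = f"
      using f' ids M[of "idn C x" f'] cmp_idn_right[OF f'(2)] by (auto simp: I hom_def)
    show "cmp (quotient_cat C R) (idn (quotient_cat C R) y) f = f"
      using f' ids M[of f' "idn C y"] cmp_idn_left[OF f'(2)] by (auto simp: I hom_def)
  next
    fix f x y g z
    assume "f \<in> hom (quotient_cat C R) x y" "g \<in> hom (quotient_cat C R) y z"
    then obtain f' g' where "f = R `` {f'}" "f' \<in> hom C x y" "g = R `` {g'}" "g' \<in> hom C y z"
      by (auto simp: H)
    then show "cmp (quotient_cat C R) g f \<in> hom (quotient_cat C R) x z"
      using M[of f' g'] cmp_hom[of f' x y g' z] unfolding H by (auto dest: homD)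
  next
    fix f w x g y h z
    assume "f \<in> hom (quotient_cat C R) w x" "g \<in> hom (quotient_cat C R) x y"
      "h \<in> hom (quotient_cat C R) y z"
    then obtain f' g' h' where *: "f = R `` {f'}" "f' \<in> hom C w x" "g = R `` {g'}"
      "g' \<in> hom C x y" "h = R `` {h'}" "h' \<in> hom C y z"
      by (auto simp: H)
    note c = cmp_hom[OF *(2,4)] cmp_hom[OF *(4,6)]
    show "cmp (quotient_cat C R) h (cmp (quotient_cat C R) g f) =
      cmp (quotient_cat C R) (cmp (quotient_cat C R) h g) f"
      using * c cmp_assoc[OF *(2,4,6)] by (simp add: M hom_def)
  qed (auto simp: A O S T src_obj tgt_obj)
qed

lemma word_cat_simps [simp]:
  "obj (word_cat I) = obj I"
  "(x, w, y) \<in> arr (word_cat I) \<longleftrightarrow> path I x w y"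
  "src (word_cat I) (x, w, y) = x"
  "tgt (word_cat I) (x, w, y) = y"
  "idn (word_cat I) x = (x, [], x)"
  "cmp (word_cat I) (y', v, z) (x, w, y) = (x, w @ v, z)"
  "word_inv (x, w, y) = (y, rev (map flip w), x)"
  by (simp_all add: word_cat_def word_inv_def)

lemma flip_flip [simp]: "flip (flip l) = l"
  by (cases l) simp_all

lemma rev_map_flip [simp]: "rev (map flip (rev (map flip w))) = w"
  by (simp add: rev_map comp_def)

context category
begin

lemma path_obj: "path C x w y \<Longrightarrow> x \<in> obj C \<and> y \<in> obj C"
proof (induction w arbitrary: x)
  case (Cons l w)
  then show ?case by (cases l) (auto simp: src_obj tgt_obj)
qed auto

lemma path_append: "path C x (u @ v) z \<longleftrightarrow> (\<exists>y. path C x u y \<and> path C y v z)"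
proof (induction u arbitrary: x)
  case Nil
  then show ?case using path_obj by auto
next
  case (Cons l u)
  then show ?case by (cases l) auto
qed

lemma path_inv: "path C x w y \<Longrightarrow> path C y (rev (map flip w)) x"
proof (induction w arbitrary: x)
  case (Cons l w)
  then show ?case
    by (cases l) (auto simp: path_append src_obj tgt_obj)
qed auto

lemma category_word_cat: "category (word_cat C)"
  by unfold_locales (auto simp: hom_def path_append dest: path_obj)

lemma word_of_arr: "i \<in> arr C \<Longrightarrow> word_of C i \<in> hom (word_cat C) (src C i) (tgt C i)"
  by (simp add: word_of_def hom_def tgt_obj)

lemma word_inv_hom: "u \<in> hom (word_cat C) x y \<Longrightarrow> word_inv u \<in> hom (word_cat C) y x"
  by (cases u) (auto simp: hom_def path_inv)

lemma left_rel_hom: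
  "(u, v) \<in> left_rel C \<Longrightarrow>
    u \<in> hom (word_cat C) (src (word_cat C) u) (tgt (word_cat C) u) \<and>
    v \<in> hom (word_cat C) (src (word_cat C) u) (tgt (word_cat C) u)"
proof (induction rule: left_rel.induct)
  case (cmp i j)
  then have "cmp C j i \<in> hom C (src C i) (tgt C j)"
    by (intro cmp_hom[of _ _ "tgt C i"]) (auto simp: hom_def)
  then show ?case using cmp tgt_obj by (auto simp: word_of_def hom_def)
next
  case (idn x)
  then show ?case using idn_hom[of x] by (auto simp: word_of_def hom_def)
next
  case (uniq u v)
  then show ?case using word_inv_hom[of u] by (cases u, cases v) (auto simp: hom_def)
next
  case (pinv u)
  then show ?case by (cases u) (auto simp: hom_def path_append intro: path_inv)
next
  case (monic i)
  then show ?case by (auto simp: word_of_def hom_def src_obj)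
qed (auto simp: hom_def path_append)

lemma congruence_left_rel: "category_congruence (word_cat C) (left_rel C)"
proof -
  have "equiv (arr (word_cat C)) (left_rel C)"
  proof (rule equivI)
    show "left_rel C \<subseteq> arr (word_cat C) \<times> arr (word_cat C)"
      by (rule subrelI) (use left_rel_hom in \<open>auto simp: hom_def\<close>)
    show "refl_on (arr (word_cat C)) (left_rel C)"
      by (auto simp: refl_on_def intro: left_rel.refl)
  qed (auto intro!: symI transI intro: left_rel.sym left_rel.trans)
  moreover have "src (word_cat C) u = src (word_cat C) v \<and> tgt (word_cat C) u = tgt (word_cat C) v"
    if "(u, v) \<in> left_rel C" for u v
    using left_rel_hom[OF that] by (auto simp: hom_def)
  ultimately show ?thesis
    unfolding category_congruence_def by (blast intro: left_rel.cong)
qed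

lemmas left_quotient = category_quotient_cat[OF category_word_cat congruence_left_rel,
    folded left_fundamental_def]

end

context category
begin

lemma cmp_arr: "\<lbrakk>f \<in> arr C; g \<in> arr C; src C g = tgt C f\<rbrakk> \<Longrightarrow> cmp C g f \<in> arr C"
  and cmp_src: "\<lbrakk>f \<in> arr C; g \<in> arr C; src C g = tgt C f\<rbrakk> \<Longrightarrow> src C (cmp C g f) = src C f"
  and cmp_tgt: "\<lbrakk>f \<in> arr C; g \<in> arr C; src C g = tgt C f\<rbrakk> \<Longrightarrow> tgt C (cmp C g f) = tgt C g"
  using cmp_hom[of f "src C f" "tgt C f" g "tgt C g"] by (auto simp: hom_def)

lemma cmp_assoc':
  "\<lbrakk>f \<in> arr C; g \<in> arr C; h \<in> arr C; src C g = tgt C f; src C h = tgt C g\<rbrakk>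
    \<Longrightarrow> cmp C (cmp C h g) f = cmp C h (cmp C g f)"
  using cmp_assoc[of f "src C f" "tgt C f" g "tgt C g" h "tgt C h"] by (simp add: hom_def)

end

context inverse_category
begin

lemma pseudoinverse_unique: "\<lbrakk>f \<in> arr C; pseudoinverse C f g; pseudoinverse C f h\<rbrakk> \<Longrightarrow> g = h"
  using ex1_pseudoinverse by blast

lemma pinv_pseudoinverse: "f \<in> arr C \<Longrightarrow> pseudoinverse C f (pinv C f)"
  unfolding pinv_def using ex1_pseudoinverse by (rule theI')

lemma pinv_eqI: "\<lbrakk>f \<in> arr C; pseudoinverse C f g\<rbrakk> \<Longrightarrow> pinv C f = g"
  using pinv_pseudoinverse pseudoinverse_unique by blast

lemma idempotents_cmp:
  assumes e: "e \<in> hom C x x" "cmp C e e = e" and f: "f \<in> hom C x x" "cmp C f f = f"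
  shows "cmp C (cmp C e f) (cmp C e f) = cmp C e f"
proof -
  let ?E = "hom C x x"
  have cl: "cmp C p q \<in> ?E" if "p \<in> ?E" "q \<in> ?E" for p q
    using that cmp_hom by blast
  have as: "cmp C (cmp C p q) r = cmp C p (cmp C q r)" if "p \<in> ?E" "q \<in> ?E" "r \<in> ?E" for p q r
    using cmp_assoc[OF that(3,2,1)] by simp
  have ee: "cmp C e (cmp C e z) = cmp C e z" if "z \<in> ?E" for z
    using as[OF e(1) e(1) that] e(2) by simp
  have ff: "cmp C f (cmp C f z) = cmp C f z" if "z \<in> ?E" for z
    using as[OF f(1) f(1) that] f(2) by simp
  have efE: "cmp C e f \<in> ?E" using cl e f by blast
  have ps: "pseudoinverse C p q \<longleftrightarrow>
      q \<in> ?E \<and> cmp C p (cmp C q p) = p \<and> cmp C q (cmp C p q) = q" if "p \<in> ?E" for p q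
    using that by (auto simp: pseudoinverse_def hom_def)
  have efA: "cmp C e f \<in> arr C" using efE by (simp add: hom_def)
  define a where "a = pinv C (cmp C e f)"
  have a: "pseudoinverse C (cmp C e f) a"
    unfolding a_def using efA by (rule pinv_pseudoinverse)
  then have aE: "a \<in> ?E"
    and a1: "cmp C e (cmp C f (cmp C a (cmp C e f))) = cmp C e f"
    and a2: "cmp C a (cmp C e (cmp C f a)) = a"
    using e f by (auto simp: ps[OF efE] as cl)
  have a2': "cmp C a (cmp C e (cmp C f (cmp C a z))) = cmp C a z" if "z \<in> ?E" for z
    using arg_cong[OF a2, of "\<lambda>p. cmp C p z"] that aE e f by (simp add: as cl)
  have "pseudoinverse C (cmp C e f) (cmp C f (cmp C a e))"
    using e f aE a1 a2' by (simp add: ps[OF efE] as cl ee ff)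
  with a have fae: "a = cmp C f (cmp C a e)"
    by (rule pseudoinverse_unique[OF efA])
  have aa: "cmp C a a = a"
  proof -
    have "cmp C (cmp C f (cmp C a e)) (cmp C f (cmp C a e)) = cmp C f (cmp C a e)"
      using e f aE a2' by (simp add: as cl)
    then show ?thesis using fae by simp
  qed
  have "pseudoinverse C a a" "pseudoinverse C a (cmp C e f)"
    using a aE aa efE by (simp_all add: ps)
  then have "a = cmp C e f"
    using pseudoinverse_unique[of a] aE by (simp add: hom_def)
  with aa show ?thesis by simp
qed

lemma idempotents_commute:
  assumes e: "e \<in> hom C x x" "cmp C e e = e" and f: "f \<in> hom C x x" "cmp C f f = f"
  shows "cmp C e f = cmp C f e"
proof -
  let ?E = "hom C x x"
  have cl: "cmp C p q \<in> ?E" if "p \<in> ?E" "q \<in> ?E" for p q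
    using that cmp_hom by blast
  have as: "cmp C (cmp C p q) r = cmp C p (cmp C q r)" if "p \<in> ?E" "q \<in> ?E" "r \<in> ?E" for p q r
    using cmp_assoc[OF that(3,2,1)] by simp
  have ee: "cmp C e (cmp C e z) = cmp C e z" if "z \<in> ?E" for z
    using as[OF e(1) e(1) that] e(2) by simp
  have ff: "cmp C f (cmp C f z) = cmp C f z" if "z \<in> ?E" for z
    using as[OF f(1) f(1) that] f(2) by simp
  have efE: "cmp C e f \<in> ?E" and feE: "cmp C f e \<in> ?E" using cl e f by blast+
  have ps: "pseudoinverse C p q \<longleftrightarrow>
      q \<in> ?E \<and> cmp C p (cmp C q p) = p \<and> cmp C q (cmp C p q) = q" if "p \<in> ?E" for p q
    using that by (auto simp: pseudoinverse_def hom_def)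
  have i1: "cmp C e (cmp C f (cmp C e f)) = cmp C e f"
    using idempotents_cmp[OF e f] e f by (simp add: as cl)
  have i2: "cmp C f (cmp C e (cmp C f e)) = cmp C f e"
    using idempotents_cmp[OF f e] e f by (simp add: as cl)
  have "pseudoinverse C (cmp C e f) (cmp C f e)" "pseudoinverse C (cmp C e f) (cmp C e f)"
    using e f i1 i2 by (simp_all add: ps[OF efE] as cl ee ff)
  then show ?thesis
    using pseudoinverse_unique[of "cmp C e f"] efE by (simp add: hom_def)
qed

lemma pseudoinverse_cmp:
  assumes "f \<in> hom C x y" "pseudoinverse C f f'"
    and "g \<in> hom C y z" "pseudoinverse C g g'"
  shows "pseudoinverse C (cmp C g f) (cmp C f' g')"
proof -
  have f: "f \<in> arr C" "src C f = x" "tgt C f = y"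
    and f': "f' \<in> arr C" "src C f' = y" "tgt C f' = x"
    and ff: "cmp C f (cmp C f' f) = f" "cmp C f' (cmp C f f') = f'"
    and g: "g \<in> arr C" "src C g = y" "tgt C g = z"
    and g': "g' \<in> arr C" "src C g' = z" "tgt C g' = y"
    and gg: "cmp C g (cmp C g' g) = g" "cmp C g' (cmp C g g') = g'"
    using assms by (auto simp: pseudoinverse_def hom_def)
  note st = f f' g g' cmp_arr cmp_src cmp_tgt
  note as = cmp_assoc'
  let ?p = "cmp C f f'" and ?q = "cmp C g' g"
  have "?p \<in> hom C y y" "?q \<in> hom C y y"
    by (simp_all add: hom_def st)
  moreover have "cmp C ?p ?p = ?p" "cmp C ?q ?q = ?q"
    by (simp_all add: as st ff gg)
  ultimately have pq: "cmp C ?p ?q = cmp C ?q ?p"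
    by (intro idempotents_commute)
  have pqz: "cmp C f (cmp C f' (cmp C g' (cmp C g w))) = cmp C g' (cmp C g (cmp C f (cmp C f' w)))"
    if "w \<in> arr C" "tgt C w = y" for w
    using arg_cong[OF pq, of "\<lambda>r. cmp C r w"] that by (simp add: as st)
  have gz: "cmp C g (cmp C g' (cmp C g w)) = cmp C g w" if "w \<in> arr C" "tgt C w = y" for w
    using arg_cong[OF gg(1), of "\<lambda>r. cmp C r w"] that by (simp add: as st)
  have fz: "cmp C f' (cmp C f (cmp C f' w)) = cmp C f' w" if "w \<in> arr C" "tgt C w = y" for w
    using arg_cong[OF ff(2), of "\<lambda>r. cmp C r w"] that by (simp add: as st)
  have "cmp C (cmp C g f) (cmp C (cmp C f' g') (cmp C g f)) = cmp C g f"
    by (simp add: as st pqz gz ff)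
  moreover have "cmp C (cmp C f' g') (cmp C (cmp C g f) (cmp C f' g')) = cmp C f' g'"
    by (simp add: as st pqz[symmetric] fz gg)
  ultimately show ?thesis
    by (simp add: pseudoinverse_def hom_def st)
qed

end

context category
begin

lemma left_class_eq: "\<lbrakk>u \<in> arr (word_cat C); left_rel C `` {u} = left_rel C `` {v}\<rbrakk> \<Longrightarrow> (v, u) \<in> left_rel C"
  using left_rel.refl[of u C] by blast

lemma left_class_eqI: "(u, v) \<in> left_rel C \<Longrightarrow> left_rel C `` {u} = left_rel C `` {v}"
  by (intro set_eqI) (auto intro: left_rel.sym left_rel.trans)

lemma left_fundamental_obj [simp]: "obj (left_fundamental C) = obj C"
  and left_fundamental_idn [simp]: "idn (left_fundamental C) x = left_rel C `` {(x, [], x)}"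
  by (simp_all add: left_fundamental_def quotient_cat_def)

lemma left_class_arr: "u \<in> arr (word_cat C) \<Longrightarrow> left_rel C `` {u} \<in> arr (left_fundamental C)"
  by (simp add: left_fundamental_def quotient_cat_def quotientI)

lemma left_arrE:
  assumes "c \<in> arr (left_fundamental C)"
  obtains u where "u \<in> arr (word_cat C)" "c = left_rel C `` {u}"
  using assms by (auto simp: left_fundamental_def quotient_cat_def elim!: quotientE)

lemma pseudoinverse_word_inv:
  assumes "u \<in> arr (word_cat C)"
  shows "pseudoinverse (left_fundamental C) (left_rel C `` {u}) (left_rel C `` {word_inv u})"
proof -
  interpret W: category "word_cat C" by (rule category_word_cat)
  let ?v = "word_inv u"
  have v: "?v \<in> arr (word_cat C)" "word_inv ?v = u"
    "src (word_cat C) ?v = tgt (word_cat C) u" "tgt (word_cat C) ?v = src (word_cat C) u"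
    using assms by (cases u; auto simp: path_inv)+
  have e1: "left_rel C `` {cmp (word_cat C) u (cmp (word_cat C) ?v u)} = left_rel C `` {u}"
    using left_rel.pinv[OF assms] by (rule left_class_eqI)
  have e2: "left_rel C `` {cmp (word_cat C) ?v (cmp (word_cat C) u ?v)} = left_rel C `` {?v}"
    using left_rel.pinv[OF v(1)] v(2) by (intro left_class_eqI) simp
  note s = assms v(1,3,4) W.cmp_arr W.cmp_src W.cmp_tgt
  show ?thesis
    unfolding pseudoinverse_def hom_def
    by (simp add: left_quotient(2-4) left_class_arr s e1 e2)
qed

lemma inverse_category_left_fundamental: "inverse_category (left_fundamental C)"
proof (intro inverse_category.intro inverse_category_axioms.intro left_quotient(1))
  fix f assume "f \<in> arr (left_fundamental C)"
  then obtain u where u: "u \<in> arr (word_cat C)" "f = left_rel C `` {u}"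
    by (rule left_arrE)
  show "\<exists>!g. pseudoinverse (left_fundamental C) f g"
  proof
    show "pseudoinverse (left_fundamental C) f (left_rel C `` {word_inv u})"
      using pseudoinverse_word_inv u by simp
  next
    fix g assume g: "pseudoinverse (left_fundamental C) f g"
    then have "g \<in> arr (left_fundamental C)" by (simp add: pseudoinverse_def hom_def)
    then obtain v where v: "v \<in> arr (word_cat C)" "g = left_rel C `` {v}"
      by (rule left_arrE)
    interpret W: category "word_cat C" by (rule category_word_cat)
    have st: "src (word_cat C) v = tgt (word_cat C) u" "tgt (word_cat C) v = src (word_cat C) u"
      using g u v by (auto simp: pseudoinverse_def hom_def left_quotient(2,3))
    note s = u(1) v(1) st W.cmp_arr W.cmp_src W.cmp_tgt
    have "left_rel C `` {cmp (word_cat C) u (cmp (word_cat C) v u)} = left_rel C `` {u}"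
      "left_rel C `` {cmp (word_cat C) v (cmp (word_cat C) u v)} = left_rel C `` {v}"
      using g unfolding pseudoinverse_def u(2) v(2) by (simp_all add: left_quotient(4) s)
    then have "(cmp (word_cat C) u (cmp (word_cat C) v u), u) \<in> left_rel C"
      "(cmp (word_cat C) v (cmp (word_cat C) u v), v) \<in> left_rel C"
      by (metis left_class_eq left_rel.sym s(1,2))+
    then have "(v, word_inv u) \<in> left_rel C"
      by (intro left_rel.uniq) (simp_all add: s hom_def)
    then show "g = left_rel C `` {word_inv u}"
      using v(2) left_class_eqI by simp
  qed
qed

lemma word_of_facts:
  assumes "i \<in> arr C"
  shows "word_of C i \<in> arr (word_cat C)" "src (word_cat C) (word_of C i) = src C i"
    "tgt (word_cat C) (word_of C i) = tgt C i"
  using word_of_arr[OF assms] by (simp_all add: hom_def)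

lemma functor_left_eta: "is_functor C (left_fundamental C) (\<lambda>x. x) (left_eta C)"
proof -
  have "left_eta C (cmp C j i) = cmp (left_fundamental C) (left_eta C j) (left_eta C i)"
    if "i \<in> arr C" "j \<in> arr C" "src C j = tgt C i" for i j
    using left_rel.cmp[OF that] that unfolding left_eta_def
    by (simp add: left_quotient(4) word_of_facts left_class_eqI)
  moreover have "left_eta C (idn C x) = idn (left_fundamental C) x" if "x \<in> obj C" for x
    using left_rel.idn[OF that] by (simp add: left_eta_def left_class_eqI)
  moreover have "left_eta C i \<in> hom (left_fundamental C) (src C i) (tgt C i)" if "i \<in> arr C" for i
    using that by (simp add: left_eta_def hom_def left_class_arr left_quotient(2,3) word_of_facts)
  ultimately show ?thesis by (simp add: is_functor_def)
qed

lemma left_eta_monic: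
  assumes "i \<in> arr C"
  shows "cmp (left_fundamental C) (pinv (left_fundamental C) (left_eta C i)) (left_eta C i) =
    idn (left_fundamental C) (src C i)"
proof -
  interpret L: inverse_category "left_fundamental C"
    by (rule inverse_category_left_fundamental)
  have arr: "left_eta C i \<in> arr (left_fundamental C)"
    using functor_left_eta assms by (simp add: is_functor_def hom_def)
  have "pinv (left_fundamental C) (left_eta C i) = left_rel C `` {word_inv (word_of C i)}"
    using L.pinv_eqI[OF arr] pseudoinverse_word_inv word_of_facts(1)[OF assms]
    by (simp add: left_eta_def)
  moreover have "word_inv (word_of C i) \<in> arr (word_cat C)"
    "src (word_cat C) (word_inv (word_of C i)) = tgt (word_cat C) (word_of C i)"
    using word_inv_hom[OF word_of_arr[OF assms]] word_of_facts(3)[OF assms] by (simp_all add: hom_def)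
  ultimately show ?thesis
    using left_rel.monic[OF assms]
    by (simp add: left_eta_def left_quotient(4) word_of_facts assms left_class_eqI)
qed

end

primrec word_eval ::
  "('o, 'm) precategory \<Rightarrow> ('p, 'n) precategory \<Rightarrow> ('o \<Rightarrow> 'p) \<Rightarrow> ('m \<Rightarrow> 'n) \<Rightarrow> 'o \<Rightarrow> 'm letter list \<Rightarrow> 'n"
  where
  "word_eval I D Fo Fa x [] = idn D (Fo x)"
| "word_eval I D Fo Fa x (l # w) =
     (case l of
        Fwd i \<Rightarrow> cmp D (word_eval I D Fo Fa (tgt I i) w) (Fa i)
      | Bwd i \<Rightarrow> cmp D (word_eval I D Fo Fa (src I i) w) (pinv D (Fa i)))"

locale monic_functor =
  I: category I + D: inverse_category D
  for I :: "('o, 'm) precategory" and D :: "('p, 'n) precategory" +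
  fixes Fo :: "'o \<Rightarrow> 'p" and Fa :: "'m \<Rightarrow> 'n"
  assumes F: "is_functor I D Fo Fa"
    and monic: "i \<in> arr I \<Longrightarrow> cmp D (pinv D (Fa i)) (Fa i) = idn D (Fo (src I i))"
begin

abbreviation "ev \<equiv> word_eval I D Fo Fa"

lemma Fo_obj: "x \<in> obj I \<Longrightarrow> Fo x \<in> obj D"
  and Fa_hom: "i \<in> arr I \<Longrightarrow> Fa i \<in> hom D (Fo (src I i)) (Fo (tgt I i))"
  and Fa_idn: "x \<in> obj I \<Longrightarrow> Fa (idn I x) = idn D (Fo x)"
  and Fa_cmp: "\<lbrakk>i \<in> arr I; j \<in> arr I; src I j = tgt I i\<rbrakk> \<Longrightarrow> Fa (cmp I j i) = cmp D (Fa j) (Fa i)"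
  using F by (auto simp: is_functor_def)

lemma pinv_Fa:
  assumes "i \<in> arr I"
  shows "pseudoinverse D (Fa i) (pinv D (Fa i))"
    and "pinv D (Fa i) \<in> hom D (Fo (tgt I i)) (Fo (src I i))"
proof -
  show *: "pseudoinverse D (Fa i) (pinv D (Fa i))"
    using D.pinv_pseudoinverse Fa_hom[OF assms] by (simp add: hom_def)
  show "pinv D (Fa i) \<in> hom D (Fo (tgt I i)) (Fo (src I i))"
    using * Fa_hom[OF assms] by (auto simp: pseudoinverse_def hom_def)
qed

lemma pseudoinverse_sym: "\<lbrakk>f \<in> hom D a b; pseudoinverse D f g\<rbrakk> \<Longrightarrow> pseudoinverse D g f"
  by (auto simp: pseudoinverse_def hom_def)

lemma ev_hom: "path I x w y \<Longrightarrow> ev x w \<in> hom D (Fo x) (Fo y)"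
proof (induction w arbitrary: x)
  case Nil
  then have "x \<in> obj I" "x = y" by auto
  then show ?case using D.idn_hom[OF Fo_obj] by simp
next
  case (Cons l w)
  then show ?case
    by (cases l) (auto intro: D.cmp_hom Fa_hom pinv_Fa(2))
qed

lemma ev_append:
  "\<lbrakk>path I x u y; path I y v z\<rbrakk> \<Longrightarrow> ev x (u @ v) = cmp D (ev y v) (ev x u)"
proof (induction u arbitrary: x)
  case Nil
  then show ?case using D.cmp_idn_right[OF ev_hom[of y v z]] by simp
next
  case (Cons l u)
  show ?case
  proof (cases l)
    case (Fwd i)
    with Cons show ?thesis
      using D.cmp_assoc[OF Fa_hom[of i] ev_hom[of "tgt I i" u y] ev_hom[of y v z]] by simp
  next
    case (Bwd i)
    with Cons show ?thesis
      using D.cmp_assoc[OF pinv_Fa(2)[of i] ev_hom[of "src I i" u y] ev_hom[of y v z]] by simp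
  qed
qed

lemma ev_Fwd: "i \<in> arr I \<Longrightarrow> ev x [Fwd i] = Fa i"
  using D.cmp_idn_left[OF Fa_hom] by simp

lemma ev_Bwd: "i \<in> arr I \<Longrightarrow> ev x [Bwd i] = pinv D (Fa i)"
  using D.cmp_idn_left[OF pinv_Fa(2)] by simp

lemma ev_inv: "path I x w y \<Longrightarrow> pseudoinverse D (ev x w) (ev y (rev (map flip w)))"
proof (induction w arbitrary: x)
  case Nil
  then have "x \<in> obj I" by auto
  then have h: "idn D (Fo x) \<in> hom D (Fo x) (Fo x)" by (intro D.idn_hom Fo_obj)
  then show ?case
    using Nil D.cmp_idn_left[OF h] by (auto simp: pseudoinverse_def hom_def)
next
  case (Cons l w)
  show ?case
  proof (cases l)
    case (Fwd i)
    with Cons have i: "i \<in> arr I" "src I i = x" and w: "path I (tgt I i) w y" by auto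
    have "pseudoinverse D (cmp D (ev (tgt I i) w) (Fa i))
        (cmp D (pinv D (Fa i)) (ev y (rev (map flip w))))"
      using D.pseudoinverse_cmp[OF Fa_hom[OF i(1)] pinv_Fa(1)[OF i(1)] ev_hom[OF w] Cons.IH[OF w]] .
    moreover have "ev y (rev (map flip w) @ [Bwd i]) =
        cmp D (ev (tgt I i) [Bwd i]) (ev y (rev (map flip w)))"
      using I.path_inv[OF w] i I.src_obj by (intro ev_append[where z = x]) auto
    ultimately show ?thesis using Fwd ev_Bwd[OF i(1)] by simp
  next
    case (Bwd i)
    with Cons have i: "i \<in> arr I" "tgt I i = x" and w: "path I (src I i) w y" by auto
    have s: "pseudoinverse D (pinv D (Fa i)) (Fa i)"
      using pseudoinverse_sym[OF Fa_hom[OF i(1)] pinv_Fa(1)[OF i(1)]] .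
    have "pseudoinverse D (cmp D (ev (src I i) w) (pinv D (Fa i)))
        (cmp D (Fa i) (ev y (rev (map flip w))))"
      using D.pseudoinverse_cmp[OF pinv_Fa(2)[OF i(1)] s ev_hom[OF w] Cons.IH[OF w]] .
    moreover have "ev y (rev (map flip w) @ [Fwd i]) =
        cmp D (ev (src I i) [Fwd i]) (ev y (rev (map flip w)))"
      using I.path_inv[OF w] i I.tgt_obj by (intro ev_append[where z = x]) auto
    ultimately show ?thesis using Bwd ev_Fwd[OF i(1)] by simp
  qed
qed

definition eval :: "('o, 'm) word \<Rightarrow> 'n" where
  "eval = (\<lambda>(x, w, y). ev x w)"

lemma eval_hom: "u \<in> arr (word_cat I) \<Longrightarrow>
    eval u \<in> hom D (Fo (src (word_cat I) u)) (Fo (tgt (word_cat I) u))"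
  by (cases u) (simp add: eval_def ev_hom)

lemma eval_cmp:
  "\<lbrakk>u \<in> arr (word_cat I); v \<in> arr (word_cat I); src (word_cat I) v = tgt (word_cat I) u\<rbrakk>
    \<Longrightarrow> eval (cmp (word_cat I) v u) = cmp D (eval v) (eval u)"
  by (cases u, cases v) (auto simp: eval_def intro: ev_append)

lemma eval_inv: "u \<in> arr (word_cat I) \<Longrightarrow> pseudoinverse D (eval u) (eval (word_inv u))"
  by (cases u) (simp add: eval_def ev_inv)

lemma eval_word_of: "i \<in> arr I \<Longrightarrow> eval (word_of I i) = Fa i"
  using ev_Fwd[of i "src I i"] by (simp add: eval_def word_of_def)

lemma eval_left_rel: "(u, v) \<in> left_rel I \<Longrightarrow> eval u = eval v"
proof (induction rule: left_rel.induct)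
  case (cong u u' v v')
  have "u' \<in> arr (word_cat I)" "v' \<in> arr (word_cat I)" "src (word_cat I) v' = tgt (word_cat I) u'"
    "u \<in> arr (word_cat I)" "v \<in> arr (word_cat I)"
    using I.left_rel_hom[OF cong.hyps(1)] I.left_rel_hom[OF cong.hyps(2)] cong.hyps(3)
    by (auto simp: hom_def)
  then show ?case using cong by (simp add: eval_cmp)
next
  case (idn x)
  have "idn I x \<in> arr I" using I.idn_hom[OF idn] by (simp add: hom_def)
  then show ?case using idn Fa_idn eval_word_of by (simp add: eval_def)
next
  case (cmp i j)
  then have "cmp I j i \<in> arr I" by (intro I.cmp_arr)
  then show ?case
    using cmp Fa_cmp by (simp add: eval_word_of eval_cmp I.word_of_facts)
next
  case (pinv u)
  obtain x w y where u: "u = (x, w, y)" by (cases u)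
  have p: "path I x w y" "path I y (rev (map flip w)) x" using pinv I.path_inv by (simp_all add: u)
  then have "eval (cmp (word_cat I) u (cmp (word_cat I) (word_inv u) u)) =
      cmp D (eval u) (cmp D (eval (word_inv u)) (eval u))"
    using ev_append[OF p(1), of "rev (map flip w) @ w" y] ev_append[OF p(2), of w y]
      ev_append[OF p] D.cmp_assoc[OF ev_hom[OF p(1)] ev_hom[OF p(2)] ev_hom[OF p(1)]]
      I.path_append by (auto simp: u eval_def)
  then show ?case using eval_inv[OF pinv] by (simp add: pseudoinverse_def)
next
  case (uniq u v)
  interpret W: category "word_cat I" by (rule I.category_word_cat)
  have v: "v \<in> arr (word_cat I)" "src (word_cat I) v = tgt (word_cat I) u"
    "tgt (word_cat I) v = src (word_cat I) u" using uniq(2) by (auto simp: hom_def)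
  note s = uniq(1) v W.cmp_arr W.cmp_src W.cmp_tgt
  have "pseudoinverse D (eval u) (eval v)"
    using uniq.IH eval_hom[OF uniq(1)] eval_hom[OF v(1)] v
    by (auto simp: pseudoinverse_def hom_def eval_cmp s)
  then show ?case
    using D.pseudoinverse_unique[of "eval u"] eval_inv[OF uniq(1)] eval_hom[OF uniq(1)]
    by (simp add: hom_def)
next
  case (monic i)
  have "eval (word_inv (word_of I i)) = pinv D (Fa i)"
    using ev_Bwd[OF monic, of "tgt I i"] by (simp add: eval_def word_of_def)
  moreover have "word_inv (word_of I i) \<in> hom (word_cat I) (tgt I i) (src I i)"
    using I.word_inv_hom[OF I.word_of_arr[OF monic]] .
  ultimately show ?case
    using monic_functor.monic[OF monic_functor_axioms monic] monic
    by (simp add: eval_cmp I.word_of_facts eval_word_of hom_def) (simp add: eval_def)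
qed simp_all

lemma functor_eval_unique:
  assumes G: "is_functor (left_fundamental I) D Fo Ga"
    and ext: "\<And>i. i \<in> arr I \<Longrightarrow> Ga (left_eta I i) = Fa i"
  shows "path I x w y \<Longrightarrow> Ga (left_rel I `` {(x, w, y)}) = ev x w"
proof (induction w arbitrary: x)
  case Nil
  then have "Ga (idn (left_fundamental I) x) = idn D (Fo x)"
    using G unfolding is_functor_def I.left_fundamental_obj by auto
  with Nil show ?case by simp
next
  case (Cons l w)
  have Gc: "Ga (left_rel I `` {cmp (word_cat I) v u}) = cmp D (Ga (left_rel I `` {v})) (Ga (left_rel I `` {u}))"
    if "u \<in> arr (word_cat I)" "v \<in> arr (word_cat I)" "src (word_cat I) v = tgt (word_cat I) u" for u v
  proof -
    have "left_rel I `` {u} \<in> arr (left_fundamental I)" "left_rel I `` {v} \<in> arr (left_fundamental I)"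
      using that by (simp_all add: I.left_class_arr)
    then have "Ga (cmp (left_fundamental I) (left_rel I `` {v}) (left_rel I `` {u})) =
        cmp D (Ga (left_rel I `` {v})) (Ga (left_rel I `` {u}))"
      using G that unfolding is_functor_def by (simp add: I.left_quotient(2,3))
    then show ?thesis using that by (simp add: I.left_quotient(4))
  qed
  have Gi: "Ga (left_rel I `` {word_of I i}) = Fa i" if "i \<in> arr I" for i
    using ext[OF that] by (simp add: left_eta_def)
  show ?case
  proof (cases l)
    case (Fwd i)
    with Cons have i: "i \<in> arr I" "src I i = x" and w: "path I (tgt I i) w y" by auto
    show ?thesis
      using Gc[of "word_of I i" "(tgt I i, w, y)"] Cons.IH[OF w] w i Gi
      by (simp add: I.word_of_facts) (simp add: word_of_def Fwd)
  next
    case (Bwd i)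
    with Cons have i: "i \<in> arr I" "tgt I i = x" and w: "path I (src I i) w y" by auto
    let ?u = "word_of I i"
    have a: "?u \<in> arr (word_cat I)" "word_inv ?u \<in> arr (word_cat I)"
      "src (word_cat I) (word_inv ?u) = tgt I i" "tgt (word_cat I) (word_inv ?u) = src I i"
      using I.word_of_facts[OF i(1)] I.word_inv_hom[OF I.word_of_arr[OF i(1)]] by (simp_all add: hom_def)
    have L: "left_rel I `` {?u} \<in> arr (left_fundamental I)"
      "left_rel I `` {word_inv ?u} \<in> arr (left_fundamental I)"
      using a by (simp_all add: I.left_class_arr)
    interpret W: category "word_cat I" by (rule I.category_word_cat)
    have e: "left_rel I `` {cmp (word_cat I) ?u (cmp (word_cat I) (word_inv ?u) ?u)} = left_rel I `` {?u}"
      "left_rel I `` {cmp (word_cat I) (word_inv ?u) (cmp (word_cat I) ?u (word_inv ?u))} =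
        left_rel I `` {word_inv ?u}"
      using left_rel.pinv[OF a(1)] left_rel.pinv[OF a(2)]
      by (auto intro!: I.left_class_eqI simp: word_of_def)
    note s = a I.word_of_facts[OF i(1)] W.cmp_arr W.cmp_src W.cmp_tgt
    have "Ga (left_rel I `` {word_inv ?u}) \<in> hom D (Fo (tgt I i)) (Fo (src I i))"
      using G L(2) unfolding is_functor_def by (auto simp: I.left_quotient(2,3) a)
    moreover have "cmp D (Fa i) (cmp D (Ga (left_rel I `` {word_inv ?u})) (Fa i)) = Fa i"
      using arg_cong[OF e(1), of Ga] by (simp add: Gc s Gi i)
    moreover have "cmp D (Ga (left_rel I `` {word_inv ?u})) (cmp D (Fa i) (Ga (left_rel I `` {word_inv ?u})))
        = Ga (left_rel I `` {word_inv ?u})"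
      using arg_cong[OF e(2), of Ga] by (simp add: Gc s Gi i)
    ultimately have "pseudoinverse D (Fa i) (Ga (left_rel I `` {word_inv ?u}))"
      using Fa_hom[OF i(1)] by (simp add: pseudoinverse_def hom_def)
    then have p: "Ga (left_rel I `` {word_inv ?u}) = pinv D (Fa i)"
      using D.pinv_eqI[of "Fa i"] Fa_hom[OF i(1)] by (simp add: hom_def)
    show ?thesis
      using Gc[of "word_inv ?u" "(src I i, w, y)"] Cons.IH[OF w] w i p a
      by simp (simp add: word_of_def Bwd)
  qed
qed

lemma left_fundamental_universal:
  "\<exists>Ga. is_functor (left_fundamental I) D Fo Ga \<and> (\<forall>i\<in>arr I. Ga (left_eta I i) = Fa i)"
  "\<lbrakk>is_functor (left_fundamental I) D Fo Ga; \<forall>i\<in>arr I. Ga (left_eta I i) = Fa i;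
    is_functor (left_fundamental I) D Fo Gb; \<forall>i\<in>arr I. Gb (left_eta I i) = Fa i;
    c \<in> arr (left_fundamental I)\<rbrakk> \<Longrightarrow> Ga c = Gb c"
proof -
  define Ga where "Ga c = eval (SOME u. u \<in> c)" for c
  have Ga: "Ga (left_rel I `` {u}) = eval u" if "u \<in> arr (word_cat I)" for u
  proof -
    have "u \<in> left_rel I `` {u}"
      using left_rel.refl[OF that] by simp
    then have "(SOME v. v \<in> left_rel I `` {u}) \<in> left_rel I `` {u}"
      by (rule someI)
    then have "(u, SOME v. v \<in> left_rel I `` {u}) \<in> left_rel I" by blast
    from eval_left_rel[OF this] show ?thesis by (simp add: Ga_def)
  qed
  interpret W: category "word_cat I" by (rule I.category_word_cat)
  have "Ga c \<in> hom D (Fo (src (left_fundamental I) c)) (Fo (tgt (left_fundamental I) c))"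
    if c: "c \<in> arr (left_fundamental I)" for c
  proof -
    obtain u where "u \<in> arr (word_cat I)" "c = left_rel I `` {u}"
      using c by (rule I.left_arrE)
    then show ?thesis using eval_hom[of u] by (simp add: I.left_quotient(2,3) Ga)
  qed
  moreover have "Ga (idn (left_fundamental I) x) = idn D (Fo x)" if "x \<in> obj I" for x
    using that by (simp add: Ga) (simp add: eval_def)
  moreover have "Ga (cmp (left_fundamental I) d c) = cmp D (Ga d) (Ga c)"
    if cd: "c \<in> arr (left_fundamental I)" "d \<in> arr (left_fundamental I)"
      "src (left_fundamental I) d = tgt (left_fundamental I) c" for c d
  proof -
    obtain u where "u \<in> arr (word_cat I)" "c = left_rel I `` {u}"
      using cd(1) by (rule I.left_arrE)
    moreover obtain v where "v \<in> arr (word_cat I)" "d = left_rel I `` {v}"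
      using cd(2) by (rule I.left_arrE)
    ultimately show ?thesis
      using cd(3) by (simp add: I.left_quotient(2-4) Ga W.cmp_arr eval_cmp)
  qed
  ultimately have "is_functor (left_fundamental I) D Fo Ga"
    using Fo_obj by (simp add: is_functor_def)
  moreover have "\<forall>i\<in>arr I. Ga (left_eta I i) = Fa i"
    by (simp add: left_eta_def Ga I.word_of_facts eval_word_of)
  ultimately show "\<exists>Ga. is_functor (left_fundamental I) D Fo Ga \<and> (\<forall>i\<in>arr I. Ga (left_eta I i) = Fa i)"
    by blast
next
  assume *: "is_functor (left_fundamental I) D Fo Ga" "\<forall>i\<in>arr I. Ga (left_eta I i) = Fa i"
    "is_functor (left_fundamental I) D Fo Gb" "\<forall>i\<in>arr I. Gb (left_eta I i) = Fa i"
    "c \<in> arr (left_fundamental I)"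
  obtain u where u: "u \<in> arr (word_cat I)" "c = left_rel I `` {u}"
    using *(5) by (rule I.left_arrE)
  obtain x w y where "u = (x, w, y)" by (cases u)
  with u have "path I x w y" "c = left_rel I `` {(x, w, y)}" by simp_all
  then show "Ga c = Gb c"
    using functor_eval_unique[OF *(1)] functor_eval_unique[OF *(3)] *(2,4) by simp
qed

end

end

theory Submission
  imports Defs "HOL-Library.Countable_Set"
begin

text \<open>
  Every word in the arrows of \<open>I\<close> and their inverses acts on a diagram of injections as a partial
  injection (a zigzag), and this action respects the defining relations of the left fundamental inverse
  category. So if \<open>I\<close> is upward-simply-connected, all loops act as partial
  identities. Conversely, a loop acts on the representable diagram of the left fundamental category by
  composition, so a cocone over that diagram, or over the finite part of it that a zigzag visits, makes the
  loop idempotent.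

  For the passage to an arbitrary category \<open>C\<close> with the AP, identify two parallel arrows of \<open>C\<close> when some
  further arrow equalizes them. By the AP the quotient is a category with the AP in which all arrows are
  monic; it embeds into sets and injections by \<open>x \<mapsto> {arrows into x}\<close>, so parallel arrows of an
  upward-simply-connected \<open>I\<close> have equal images, and the diagram factors through the finite poset that is
  the skeleton of the preorder reflection of \<open>I\<close>. The upward-closed subsets of that poset are
  simply-connected, hence it is forest-like (remove a minimal point and detect a disconnected set above it
  by a cocycle modulo 2), and over a forest-like poset cocones are built by amalgamation from the top.
  As \<open>I\<close> is finitely generated, the cocone lifts from the quotient to \<open>C\<close>.

  Sets and injections form a category with the AP and the JEP, but its arrows need not fit into the given
  types; a Loewenheim-Skolem argument cuts a category with AP and JEP down to a countable one.
\<close>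

section \<open>Diagrams of injections\<close>

text \<open>The diagrams that drive the argument take values in classes of words or in arrows of a
  category, so the value type is left free here; a diagram is carried into the type of
  \<open>Inj\<close> by an injection only where a hypothesis on \<open>Inj\<close> is applied. Three
  of them have one origin: a functor with left-cancellable arrows, to the left fundamental category,
  to the monic quotient or to the fundamental groupoid, turned into sets by taking all arrows into
  an object.

  Partial injections are suitable values because they form an inverse semigroup whose idempotents
  are the partial identities: idempotence of a loop becomes the statement that it moves no point.

  The categories in (i) live on fixed types that may be merely countably infinite, whereas
  \<open>Inj\<close> has uncountably many objects. This obstacle is the reason for all the
  countability arguments. For the AP alone, connectedness is tested on discrete categories with at
  most two objects, which are countable from the start.

  For posets, the return from forest-like to upward-simply-connected is not a computation with
  words; it runs through cocones in \<open>Inj\<close>.\<close>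

locale injective_diagram = category I for I :: "('o, 'm) precategory" +
  fixes A :: "'o \<Rightarrow> 'y set" and m :: "'m \<Rightarrow> 'y \<Rightarrow> 'y"
  assumes map_in: "\<lbrakk>i \<in> arr I; a \<in> A (src I i)\<rbrakk> \<Longrightarrow> m i a \<in> A (tgt I i)"
    and map_inj: "i \<in> arr I \<Longrightarrow> inj_on (m i) (A (src I i))"
    and map_idn: "\<lbrakk>x \<in> obj I; a \<in> A x\<rbrakk> \<Longrightarrow> m (idn I x) a = a"
    and map_cmp: "\<lbrakk>i \<in> arr I; j \<in> arr I; src I j = tgt I i; a \<in> A (src I i)\<rbrakk>
      \<Longrightarrow> m (cmp I j i) a = m j (m i a)"

text \<open>Relations rather than functions, because a backward letter acts only on the image of
  \<open>m i\<close>. Words and \<open>O\<close> are both read from left to right, so concatenation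
  turns into \<open>O\<close> without reversal.\<close>

primrec zigzag ::
  "('o, 'm) precategory \<Rightarrow> ('o \<Rightarrow> 'y set) \<Rightarrow> ('m \<Rightarrow> 'y \<Rightarrow> 'y) \<Rightarrow> 'o \<Rightarrow> 'm letter list \<Rightarrow> 'y rel"
  where
  "zigzag I A m x [] = Id_on (A x)"
| "zigzag I A m x (l # w) =
     (case l of
        Fwd i \<Rightarrow> {(a, m i a) |a. a \<in> A (src I i)} O zigzag I A m (tgt I i) w
      | Bwd i \<Rightarrow> {(m i a, a) |a. a \<in> A (src I i)} O zigzag I A m (src I i) w)"

context injective_diagram
begin

abbreviation "zz \<equiv> zigzag I A m"

lemma zigzag_subset: "path I x w y \<Longrightarrow> zz x w \<subseteq> A x \<times> A y"
proof (induction w arbitrary: x)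
  case (Cons l w)
  then show ?case by (cases l) (use map_in in fastforce)+
qed auto

lemma zigzag_append: "\<lbrakk>path I x u y; path I y v z\<rbrakk> \<Longrightarrow> zz x (u @ v) = zz x u O zz y v"
proof (induction u arbitrary: x)
  case Nil
  then have "zz x v \<subseteq> A x \<times> A z" "x = y" using zigzag_subset by auto
  then show ?case by auto
next
  case (Cons l u)
  then show ?case by (cases l) (auto simp: O_assoc)
qed

lemma zigzag_inv: "path I x w y \<Longrightarrow> zz y (rev (map flip w)) = (zz x w)\<inverse>"
proof (induction w arbitrary: x)
  case (Cons l w)
  show ?case
  proof (cases l)
    case (Fwd i)
    with Cons.prems have i: "i \<in> arr I" "src I i = x" and w: "path I (tgt I i) w y" by auto
    have p: "path I (tgt I i) [Bwd i] x" using i src_obj by auto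
    show ?thesis
      using zigzag_append[OF path_inv[OF w] p] Cons.IH[OF w] i map_in[OF i(1)]
      by (fastforce simp: Fwd)
  next
    case (Bwd i)
    with Cons.prems have i: "i \<in> arr I" "tgt I i = x" and w: "path I (src I i) w y" by auto
    have p: "path I (src I i) [Fwd i] x" using i tgt_obj by auto
    show ?thesis
      using zigzag_append[OF path_inv[OF w] p] Cons.IH[OF w] i map_in[OF i(1)]
      by (fastforce simp: Bwd)
  qed
qed auto

text \<open>Injectivity of the maps enters through the backward letters, whose converse graphs would
  otherwise be multivalued.\<close>

lemma zigzag_functional: "path I x w y \<Longrightarrow> single_valued (zz x w)"
proof (induction w arbitrary: x)
  case (Cons l w)
  show ?case
  proof (cases l)
    case (Fwd i)
    with Cons have "single_valued (zz (tgt I i) w)" by simp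
    then show ?thesis using Fwd by (auto simp: single_valued_def)
  next
    case (Bwd i)
    with Cons have "single_valued (zz (src I i) w)" "inj_on (m i) (A (src I i))"
      using map_inj by auto
    then show ?thesis using Bwd by (auto simp: single_valued_def dest: inj_onD)
  qed
qed (auto simp: single_valued_def)

lemma zigzag_injective: "path I x w y \<Longrightarrow> single_valued ((zz x w)\<inverse>)"
  using zigzag_functional[OF path_inv] by (simp add: zigzag_inv)

definition zz_word :: "('o, 'm) word \<Rightarrow> 'y rel" where
  "zz_word = (\<lambda>(x, w, y). zz x w)"

lemma zz_word_cmp:
  "\<lbrakk>u \<in> arr (word_cat I); v \<in> arr (word_cat I); src (word_cat I) v = tgt (word_cat I) u\<rbrakk>
    \<Longrightarrow> zz_word (cmp (word_cat I) v u) = zz_word u O zz_word v"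
  by (cases u, cases v) (auto simp: zz_word_def zigzag_append)

lemma zz_word_inv: "u \<in> arr (word_cat I) \<Longrightarrow> zz_word (word_inv u) = (zz_word u)\<inverse>"
  by (cases u) (auto simp: zz_word_def zigzag_inv)

lemma zz_word_injective:
  "u \<in> arr (word_cat I) \<Longrightarrow> single_valued (zz_word u) \<and> single_valued ((zz_word u)\<inverse>)"
  by (cases u) (auto simp: zz_word_def intro: zigzag_functional zigzag_injective)

end

section \<open>Partial injections as an inverse semigroup\<close>

lemma partial_injection_pseudoinverse:
  assumes "single_valued (R\<inverse>)"
  shows "(R O R\<inverse>) O R = R"
  using assms by (auto simp: single_valued_def)

text \<open>A pair \<open>(a, b)\<close> of \<open>S\<close> factors as a chain through
  \<open>S\<close>, \<open>R\<close>, \<open>S\<close>. Functionality identifies the second point of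
  the chain with \<open>b\<close>, injectivity the third with \<open>a\<close>, which leaves
  \<open>(b, a)\<close> in \<open>R\<close>. The other inclusion is symmetric.\<close>

lemma partial_injection_pseudoinverse_unique:
  assumes "single_valued R" "single_valued (R\<inverse>)" "single_valued S" "single_valued (S\<inverse>)"
    and "(R O S) O R = R" "(S O R) O S = S"
  shows "S = R\<inverse>"
proof (rule set_eqI, clarify)
  fix a b
  have "(b, a) \<in> R" if ab: "(a, b) \<in> S"
  proof -
    have "(a, b) \<in> (S O R) O S" using ab assms(6) by simp
    then obtain c d where "(a, c) \<in> S" "(c, d) \<in> R" "(d, b) \<in> S" by blast
    then show ?thesis using ab assms(3,4) unfolding single_valued_def by blast
  qed
  moreover have "(a, b) \<in> S" if ba: "(b, a) \<in> R"
  proof -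
    have "(b, a) \<in> (R O S) O R" using ba assms(5) by simp
    then obtain c d where "(b, c) \<in> R" "(c, d) \<in> S" "(d, a) \<in> R" by blast
    then show ?thesis using ba assms(1,2) unfolding single_valued_def by blast
  qed
  ultimately show "(a, b) \<in> S \<longleftrightarrow> (a, b) \<in> R\<inverse>" by auto
qed

context injective_diagram
begin

text \<open>The rules \<open>pinv\<close> and \<open>uniq\<close> hold because partial injections
  have their converses as unique pseudoinverses; \<open>monic\<close> holds because
  \<open>m i\<close> is defined and injective on the whole set over the source of
  \<open>i\<close>.\<close>

lemma zz_word_left_rel: "(u, v) \<in> left_rel I \<Longrightarrow> zz_word u = zz_word v"
proof (induction rule: left_rel.induct)
  case (cong u u' v v')
  have "u' \<in> arr (word_cat I)" "v' \<in> arr (word_cat I)" "src (word_cat I) v' = tgt (word_cat I) u'"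
    "u \<in> arr (word_cat I)" "v \<in> arr (word_cat I)"
    using left_rel_hom[OF cong.hyps(1)] left_rel_hom[OF cong.hyps(2)] cong.hyps(3)
    by (auto simp: hom_def)
  then show ?case using cong by (simp add: zz_word_cmp)
next
  case (idn x)
  have "idn I x \<in> arr I" "src I (idn I x) = x" "tgt I (idn I x) = x"
    using idn_hom[OF idn] by (simp_all add: hom_def)
  then show ?case using map_idn[OF idn] idn by (auto simp: zz_word_def word_of_def)
next
  case (cmp i j)
  then have "src I (cmp I j i) = src I i" "tgt I (cmp I j i) = tgt I j"
    by (simp_all add: cmp_src cmp_tgt)
  then show ?case
    using cmp map_cmp[OF cmp] map_in by (fastforce simp: zz_word_def word_of_def)
next
  case (pinv u)
  interpret W: category "word_cat I" by (rule category_word_cat)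
  have i: "word_inv u \<in> arr (word_cat I)" "src (word_cat I) (word_inv u) = tgt (word_cat I) u"
    "tgt (word_cat I) (word_inv u) = src (word_cat I) u"
    using word_inv_hom[of u "src (word_cat I) u" "tgt (word_cat I) u"] pinv
    by (auto simp: hom_def)
  note s = pinv i W.cmp_arr W.cmp_src W.cmp_tgt
  show ?case
    using zz_word_injective[OF pinv]
    by (simp add: s zz_word_cmp zz_word_inv partial_injection_pseudoinverse)
next
  case (uniq u v)
  interpret W: category "word_cat I" by (rule category_word_cat)
  have v: "v \<in> arr (word_cat I)" "src (word_cat I) v = tgt (word_cat I) u"
    "tgt (word_cat I) v = src (word_cat I) u" using uniq(2) by (auto simp: hom_def)
  note s = uniq(1) v W.cmp_arr W.cmp_src W.cmp_tgt
  show ?case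
    using zz_word_injective[OF uniq(1)] zz_word_injective[OF v(1)] uniq.IH
    by (simp add: s zz_word_cmp zz_word_inv partial_injection_pseudoinverse_unique)
next
  case (monic i)
  then show ?case
    using map_inj[OF monic] by (auto simp: zz_word_def word_of_def dest: inj_onD)
qed simp_all

text \<open>An idempotent partial injection is a partial identity: if \<open>(a, b)\<close> factors
  through \<open>c\<close>, functionality gives \<open>c = b\<close>, and injectivity then gives
  \<open>a = b\<close>.\<close>

lemma zigzag_loop:
  assumes "upward_simply_connected I" "path I x w x"
  shows "zz x w \<subseteq> Id"
proof -
  let ?u = "(x, w, x)" and ?L = "left_fundamental I"
  have u: "?u \<in> arr (word_cat I)" and x: "x \<in> obj I" using assms(2) path_obj by auto
  then have "left_rel I `` {?u} \<in> hom ?L x x"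
    by (simp add: hom_def left_class_arr left_quotient(2,3))
  then have "cmp ?L (left_rel I `` {?u}) (left_rel I `` {?u}) = left_rel I `` {?u}"
    using assms(1) x unfolding upward_simply_connected_def by blast
  then have "left_rel I `` {cmp (word_cat I) ?u ?u} = left_rel I `` {?u}"
    using u left_quotient(4)[of ?u ?u] by simp
  then have "(cmp (word_cat I) ?u ?u, ?u) \<in> left_rel I"
    using left_class_eq[OF u] left_rel.sym by metis
  then have e: "zz x w O zz x w = zz x w"
    using zz_word_left_rel zz_word_cmp[OF u u] by (force simp: zz_word_def)
  have f: "single_valued (zz x w)" "single_valued ((zz x w)\<inverse>)"
    using zigzag_functional zigzag_injective assms(2) by blast+
  show ?thesis
  proof (rule subrelI)
    fix a b assume ab: "(a, b) \<in> zz x w"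
    then obtain c where "(a, c) \<in> zz x w" "(c, b) \<in> zz x w" using e by blast
    then show "(a, b) \<in> Id" using ab f unfolding single_valued_def by blast
  qed
qed

end

text \<open>One run of a zigzag tests membership of finitely many points, which \<open>S\<close>
  records together with their objects. The family \<open>A'\<close> is arbitrary here; closing it
  under the arrows is left to \<open>finite_subdiagram\<close>.\<close>

lemma zigzag_finite_trace:
  assumes "category I" "(a, b) \<in> zigzag I A m x w" "path I x w y"
  shows "\<exists>S. finite S \<and> S \<subseteq> Sigma (obj I) A \<and>
    (\<forall>A'. (\<forall>(z, c)\<in>S. c \<in> A' z) \<longrightarrow> (a, b) \<in> zigzag I A' m x w)"
  using assms(2,3)
proof (induction w arbitrary: a x)
  case Nil
  then show ?case by (intro exI[of _ "{(x, a)}"]) auto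
next
  case (Cons l w)
  interpret category I by fact
  show ?case
  proof (cases l)
    case (Fwd i)
    then have *: "(m i a, b) \<in> zigzag I A m (tgt I i) w" "a \<in> A (src I i)"
      "path I (tgt I i) w y" "src I i = x" "src I i \<in> obj I"
      using Cons.prems src_obj by auto
    from Cons.IH[OF *(1,3)] obtain S where "finite S" "S \<subseteq> Sigma (obj I) A"
      "\<forall>A'. (\<forall>(z, c)\<in>S. c \<in> A' z) \<longrightarrow> (m i a, b) \<in> zigzag I A' m (tgt I i) w" by blast
    then show ?thesis
      using * by (intro exI[of _ "insert (src I i, a) S"]) (auto simp: Fwd)
  next
    case (Bwd i)
    then obtain c where *: "(c, b) \<in> zigzag I A m (src I i) w" "c \<in> A (src I i)" "m i c = a"
      "path I (src I i) w y" "src I i \<in> obj I"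
      using Cons.prems src_obj by auto
    from Cons.IH[OF *(1,4)] obtain S where "finite S" "S \<subseteq> Sigma (obj I) A"
      "\<forall>A'. (\<forall>(z, c)\<in>S. c \<in> A' z) \<longrightarrow> (c, b) \<in> zigzag I A' m (src I i) w" by blast
    then show ?thesis
      using * by (intro exI[of _ "insert (src I i, c) S"]) (auto simp: Bwd)
  qed
qed

context injective_diagram
begin

lemma finite_subdiagram:
  assumes fin: "finite (arr I)" and ab: "(a, b) \<in> zz x w" and w: "path I x w y"
  shows "\<exists>A'. injective_diagram I A' m \<and> (\<forall>z. A' z \<subseteq> A z \<and> finite (A' z)) \<and>
    (a, b) \<in> zigzag I A' m x w"
proof -
  obtain S where S: "finite S" "S \<subseteq> Sigma (obj I) A"
    "\<And>A'. (\<forall>(z, c)\<in>S. c \<in> A' z) \<Longrightarrow> (a, b) \<in> zigzag I A' m x w"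
    using zigzag_finite_trace[OF category_axioms ab w] by metis
  \<comment> \<open>One application of every arrow is already closed, since arrows compose, and the
    identities put \<open>S\<close> itself into \<open>A'\<close>.\<close>
  define A' where "A' z = {m i c |i c. i \<in> arr I \<and> tgt I i = z \<and> (src I i, c) \<in> S}" for z
  have sub: "A' z \<subseteq> A z" for z using S(2) map_in by (force simp: A'_def)
  have "A' z \<subseteq> (\<lambda>(i, p). m i (snd p)) ` (arr I \<times> S)" for z by (force simp: A'_def)
  then have "finite (A' z)" for z
    by (rule finite_subset) (use fin S(1) in simp)
  moreover have "c \<in> A' z" if "(z, c) \<in> S" for z c
  proof -
    have "z \<in> obj I" "c \<in> A z" using that S(2) by auto
    then show ?thesis
      using that idn_hom[of z] map_idn[of z c] unfolding A'_def
      by (intro CollectI exI[of _ "idn I z"] exI[of _ c]) (simp add: hom_def)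
  qed
  moreover have "injective_diagram I A' m"
  proof
    fix i a assume i: "i \<in> arr I" "a \<in> A' (src I i)"
    then obtain j c where j: "j \<in> arr I" "tgt I j = src I i" "(src I j, c) \<in> S" "a = m j c"
      by (auto simp: A'_def)
    moreover have "c \<in> A (src I j)" using j S(2) by auto
    ultimately have "m i a = m (cmp I i j) c" using i map_cmp by simp
    then show "m i a \<in> A' (tgt I i)" using i j cmp_arr[of j i] cmp_tgt[of j i] cmp_src[of j i]
      by (force simp: A'_def)
  next
    fix i assume "i \<in> arr I"
    then show "inj_on (m i) (A' (src I i))" using map_inj sub inj_on_subset by blast
  qed (use sub map_idn map_cmp in blast)+
  ultimately show ?thesis using S(3)[of A'] sub by (intro exI[of _ A']) blast
qed

text \<open>Change of value type: this is how a diagram of classes of words becomes a diagram of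
  subsets of the type underlying \<open>Inj\<close> without losing the run under study.\<close>

lemma image_diagram:
  fixes e :: "'y \<Rightarrow> 'x"
  assumes e: "inj_on e (\<Union>x\<in>obj I. A x)"
  defines "A' \<equiv> \<lambda>x. e ` A x"
    and "m' \<equiv> \<lambda>i. e \<circ> m i \<circ> inv_into (\<Union>x\<in>obj I. A x) e"
  shows "injective_diagram I A' m'"
    and "\<lbrakk>(a, b) \<in> zz x w; path I x w y\<rbrakk> \<Longrightarrow> (e a, e b) \<in> zigzag I A' m' x w"
proof -
  have m': "m' i (e a) = e (m i a)" if "i \<in> arr I" "a \<in> A (src I i)" for i a
  proof -
    have "a \<in> (\<Union>x\<in>obj I. A x)" using that src_obj by blast
    from inv_into_f_f[OF e this] show ?thesis by (simp add: m'_def)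
  qed
  have e': "a = b" if "a \<in> A x" "b \<in> A y" "e a = e b" "x \<in> obj I" "y \<in> obj I" for a b x y
    using that e by (auto dest!: inj_onD)
  show "injective_diagram I A' m'"
  proof
    fix i assume i: "i \<in> arr I"
    show "inj_on (m' i) (A' (src I i))"
    proof (rule inj_onI)
      fix p q assume "p \<in> A' (src I i)" "q \<in> A' (src I i)" and eq: "m' i p = m' i q"
      then obtain a b where ab: "p = e a" "a \<in> A (src I i)" "q = e b" "b \<in> A (src I i)"
        by (auto simp: A'_def)
      then have "e (m i a) = e (m i b)" using m'[OF i] eq by simp
      then have "m i a = m i b" using e'[OF map_in[OF i] map_in[OF i]] ab tgt_obj[OF i] by blast
      then show "p = q" using ab inj_onD[OF map_inj[OF i]] by blast
    qed
  next
    fix x a assume "x \<in> obj I" "a \<in> A' x"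
    then show "m' (idn I x) a = a"
      using m'[of "idn I x"] map_idn[of x] idn_hom[of x] by (auto simp: A'_def hom_def)
  next
    fix i j a assume *: "i \<in> arr I" "j \<in> arr I" "src I j = tgt I i" "a \<in> A' (src I i)"
    then obtain c where c: "a = e c" "c \<in> A (src I i)" by (auto simp: A'_def)
    have "m i c \<in> A (src I j)" using map_in * c by simp
    then show "m' (cmp I j i) a = m' j (m' i a)"
      using * c m' map_cmp cmp_arr cmp_src by simp
  qed (auto simp: A'_def m' map_in)
  show "(e a, e b) \<in> zigzag I A' m' x w" if "(a, b) \<in> zz x w" "path I x w y"
    using that
  proof (induction w arbitrary: a x)
    case (Cons l w)
    show ?case
    proof (cases l)
      case (Fwd i)
      then have *: "(m i a, b) \<in> zz (tgt I i) w" "a \<in> A (src I i)" "path I (tgt I i) w y" "i \<in> arr I"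
        using Cons.prems by auto
      then have "(e a, m' i (e a)) \<in> {(a, m' i a) |a. a \<in> A' (src I i)}" by (auto simp: A'_def)
      then show ?thesis using Cons.IH[OF *(1,3)] m'[OF *(4,2)] by (auto simp: Fwd)
    next
      case (Bwd i)
      then obtain c where *: "(c, b) \<in> zz (src I i) w" "c \<in> A (src I i)" "path I (src I i) w y"
        "i \<in> arr I" "a = m i c"
        using Cons.prems by auto
      then have "(m' i (e c), e c) \<in> {(m' i a, a) |a. a \<in> A' (src I i)}" by (auto simp: A'_def)
      then have "(e a, e c) \<in> {(m' i a, a) |a. a \<in> A' (src I i)}" using m'[OF *(4,2)] *(5) by simp
      then show ?thesis using Cons.IH[OF *(1,3)] by (simp only: Bwd zigzag.simps letter.case relcompI)
    qed
  qed (auto simp: A'_def)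
qed

end

text \<open>The covariant embedding that sends an object to the set of all arrows into it;
  left-cancellability of \<open>Fa i\<close> is what makes composition with it injective.\<close>

lemma functor_injective_diagram:
  assumes I: "category I" and Q: "category Q" and F: "is_functor I Q Fo Fa"
    and monic: "\<And>i a b. \<lbrakk>i \<in> arr I; a \<in> arr Q; b \<in> arr Q; tgt Q a = Fo (src I i); tgt Q b = Fo (src I i);
      cmp Q (Fa i) a = cmp Q (Fa i) b\<rbrakk> \<Longrightarrow> a = b"
  shows "injective_diagram I (\<lambda>x. {a \<in> arr Q. tgt Q a = Fo x}) (\<lambda>i. cmp Q (Fa i))"
proof -
  interpret I: category I by fact
  interpret Q: category Q by fact
  note F' = F[unfolded is_functor_def]
  have h: "Fa i \<in> arr Q" "src Q (Fa i) = Fo (src I i)" "tgt Q (Fa i) = Fo (tgt I i)" if "i \<in> arr I" for i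
    using F' that by (auto simp: hom_def)
  show ?thesis
  proof
    fix i assume "i \<in> arr I"
    then show "inj_on (cmp Q (Fa i)) {a \<in> arr Q. tgt Q a = Fo (src I i)}"
      using monic by (auto intro!: inj_onI)
  next
    fix x a assume "x \<in> obj I" "a \<in> {a \<in> arr Q. tgt Q a = Fo x}"
    then show "cmp Q (Fa (idn I x)) a = a"
      using F' Q.cmp_idn_left[of a "src Q a" "Fo x"] by (auto simp: hom_def)
  next
    fix i j a assume "i \<in> arr I" "j \<in> arr I" "src I j = tgt I i" "a \<in> {a \<in> arr Q. tgt Q a = Fo (src I i)}"
    then show "cmp Q (Fa (cmp I j i)) a = cmp Q (Fa j) (cmp Q (Fa i) a)"
      using F' by (auto simp: h Q.cmp_assoc')
  qed (auto simp: h Q.cmp_arr Q.cmp_tgt)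
qed

context injective_diagram
begin

text \<open>The loop that goes back along \<open>i\<close> and forward along \<open>j\<close> takes
  \<open>m i a\<close> to \<open>a\<close> and then to \<open>m j a\<close>.\<close>

lemma parallel_maps_eq:
  assumes "upward_simply_connected I" "i \<in> arr I" "j \<in> arr I" "src I i = src I j" "tgt I i = tgt I j"
    and "a \<in> A (src I i)"
  shows "m i a = m j a"
proof -
  have p: "path I (tgt I i) [Bwd i, Fwd j] (tgt I i)" using assms tgt_obj src_obj by auto
  have "(m i a, m j a) \<in> zz (tgt I i) [Bwd i, Fwd j]"
    using assms map_in[of j a] by auto
  then show ?thesis using zigzag_loop[OF assms(1) p] by auto
qed

end

section \<open>Amalgamation and joint embedding\<close>

definition amalgamates :: "('o, 'm) precategory \<Rightarrow> 'm \<Rightarrow> 'm \<Rightarrow> 'm \<Rightarrow> 'm \<Rightarrow> bool" where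
  "amalgamates C f g h k \<longleftrightarrow> h \<in> arr C \<and> k \<in> arr C \<and> src C h = tgt C f \<and> src C k = tgt C g \<and>
     tgt C h = tgt C k \<and> cmp C h f = cmp C k g"

lemma preorder_cat_simps [simp]:
  "obj (preorder_cat P r) = P" "arr (preorder_cat P r) = r \<inter> P \<times> P"
  "src (preorder_cat P r) = fst" "tgt (preorder_cat P r) = snd"
  "idn (preorder_cat P r) x = (x, x)" "cmp (preorder_cat P r) g f = (fst f, snd g)"
  by (simp_all add: preorder_cat_def)

lemma hom_preorder_cat: "hom (preorder_cat P r) x y = {(x, y)} \<inter> r \<inter> P \<times> P"
  by (auto simp: hom_def)

lemma has_AP_iff:
  assumes "category C"
  shows "has_AP C \<longleftrightarrow> (\<forall>f\<in>arr C. \<forall>g\<in>arr C. src C f = src C g \<longrightarrow> (\<exists>h k. amalgamates C f g h k))"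
    (is "_ \<longleftrightarrow> ?R")
proof
  interpret category C by fact
  let ?S = "{0, 1, 2 :: nat}" and ?r = "{(0,0), (1,1), (2,2), (0,1), (0,2 :: nat)}"
  show ?R if ap: "has_AP C"
  proof (intro ballI impI)
    fix f g assume fg: "f \<in> arr C" "g \<in> arr C" "src C f = src C g"
    define Fo where "Fo n = (if n = 0 then src C f else if n = 1 then tgt C f else tgt C g)" for n :: nat
    define Fa where "Fa p = (if p = (0, 1) then f else if p = (0, 2) then g else idn C (Fo (fst p)))"
      for p :: "nat \<times> nat"
    have o: "src C f \<in> obj C" "tgt C f \<in> obj C" "tgt C g \<in> obj C" using fg src_obj tgt_obj by auto
    have i: "idn C x \<in> arr C \<and> src C (idn C x) = x \<and> tgt C (idn C x) = x" if "x \<in> obj C" for x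
      using idn_hom[OF that] by (auto simp: hom_def)
    have c: "cmp C f (idn C (src C f)) = f" "cmp C (idn C (tgt C f)) f = f" "cmp C g (idn C (src C g)) = g"
      "cmp C (idn C (tgt C g)) g = g"
      using cmp_idn_left[OF arr_hom[OF fg(1)]] cmp_idn_left[OF arr_hom[OF fg(2)]]
        cmp_idn_right[OF arr_hom[OF fg(1)]] cmp_idn_right[OF arr_hom[OF fg(2)]] by auto
    have ii: "cmp C (idn C x) (idn C x) = idn C x" if "x \<in> obj C" for x
      using cmp_idn_left[OF idn_hom[OF that]] .
    have "is_functor (preorder_cat ?S ?r) C Fo Fa"
      using fg o i[OF o(1)] i[OF o(2)] i[OF o(3)] c ii[OF o(1)] ii[OF o(2)] ii[OF o(3)] unfolding is_functor_def
      by (simp add: Fo_def Fa_def hom_def)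
    then obtain X t where "is_cocone (preorder_cat ?S ?r) C Fo Fa X t"
      using ap unfolding has_AP_def diagrams_have_cocones_def has_cocone_def by blast
    then show "\<exists>h k. amalgamates C f g h k"
      unfolding is_cocone_def amalgamates_def
      by (intro exI[of _ "t 1"] exI[of _ "t 2"]) (auto simp: Fo_def Fa_def hom_def)
  qed
  show "has_AP C" if ?R
    unfolding has_AP_def diagrams_have_cocones_def
  proof (intro allI impI)
    fix Fo Fa assume F: "is_functor (preorder_cat ?S ?r) C Fo Fa"
    have Fa: "Fa (0, 1) \<in> hom C (Fo 0) (Fo 1)" "Fa (0, 2) \<in> hom C (Fo 0) (Fo 2)"
      and Fi: "Fa (0, 0) = idn C (Fo 0)" "Fa (1, 1) = idn C (Fo 1)" "Fa (2, 2) = idn C (Fo 2)"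
      using F unfolding is_functor_def by simp_all
    then obtain h k where hk: "amalgamates C (Fa (0, 1)) (Fa (0, 2)) h k"
      using \<open>?R\<close> by (fastforce simp: hom_def)
    then have h: "h \<in> hom C (Fo 1) (tgt C h)" and k: "k \<in> hom C (Fo 2) (tgt C h)"
      using Fa by (auto simp: amalgamates_def hom_def)
    note m = cmp_hom[OF Fa(1) h]
    have "is_cocone (preorder_cat ?S ?r) C Fo Fa (tgt C h)
        (\<lambda>n. if n = 0 then cmp C h (Fa (0, 1)) else if n = 1 then h else k)"
      unfolding is_cocone_def
      using h k m hk hom_obj[OF h] cmp_idn_right[OF h] cmp_idn_right[OF k] cmp_idn_right[OF m] Fi
      by (simp add: amalgamates_def)
    then show "has_cocone (preorder_cat ?S ?r) C Fo Fa" unfolding has_cocone_def by blast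
  qed
qed

lemma joint_embedding_finite:
  assumes C: "category C" and ne: "obj C \<noteq> {}"
    and bin: "\<And>x y. \<lbrakk>x \<in> obj C; y \<in> obj C\<rbrakk> \<Longrightarrow> \<exists>z. hom C x z \<noteq> {} \<and> hom C y z \<noteq> {}"
    and fin: "finite S"
  shows "\<forall>k\<in>S. X k \<in> obj C \<Longrightarrow> \<exists>Y\<in>obj C. \<forall>k\<in>S. hom C (X k) Y \<noteq> {}"
  using fin
proof (induction S)
  case empty
  then show ?case using ne by auto
next
  case (insert a S)
  interpret category C by fact
  from insert obtain Y where Y: "Y \<in> obj C" "\<forall>k\<in>S. hom C (X k) Y \<noteq> {}" by auto
  then obtain Z where Z: "hom C (X a) Z \<noteq> {}" "hom C Y Z \<noteq> {}" using bin[of "X a" Y] insert by auto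
  have "hom C (X k) Z \<noteq> {}" if "k \<in> S" for k
    using Y(2) Z(2) that cmp_hom by (metis ex_in_conv)
  then show ?case using Z hom_obj by (intro bexI[of _ Z]) auto
qed

text \<open>The empty shape yields an object and the two-point shape the binary condition;
  conversely, finitely many objects are joined one at a time.\<close>

lemma has_JEP_iff:
  assumes "category C"
  shows "has_JEP C \<longleftrightarrow> obj C \<noteq> {} \<and> (\<forall>x\<in>obj C. \<forall>y\<in>obj C. \<exists>z. hom C x z \<noteq> {} \<and> hom C y z \<noteq> {})"
proof (intro iffI conjI ballI)
  interpret category C by fact
  assume "has_JEP C"
  then have J: "has_cocone (preorder_cat S (Id_on S)) C Fo Fa"
    if "finite S" "is_functor (preorder_cat S (Id_on S)) C Fo Fa" for S :: "nat set" and Fo Fa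
    using that unfolding has_JEP_def diagrams_have_cocones_def by blast
  show "obj C \<noteq> {}"
    using J[of "{}"] by (auto simp: is_functor_def has_cocone_def is_cocone_def)
  fix x y assume xy: "x \<in> obj C" "y \<in> obj C"
  define Fo where "Fo n = (if n = 0 then x else y)" for n :: nat
  have "Fo n \<in> obj C" for n using xy by (simp add: Fo_def)
  then have "is_functor (preorder_cat {0, 1} (Id_on {0, 1})) C Fo (\<lambda>p. idn C (Fo (fst p)))"
    using idn_hom cmp_idn_left[OF idn_hom] by (auto simp: is_functor_def)
  from J[OF _ this] obtain X t where "is_cocone (preorder_cat {0, 1} (Id_on {0, 1})) C Fo
      (\<lambda>p. idn C (Fo (fst p))) X t"
    unfolding has_cocone_def by auto
  then have "t 0 \<in> hom C x X" "t 1 \<in> hom C y X" unfolding is_cocone_def by (auto simp: Fo_def)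
  then show "\<exists>z. hom C x z \<noteq> {} \<and> hom C y z \<noteq> {}" by blast
next
  interpret category C by fact
  assume bin: "obj C \<noteq> {} \<and> (\<forall>x\<in>obj C. \<forall>y\<in>obj C. \<exists>z. hom C x z \<noteq> {} \<and> hom C y z \<noteq> {})"
  show "has_JEP C"
    unfolding has_JEP_def diagrams_have_cocones_def
  proof (intro allI impI)
    fix S :: "nat set" and Fo Fa
    assume S: "finite S" and F: "is_functor (preorder_cat S (Id_on S)) C Fo Fa"
    then have "\<forall>k\<in>S. Fo k \<in> obj C" by (simp add: is_functor_def)
    then obtain Y where Y: "Y \<in> obj C" "\<forall>k\<in>S. hom C (Fo k) Y \<noteq> {}"
      using joint_embedding_finite[OF \<open>category C\<close> _ _ S, of Fo] bin by blast
    define t where "t k = (SOME f. f \<in> hom C (Fo k) Y)" for k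
    have t: "t k \<in> hom C (Fo k) Y" if "k \<in> S" for k
      using Y(2) that unfolding t_def by (meson ex_in_conv someI_ex)
    have "cmp C (t k) (Fa (k, k)) = t k" if "k \<in> S" for k
      using F that cmp_idn_right[OF t[OF that]] by (simp add: is_functor_def)
    then have "is_cocone (preorder_cat S (Id_on S)) C Fo Fa Y t"
      using Y t by (auto simp: is_cocone_def)
    then show "has_cocone (preorder_cat S (Id_on S)) C Fo Fa" unfolding has_cocone_def by blast
  qed
qed

text \<open>Each new leg is amalgamated with the common composite \<open>g\<close>. Tracking
  \<open>g\<close> itself settles \<open>n = 0\<close>, where it is the identity of
  \<open>a\<close>; this case occurs for one-point trees.\<close>

lemma wide_amalgamation:
  fixes n :: nat
  assumes C: "category C" "has_AP C" and a: "a \<in> obj C"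
  shows "\<forall>k<n. f k \<in> hom C a (X k) \<Longrightarrow>
    \<exists>Y g. g \<in> hom C a Y \<and> (\<forall>k<n. \<exists>h\<in>hom C (X k) Y. cmp C h (f k) = g)"
proof (induction n)
  case 0
  interpret category C by fact
  show ?case using idn_hom[OF a] by auto
next
  case (Suc n)
  interpret category C by fact
  from Suc obtain Y g where g: "g \<in> hom C a Y" "\<forall>k<n. \<exists>h\<in>hom C (X k) Y. cmp C h (f k) = g" by auto
  have fn: "f n \<in> hom C a (X n)" using Suc by simp
  then obtain p q where pq: "amalgamates C g (f n) p q"
    using C(2) g(1) unfolding has_AP_iff[OF C(1)] by (fastforce simp: hom_def)
  then have p: "p \<in> hom C Y (tgt C p)" and q: "q \<in> hom C (X n) (tgt C p)" and e: "cmp C p g = cmp C q (f n)"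
    using g fn by (auto simp: amalgamates_def hom_def)
  have "\<exists>h\<in>hom C (X k) (tgt C p). cmp C h (f k) = cmp C p g" if "k < Suc n" for k
  proof (cases "k = n")
    case False
    with that g obtain h where h: "h \<in> hom C (X k) Y" "cmp C h (f k) = g" by (metis less_antisym)
    moreover have "f k \<in> hom C a (X k)" using Suc.prems that by simp
    ultimately show ?thesis
      using cmp_hom[OF h(1) p] cmp_assoc[OF _ h(1) p] by (intro bexI[of _ "cmp C p h"]) auto
  qed (use q e in auto)
  then show ?case using cmp_hom[OF g(1) p] by blast
qed

section \<open>Reduction to countable categories\<close>

lemma functor_comp:
  assumes "is_functor A B Fo Fa" "is_functor B C Go Ga"
  shows "is_functor A C (Go \<circ> Fo) (Ga \<circ> Fa)"
  using assms unfolding is_functor_def by (auto simp: hom_def)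

lemma has_cocone_functor:
  assumes I: "category I" and c: "has_cocone I C Fo Fa" and F: "is_functor I C Fo Fa"
    and G: "is_functor C D Go Ga"
  shows "has_cocone I D (Go \<circ> Fo) (Ga \<circ> Fa)"
proof -
  interpret I: category I by fact
  obtain X t where t: "is_cocone I C Fo Fa X t" using c unfolding has_cocone_def by blast
  have "is_cocone I D (Go \<circ> Fo) (Ga \<circ> Fa) (Go X) (Ga \<circ> t)"
    unfolding is_cocone_def
  proof (intro conjI ballI)
    fix i assume i: "i \<in> arr I"
    then have "t (tgt I i) \<in> arr C" "Fa i \<in> arr C" "src C (t (tgt I i)) = tgt C (Fa i)"
      "t (src I i) = cmp C (t (tgt I i)) (Fa i)"
      using t F I.tgt_obj[OF i] unfolding is_cocone_def is_functor_def by (simp_all add: hom_def)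
    then show "(Ga \<circ> t) (src I i) = cmp D ((Ga \<circ> t) (tgt I i)) ((Ga \<circ> Fa) i)"
      using G unfolding is_functor_def by simp
  qed (use t F G in \<open>auto simp: is_cocone_def is_functor_def hom_def\<close>)
  then show ?thesis unfolding has_cocone_def by blast
qed

lemma has_cocone_cong:
  assumes I: "category I" and c: "has_cocone I C Fo Fa"
    and "\<And>x. x \<in> obj I \<Longrightarrow> Fo x = Fo' x" "\<And>i. i \<in> arr I \<Longrightarrow> Fa i = Fa' i"
  shows "has_cocone I C Fo' Fa'"
  using assms unfolding has_cocone_def is_cocone_def by simp

text \<open>A diagram in \<open>T\<close> is pushed into \<open>D\<close> along \<open>Ho\<close>
  and \<open>Ha\<close>, gets a cocone there, and brings it back along \<open>Ko\<close> and
  \<open>Ka\<close>, which undo the passage.\<close>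

lemma diagrams_have_cocones_retract:
  assumes I: "category I" and H: "is_functor T D Ho Ha" and K: "is_functor D T Ko Ka"
    and KH: "\<And>x. x \<in> obj T \<Longrightarrow> Ko (Ho x) = x" "\<And>f. f \<in> arr T \<Longrightarrow> Ka (Ha f) = f"
    and D: "diagrams_have_cocones I D"
  shows "diagrams_have_cocones I T"
  unfolding diagrams_have_cocones_def
proof (intro allI impI)
  fix Fo Fa assume F: "is_functor I T Fo Fa"
  note HF = functor_comp[OF F H]
  then have "has_cocone I D (Ho \<circ> Fo) (Ha \<circ> Fa)"
    using D unfolding diagrams_have_cocones_def by blast
  from has_cocone_functor[OF I this HF K] show "has_cocone I T Fo Fa"
    by (rule has_cocone_cong[OF I]) (use F in \<open>auto simp: KH is_functor_def hom_def\<close>)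
qed

text \<open>A copy of \<open>D\<close> on other types. The structure maps decode labels through
  \<open>inv_into\<close>, so they are meaningful only on the images of \<open>p\<close> and
  \<open>q\<close>, and only for \<open>p\<close> and \<open>q\<close> injective there.\<close>

definition relabel ::
  "('o \<Rightarrow> 'p) \<Rightarrow> ('m \<Rightarrow> 'n) \<Rightarrow> ('o, 'm) precategory \<Rightarrow> ('p, 'n) precategory" where
  "relabel p q D = (let q' = inv_into (arr D) q in
     \<lparr>obj = p ` obj D, arr = q ` arr D, src = (\<lambda>f. p (src D (q' f))), tgt = (\<lambda>f. p (tgt D (q' f))),
      idn = (\<lambda>x. q (idn D (inv_into (obj D) p x))), cmp = (\<lambda>g f. q (cmp D (q' g) (q' f)))\<rparr>)"

lemma relabel:
  assumes D: "category D" and p: "inj_on p (obj D)" and q: "inj_on q (arr D)"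
  shows "category (relabel p q D)"
    and "is_functor D (relabel p q D) p q"
    and "is_functor (relabel p q D) D (inv_into (obj D) p) (inv_into (arr D) q)"
proof -
  interpret category D by fact
  let ?T = "relabel p q D"
  have e: "obj ?T = p ` obj D" "arr ?T = q ` arr D"
    "\<And>f. f \<in> arr D \<Longrightarrow> src ?T (q f) = p (src D f)" "\<And>f. f \<in> arr D \<Longrightarrow> tgt ?T (q f) = p (tgt D f)"
    "\<And>x. x \<in> obj D \<Longrightarrow> idn ?T (p x) = q (idn D x)"
    "\<And>f g. \<lbrakk>f \<in> arr D; g \<in> arr D\<rbrakk> \<Longrightarrow> cmp ?T (q g) (q f) = q (cmp D g f)"
    using p q by (simp_all add: relabel_def Let_def)
  have pe: "p x = p y \<longleftrightarrow> x = y" if "x \<in> obj D" "y \<in> obj D" for x y using p that by (auto dest: inj_onD)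
  have id: "idn D x \<in> arr D" "src D (idn D x) = x" "tgt D (idn D x) = x" if "x \<in> obj D" for x
    using idn_hom[OF that] by (auto simp: hom_def)
  have h: "(f \<in> hom ?T x y) = (\<exists>f' x' y'. f = q f' \<and> x = p x' \<and> y = p y' \<and> f' \<in> hom D x' y')" for f x y
    using src_obj tgt_obj by (auto simp: hom_def e)
  have inj: "x = x'" if "p x = p x'" "f \<in> hom D x y" "f' \<in> hom D y' x'" for x x' y y' f f'
    using that hom_obj pe by metis
  show "is_functor D ?T p q"
    unfolding is_functor_def using src_obj tgt_obj by (auto simp: hom_def e)
  show "is_functor ?T D (inv_into (obj D) p) (inv_into (arr D) q)"
    unfolding is_functor_def using src_obj tgt_obj cmp_arr pe p q id
    by (auto simp: hom_def e)
  show "category ?T"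
  proof
    fix f x y assume "f \<in> hom ?T x y"
    then obtain f' x' y' where f: "f = q f'" "x = p x'" "y = p y'" "f' \<in> hom D x' y'" unfolding h by blast
    then have "x' \<in> obj D" "y' \<in> obj D" "f' \<in> arr D" using hom_obj by (auto simp: hom_def)
    then show "cmp ?T f (idn ?T x) = f" "cmp ?T (idn ?T y) f = f"
      using f by (simp_all add: e id cmp_idn_left cmp_idn_right)
  next
    fix f x y g z assume "f \<in> hom ?T x y" "g \<in> hom ?T y z"
    then obtain f' x' y' g' y'' z' where f: "f = q f'" "x = p x'" "y = p y'" "f' \<in> hom D x' y'"
      "g = q g'" "y = p y''" "z = p z'" "g' \<in> hom D y'' z'" unfolding h by blast
    then have "y'' = y'" using inj by metis
    with f have "cmp D g' f' \<in> hom D x' z'" "f' \<in> arr D" "g' \<in> arr D" using cmp_hom by (auto simp: hom_def)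
    then show "cmp ?T g f \<in> hom ?T x z" using f unfolding h by (auto simp: e)
  next
    fix f w x g y k z assume "f \<in> hom ?T w x" "g \<in> hom ?T x y" "k \<in> hom ?T y z"
    then obtain f' w' x' g' x'' y' k' y'' z' where f: "f = q f'" "x = p x'" "f' \<in> hom D w' x'"
      "g = q g'" "x = p x''" "y = p y'" "g' \<in> hom D x'' y'"
      "k = q k'" "y = p y''" "k' \<in> hom D y'' z'" unfolding h by blast
    then have "x'' = x'" "y'' = y'" using inj by metis+
    with f have a: "f' \<in> hom D w' x'" "g' \<in> hom D x' y'" "k' \<in> hom D y' z'" by auto
    then have "f' \<in> arr D" "g' \<in> arr D" "k' \<in> arr D" "cmp D g' f' \<in> arr D" "cmp D k' g' \<in> arr D"
      using cmp_hom by (auto simp: hom_def)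
    then show "cmp ?T k (cmp ?T g f) = cmp ?T (cmp ?T k g) f"
      using f cmp_assoc[OF a] by (simp add: e)
  qed (auto simp: e src_obj tgt_obj id hom_def)
qed

lemma diagrams_have_cocones_relabel:
  assumes S: "category S" and D: "category D" "inj_on p (obj D)" "inj_on q (arr D)"
  shows "diagrams_have_cocones S (relabel p q D) \<longleftrightarrow> diagrams_have_cocones S D"
proof
  note R = relabel(2,3)[OF D]
  show "diagrams_have_cocones S D" if "diagrams_have_cocones S (relabel p q D)"
    by (rule diagrams_have_cocones_retract[OF S R _ _ that]) (use D in auto)
  show "diagrams_have_cocones S (relabel p q D)" if "diagrams_have_cocones S D"
    by (rule diagrams_have_cocones_retract[OF S R(2,1) _ _ that]) (use D in \<open>auto simp: relabel_def Let_def\<close>)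
qed

lemma countable_inj_infinite:
  assumes "countable S" "infinite (UNIV :: 'a set)"
  shows "\<exists>e :: 'b \<Rightarrow> 'a. inj_on e S"
proof -
  obtain f :: "nat \<Rightarrow> 'a" where "inj f" using assms(2) infinite_countable_subset by blast
  then show ?thesis
    using assms(1) by (intro exI[of _ "f \<circ> to_nat_on S"]) (auto intro!: comp_inj_on dest: inj_on_subset)
qed

lemma countable_obj:
  assumes "category D" "countable (arr D)"
  shows "countable (obj D)"
proof -
  interpret category D by fact
  have "obj D \<subseteq> src D ` arr D" using idn_hom by (force simp: hom_def)
  then show ?thesis using assms(2) countable_subset by blast
qed

text \<open>Countable categories can be relabelled into any infinite types, so the hypothesis about
  \<open>'o\<close> and \<open>'m\<close> reaches them. The flag \<open>jep\<close> lets one lemma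
  serve both classes of categories, those with the AP and those with AP and JEP.\<close>

lemma diagrams_have_cocones_countable:
  fixes D :: "('p, 'n) precategory"
  assumes inf: "infinite (UNIV :: 'o set)" "infinite (UNIV :: 'm set)"
    and hyp: "\<And>C :: ('o, 'm) precategory. \<lbrakk>category C; has_AP C; jep \<Longrightarrow> has_JEP C\<rbrakk> \<Longrightarrow> diagrams_have_cocones I C"
    and I: "category I" and D: "category D" "has_AP D" "jep \<Longrightarrow> has_JEP D" "countable (arr D)"
  shows "diagrams_have_cocones I D"
proof -
  obtain p :: "'p \<Rightarrow> 'o" where p: "inj_on p (obj D)"
    using countable_inj_infinite[OF countable_obj[OF D(1,4)] inf(1)] by blast
  obtain q :: "'n \<Rightarrow> 'm" where q: "inj_on q (arr D)"
    using countable_inj_infinite[OF D(4) inf(2)] by blast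
  let ?T = "relabel p q D"
  \<comment> \<open>Covers both kinds of test shapes: \<open>r'\<close> consists of the two arrows
    out of \<open>0\<close> for the span of the AP, and is empty for the discrete shapes of the
    JEP.\<close>
  have cat: "category (preorder_cat S r)" if "r = Id_on S \<union> r'" "r' \<subseteq> {0} \<times> S" "0 \<in> S \<or> r' = {}"
    for S :: "nat set" and r r'
    using that by (intro category_preorder_cat) (auto simp: preorder_on_def refl_on_def trans_def)
  have "has_AP ?T"
    using D(2) unfolding has_AP_def
    by (subst diagrams_have_cocones_relabel[OF cat[of _ _ "{(0, 1), (0, 2)}"] D(1) p q]) auto
  moreover have "has_JEP ?T" if jep
    using D(3)[OF that] unfolding has_JEP_def
    by (auto simp: diagrams_have_cocones_relabel[OF cat[of _ _ "{}"] D(1) p q])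
  ultimately have "diagrams_have_cocones I ?T" using hyp[OF relabel(1)[OF D(1) p q]] by blast
  then show ?thesis using diagrams_have_cocones_relabel[OF I D(1) p q] by blast
qed

text \<open>Any two elements of the union of the stages lie in a common stage, and the next stage
  contains their values. All operations are binary; a unary one is encoded by ignoring its second
  argument.\<close>

lemma countable_closure:
  assumes S: "countable S" "S \<subseteq> B" and Ops: "countable Ops"
    and B: "\<And>p a b. \<lbrakk>p \<in> Ops; a \<in> B; b \<in> B\<rbrakk> \<Longrightarrow> p a b \<in> B"
  shows "\<exists>T. countable T \<and> S \<subseteq> T \<and> T \<subseteq> B \<and> (\<forall>p\<in>Ops. \<forall>a\<in>T. \<forall>b\<in>T. p a b \<in> T)"
proof -
  define step where "step T = T \<union> (\<lambda>(p, a, b). p a b) ` (Ops \<times> T \<times> T)" for T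
  define T where "T n = (step ^^ n) S" for n
  have T: "T 0 = S" "T (Suc n) = step (T n)" for n by (simp_all add: T_def)
  have "countable (T n)" for n by (induction n) (use S Ops in \<open>auto simp: T step_def\<close>)
  moreover have "T n \<subseteq> B" for n by (induction n) (use S B in \<open>auto simp: T step_def subset_iff\<close>)
  moreover have "T n \<subseteq> T k" if "n \<le> k" for n k
    using lift_Suc_mono_le[of T, OF _ that] by (auto simp: T step_def)
  then have "p a b \<in> (\<Union>n. T n)" if "p \<in> Ops" "a \<in> T n" "b \<in> T k" for p a b n k
  proof -
    have "a \<in> T (max n k)" "b \<in> T (max n k)"
      using that \<open>\<And>n k. n \<le> k \<Longrightarrow> T n \<subseteq> T k\<close> by (meson max.cobounded1 max.cobounded2 subsetD)+
    then have "p a b \<in> T (Suc (max n k))" using that(1) by (force simp: T step_def)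
    then show ?thesis by blast
  qed
  then have "\<forall>p\<in>Ops. \<forall>a\<in>\<Union>n. T n. \<forall>b\<in>\<Union>n. T n. p a b \<in> (\<Union>n. T n)" by auto
  ultimately show ?thesis using T(1) by (intro exI[of _ "\<Union>n. T n"]) auto
qed

text \<open>The Skolem functions \<open>h\<close>, \<open>k\<close>, \<open>a\<close>,
  \<open>b\<close> choose amalgams and joint embeddings. A nonempty set of arrows closed under them,
  under composition and under the identities of end points is a subcategory that inherits both
  properties.\<close>

lemma countable_subcategory:
  assumes D: "category D" "has_AP D" "has_JEP D" and S: "countable S" "S \<subseteq> arr D"
  shows "\<exists>T. countable T \<and> S \<subseteq> T \<and> T \<subseteq> arr D \<and>
    (let D' = D\<lparr>obj := src D ` T, arr := T\<rparr> in category D' \<and> has_AP D' \<and> has_JEP D')"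
proof -
  interpret category D by fact
  obtain z where z: "z \<in> obj D" using D(3) unfolding has_JEP_iff[OF D(1)] by blast
  have id: "idn D x \<in> arr D \<and> src D (idn D x) = x \<and> tgt D (idn D x) = x" if "x \<in> obj D" for x
    using idn_hom[OF that] by (auto simp: hom_def)
  obtain h k where hk: "\<And>f g. \<lbrakk>f \<in> arr D; g \<in> arr D; src D f = src D g\<rbrakk> \<Longrightarrow> amalgamates D f g (h f g) (k f g)"
    using D(2) unfolding has_AP_iff[OF D(1)] by metis
  have "\<forall>x\<in>obj D. \<forall>y\<in>obj D. \<exists>a b. a \<in> arr D \<and> b \<in> arr D \<and> src D a = x \<and> src D b = y \<and> tgt D a = tgt D b"
    using D(3) unfolding has_JEP_iff[OF D(1)] by (fastforce simp: hom_def)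
  then obtain a b where ab: "\<And>x y. \<lbrakk>x \<in> obj D; y \<in> obj D\<rbrakk> \<Longrightarrow>
      a x y \<in> arr D \<and> b x y \<in> arr D \<and> src D (a x y) = x \<and> src D (b x y) = y \<and> tgt D (a x y) = tgt D (b x y)"
    by metis
  \<comment> \<open>Objects are reached as sources and targets of arrows, so that all operations act
    on arrows alone. Where a composite or an amalgam makes no sense the value is the first argument,
    which adds nothing new to the closure.\<close>
  define Ops where "Ops = {\<lambda>f g. idn D (src D f), \<lambda>f g. idn D (tgt D f),
    \<lambda>f g. if src D g = tgt D f then cmp D g f else f,
    \<lambda>f g. if src D f = src D g then h f g else f, \<lambda>f g. if src D f = src D g then k f g else f,
    \<lambda>f g. a (src D f) (src D g), \<lambda>f g. b (src D f) (src D g)}"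
  have ops: "p f g \<in> arr D" if "p \<in> Ops" "f \<in> arr D" "g \<in> arr D" for p f g
    using that hk[of f g] ab[of "src D f" "src D g"]
    by (auto simp: Ops_def id src_obj tgt_obj cmp_arr amalgamates_def)
  \<comment> \<open>The identity of \<open>z\<close> keeps the subcategory nonempty even if
    \<open>S\<close> is empty, as the JEP demands.\<close>
  have "countable Ops" "countable (insert (idn D z) S)" "insert (idn D z) S \<subseteq> arr D"
    using S id[OF z] by (auto simp: Ops_def)
  then have "\<exists>T. countable T \<and> insert (idn D z) S \<subseteq> T \<and> T \<subseteq> arr D \<and> (\<forall>p\<in>Ops. \<forall>f\<in>T. \<forall>g\<in>T. p f g \<in> T)"
    by (intro countable_closure) (simp_all add: ops)
  then obtain T where T: "countable T" "insert (idn D z) S \<subseteq> T"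
    "T \<subseteq> arr D" "\<And>p f g. \<lbrakk>p \<in> Ops; f \<in> T; g \<in> T\<rbrakk> \<Longrightarrow> p f g \<in> T" by metis
  have c: "idn D (src D f) \<in> T" "idn D (tgt D f) \<in> T"
    "src D g = tgt D f \<Longrightarrow> cmp D g f \<in> T" "src D f = src D g \<Longrightarrow> h f g \<in> T" "src D f = src D g \<Longrightarrow> k f g \<in> T"
    "a (src D f) (src D g) \<in> T" "b (src D f) (src D g) \<in> T" if "f \<in> T" "g \<in> T" for f g
  proof -
    have "\<forall>p\<in>Ops. p f g \<in> T" using T(4) that by blast
    then show "idn D (src D f) \<in> T" "idn D (tgt D f) \<in> T"
      "src D g = tgt D f \<Longrightarrow> cmp D g f \<in> T" "src D f = src D g \<Longrightarrow> h f g \<in> T" "src D f = src D g \<Longrightarrow> k f g \<in> T"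
      "a (src D f) (src D g) \<in> T" "b (src D f) (src D g) \<in> T"
      unfolding Ops_def by (simp_all split: if_splits)
  qed
  define D' where "D' = D\<lparr>obj := src D ` T, arr := T\<rparr>"
  have e: "obj D' = src D ` T" "arr D' = T" "src D' = src D" "tgt D' = tgt D" "idn D' = idn D" "cmp D' = cmp D"
    by (simp_all add: D'_def)
  have h': "hom D' x y = hom D x y \<inter> T" for x y using T(3) by (auto simp: hom_def e)
  have tg: "tgt D f \<in> src D ` T" if "f \<in> T" for f
    using c(2)[OF that that] id[of "tgt D f"] tgt_obj T(3) that by force
  have cat: "category D'"
  proof
    fix x assume "x \<in> obj D'"
    then show "idn D' x \<in> hom D' x x"
      using c(1) T(3) idn_hom src_obj unfolding e h' by fastforce
  next
    fix f x y g z assume "f \<in> hom D' x y" "g \<in> hom D' y z"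
    then show "cmp D' g f \<in> hom D' x z" using cmp_hom c(3)[of f g] unfolding e h' by (auto simp: hom_def)
  qed (auto simp: e h' tg cmp_idn_left cmp_idn_right cmp_assoc)
  have "has_AP D'"
    unfolding has_AP_iff[OF cat] e
  proof (intro ballI impI)
    fix f g assume fg: "f \<in> T" "g \<in> T" "src D f = src D g"
    then show "\<exists>h k. amalgamates D' f g h k"
      using hk[of f g] c(4,5)[of f g] T(3)
      by (intro exI[of _ "h f g"] exI[of _ "k f g"]) (auto simp: amalgamates_def e)
  qed
  moreover have "has_JEP D'"
    unfolding has_JEP_iff[OF cat]
  proof (intro conjI ballI)
    show "obj D' \<noteq> {}" using T(2) by (auto simp: e)
    fix x y assume "x \<in> obj D'" "y \<in> obj D'"
    then obtain f g where fg: "f \<in> T" "g \<in> T" "x = src D f" "y = src D g" by (auto simp: e)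
    then have "x \<in> obj D" "y \<in> obj D" using T(3) src_obj by auto
    then have "a x y \<in> hom D' x (tgt D (a x y))" "b x y \<in> hom D' y (tgt D (a x y))"
      using ab[of x y] c(6,7)[OF fg(1,2)] fg by (simp_all add: e hom_def)
    then show "\<exists>z. hom D' x z \<noteq> {} \<and> hom D' y z \<noteq> {}" by blast
  qed
  ultimately show ?thesis
    using T(1-3) cat unfolding D'_def Let_def by (intro exI[of _ T]) simp
qed

text \<open>The image of a countable shape lies in a countable subcategory with AP and JEP, and a
  cocone found there is a cocone in \<open>D\<close>. This makes the hypothesis applicable to
  \<open>Inj\<close>, which may be too large for \<open>'o\<close> and \<open>'m\<close>.\<close>

lemma diagrams_have_cocones_all_types:
  fixes D :: "('p, 'n) precategory"
  assumes inf: "infinite (UNIV :: 'o set)" "infinite (UNIV :: 'm set)"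
    and hyp: "\<And>C :: ('o, 'm) precategory. \<lbrakk>category C; has_AP C; has_JEP C\<rbrakk> \<Longrightarrow> diagrams_have_cocones I C"
    and I: "category I" "countable (arr I)" and D: "category D" "has_AP D" "has_JEP D"
  shows "diagrams_have_cocones I D"
  unfolding diagrams_have_cocones_def
proof (intro allI impI)
  fix Fo Fa assume F: "is_functor I D Fo Fa"
  interpret I: category I by fact
  interpret D: category D by fact
  have "countable (Fa ` arr I)" "Fa ` arr I \<subseteq> arr D"
    using I(2) F by (auto simp: is_functor_def hom_def)
  from countable_subcategory[OF D this] obtain T where T: "countable T" "Fa ` arr I \<subseteq> T" "T \<subseteq> arr D"
    and "let D' = D\<lparr>obj := src D ` T, arr := T\<rparr> in category D' \<and> has_AP D' \<and> has_JEP D'" by blast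
  moreover define D' where "D' = D\<lparr>obj := src D ` T, arr := T\<rparr>"
  ultimately have D': "category D'" "has_AP D'" "has_JEP D'" by (auto simp: Let_def)
  have e: "obj D' = src D ` T" "arr D' = T" "src D' = src D" "tgt D' = tgt D" "idn D' = idn D" "cmp D' = cmp D"
    by (simp_all add: D'_def)
  have "Fo x \<in> obj D'" if "x \<in> obj I" for x
  proof -
    have "idn I x \<in> arr I" "src D (Fa (idn I x)) = Fo x"
      using I.idn_hom[OF that] F by (auto simp: is_functor_def hom_def)
    then show ?thesis using T(2) by (force simp: e)
  qed
  then have F': "is_functor I D' Fo Fa" using F T(2) by (auto simp: is_functor_def e hom_def)
  have "diagrams_have_cocones I D'"
    by (rule diagrams_have_cocones_countable[of True, OF inf]) (use hyp I D' T(1) in \<open>auto simp: e\<close>)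
  then have "has_cocone I D' Fo Fa" using F' unfolding diagrams_have_cocones_def by blast
  moreover have "src D ` T \<subseteq> obj D" using T(3) D.src_obj by auto
  ultimately show "has_cocone I D Fo Fa"
    using T(3) by (auto simp: has_cocone_def is_cocone_def e hom_def) blast
qed

lemma countable_finitely_generated:
  assumes "category I" "finitely_generated I"
  shows "countable (arr I)"
proof -
  interpret category I by fact
  obtain G where G: "finite G" "G \<subseteq> arr I" "arr_closure I G = arr I"
    using assms(2) unfolding finitely_generated_def by blast
  \<comment> \<open>Composition made total by returning \<open>f\<close> where the arrows do not
    match, in the form that \<open>countable_closure\<close> expects.\<close>
  let ?p = "\<lambda>f g. if src I g = tgt I f then cmp I g f else f"
  have "\<exists>T. countable T \<and> G \<subseteq> T \<and> T \<subseteq> arr I \<and> (\<forall>p\<in>{?p}. \<forall>f\<in>T. \<forall>g\<in>T. p f g \<in> T)"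
    using G cmp_arr by (intro countable_closure) (auto intro: countable_finite)
  then obtain T where T: "countable T" "G \<subseteq> T" and "\<forall>p\<in>{?p}. \<forall>f\<in>T. \<forall>g\<in>T. p f g \<in> T"
    by (elim exE conjE)
  then have p: "?p f g \<in> T" if "f \<in> T" "g \<in> T" for f g
    using that by (simp only: ball_simps simp_thms)
  have "f \<in> T" if "f \<in> arr_closure I G" for f
    using that
  proof induction
    case (cmp f g)
    then show ?case using p[of f g] by simp
  qed (use T(2) in auto)
  then have "arr_closure I G \<subseteq> T" by (rule subsetI)
  then show ?thesis using countable_subset[OF _ T(1)] by (simp add: G(3))
qed

section \<open>The category of injections\<close>

lemma Inj_simps [simp]:
  "obj (Inj :: ('x set, 'x inj_arr) precategory) = UNIV"
  "(X, f, Y) \<in> arr (Inj :: ('x set, 'x inj_arr) precategory) \<longleftrightarrow> f \<in> X \<rightarrow>\<^sub>E Y \<and> inj_on f X"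
  "src (Inj :: ('x set, 'x inj_arr) precategory) (X, f, Y) = X"
  "tgt (Inj :: ('x set, 'x inj_arr) precategory) (X, f, Y) = Y"
  "idn (Inj :: ('x set, 'x inj_arr) precategory) X = (X, \<lambda>x\<in>X. x, X)"
  "cmp (Inj :: ('x set, 'x inj_arr) precategory) (Y', g, Z) (X, f, Y) = (X, compose X g f, Z)"
  by (simp_all add: Inj_def)

text \<open>Twice an infinite cardinal is that cardinal. This gives the room to realize amalgams and
  disjoint unions of subsets of \<open>'x\<close> inside \<open>'x\<close> itself.\<close>

lemma ex_inj_sum:
  includes cardinal_syntax
  assumes "infinite (UNIV :: 'x set)"
  shows "\<exists>e :: 'x + 'x \<Rightarrow> 'x. inj e"
proof -
  have "|(UNIV :: 'x set) <+> (UNIV :: 'x set)| =o |UNIV :: 'x set|"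
    using card_of_Plus_infinite[OF assms card_of_mono1[OF subset_refl]] by blast
  then have "|UNIV :: ('x + 'x) set| \<le>o |UNIV :: 'x set|"
    using ordIso_imp_ordLeq by (metis UNIV_Plus_UNIV)
  then show ?thesis using card_of_ordLeq[of "UNIV :: ('x + 'x) set" "UNIV :: 'x set"] by blast
qed

lemma has_AP_Inj:
  assumes "infinite (UNIV :: 'x set)"
  shows "has_AP (Inj :: ('x set, 'x inj_arr) precategory)"
  unfolding has_AP_iff[OF category_Inj]
proof (intro ballI impI)
  fix p q :: "'x inj_arr"
  obtain X f Y where p: "p = (X, f, Y)" by (cases p)
  obtain X' g Z where q: "q = (X', g, Z)" by (cases q)
  assume "p \<in> arr Inj" "q \<in> arr Inj" "src Inj p = src Inj q"
  then have f: "f \<in> X \<rightarrow>\<^sub>E Y" "inj_on f X" and g: "g \<in> X \<rightarrow>\<^sub>E Z" "inj_on g X" and X': "X' = X"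
    unfolding p q by auto
  obtain e :: "'x + 'x \<Rightarrow> 'x" where e: "inj e" using ex_inj_sum[OF assms] by blast
  \<comment> \<open>The pushout of sets, coded by \<open>e\<close>: all of \<open>Y\<close> goes to
    the left summand, the part of \<open>Z\<close> outside the image of \<open>g\<close> to the
    right one, and a point \<open>g x\<close> is identified with \<open>f x\<close>.\<close>
  define h where "h = (\<lambda>y\<in>Y. e (Inl y))"
  define k where "k = (\<lambda>z\<in>Z. if z \<in> g ` X then e (Inl (f (inv_into X g z))) else e (Inr z))"
  have "inj_on h Y" using e by (auto simp: h_def inj_on_def)
  moreover have "inj_on k Z"
  proof (rule inj_onI)
    fix z z' assume "z \<in> Z" "z' \<in> Z" "k z = k z'"
    then show "z = z'"
      using e f(2) g(2) by (auto simp: k_def inj_eq inv_into_f_f dest: inj_onD split: if_splits)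
  qed
  moreover have "compose X h f = compose X k g"
  proof
    fix x show "compose X h f x = compose X k g x"
      using f(1) g by (cases "x \<in> X") (auto simp: compose_def h_def k_def PiE_def Pi_def)
  qed
  ultimately show "\<exists>h k. amalgamates Inj p q h k"
    unfolding p q X'
    by (intro exI[of _ "(Y, h, UNIV)"] exI[of _ "(Z, k, UNIV)"])
      (auto simp: amalgamates_def h_def k_def)
qed

lemma has_JEP_Inj:
  assumes "infinite (UNIV :: 'x set)"
  shows "has_JEP (Inj :: ('x set, 'x inj_arr) precategory)"
  unfolding has_JEP_iff[OF category_Inj]
proof (intro conjI ballI)
  fix X Y :: "'x set"
  obtain e :: "'x + 'x \<Rightarrow> 'x" where e: "inj e" using ex_inj_sum[OF assms] by blast
  have "(X, \<lambda>x\<in>X. e (Inl x), UNIV) \<in> hom Inj X UNIV" "(Y, \<lambda>y\<in>Y. e (Inr y), UNIV) \<in> hom Inj Y UNIV"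
    using e by (auto simp: hom_def inj_on_def)
  then show "\<exists>Z. hom Inj X Z \<noteq> {} \<and> hom Inj Y Z \<noteq> {}" by blast
qed auto

context injective_diagram
begin

lemma functor_Inj:
  "is_functor I Inj A (\<lambda>i. (A (src I i), restrict (m i) (A (src I i)), A (tgt I i)))"
proof -
  have "compose (A (src I i)) (restrict (m j) (A (src I j))) (restrict (m i) (A (src I i))) =
      restrict (m (cmp I j i)) (A (src I i))" if "i \<in> arr I" "j \<in> arr I" "src I j = tgt I i" for i j
    using that by (auto simp: compose_def fun_eq_iff map_cmp map_in)
  moreover have "restrict (m (idn I x)) (A x) = (\<lambda>a\<in>A x. a)" if "x \<in> obj I" for x
    using map_idn[OF that] by (auto simp: restrict_def)
  ultimately show ?thesis
    unfolding is_functor_def using idn_hom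
    by (auto simp: hom_def map_inj map_in cmp_src cmp_tgt)
qed

text \<open>The legs of a cocone are constant along zigzags, so both ends of a run around a loop
  have the same image under one injective leg.\<close>

lemma cocone_zigzag:
  assumes c: "has_cocone I Inj A (\<lambda>i. (A (src I i), restrict (m i) (A (src I i)), A (tgt I i)))"
    and w: "path I x w x"
  shows "zz x w \<subseteq> Id"
proof -
  obtain X t where t: "is_cocone I Inj A (\<lambda>i. (A (src I i), restrict (m i) (A (src I i)), A (tgt I i))) X t"
    using c unfolding has_cocone_def by blast
  define f where "f x = fst (snd (t x))" for x
  have tf: "t x = (A x, f x, X)" if "x \<in> obj I" for x
    using t that unfolding is_cocone_def f_def by (cases "t x") (auto simp: hom_def)
  have inj: "inj_on (f x) (A x)" if "x \<in> obj I" for x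
  proof -
    have "t x \<in> hom Inj (A x) X" using t that by (simp add: is_cocone_def)
    then show ?thesis by (simp add: tf[OF that] hom_def)
  qed
  have eq: "f (src I i) a = f (tgt I i) (m i a)" if "i \<in> arr I" "a \<in> A (src I i)" for i a
  proof -
    have "t (src I i) = cmp Inj (t (tgt I i)) (A (src I i), restrict (m i) (A (src I i)), A (tgt I i))"
      using t[unfolded is_cocone_def, THEN conjunct2, THEN conjunct2] that(1) by (rule bspec)
    then have "f (src I i) = compose (A (src I i)) (f (tgt I i)) (restrict (m i) (A (src I i)))"
      using tf src_obj tgt_obj that(1) by simp
    then show ?thesis using that(2) by (simp add: compose_def)
  qed
  have "f x a = f y b" if "(a, b) \<in> zz x w" "path I x w y" for a b w x y
    using that
  proof (induction w arbitrary: a x)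
    case (Cons l w)
    then show ?case by (cases l) (use eq in fastforce)+
  qed auto
  then have "f x a = f x b" if "(a, b) \<in> zz x w" for a b using that w by blast
  then show ?thesis
    using inj[of x] zigzag_subset[OF w] path_obj[OF w] by (auto dest: inj_onD)
qed

end

section \<open>The canonical diagram of the left fundamental inverse category\<close>

text \<open>The idempotent \<open>cmp C f' f\<close> plays the role of the domain of
  \<open>f\<close>, and fixing \<open>g\<close> means that \<open>g\<close> lies in it. As for
  partial functions, the domain of a composite splits into a condition for each factor. The second
  claim exchanges the commuting idempotents \<open>cmp C f f'\<close> and
  \<open>cmp C e' e\<close>.\<close>

lemma (in inverse_category) pseudoinverse_domain_split:
  assumes "f \<in> hom C x y" "pseudoinverse C f f'" "e \<in> hom C y z" "pseudoinverse C e e'"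
    and "g \<in> arr C" "tgt C g = x"
    and dom: "cmp C (cmp C (cmp C f' e') (cmp C e f)) g = g"
  shows "cmp C f' (cmp C f g) = g" and "cmp C (cmp C e' e) (cmp C f g) = cmp C f g"
proof -
  have f: "f \<in> arr C" "src C f = x" "tgt C f = y"
    and f': "f' \<in> arr C" "src C f' = y" "tgt C f' = x"
    and ff: "cmp C f (cmp C f' f) = f" "cmp C f' (cmp C f f') = f'"
    and e: "e \<in> arr C" "src C e = y" "tgt C e = z"
    and e': "e' \<in> arr C" "src C e' = z" "tgt C e' = y"
    and ee: "cmp C e (cmp C e' e) = e" "cmp C e' (cmp C e e') = e'"
    using assms by (auto simp: pseudoinverse_def hom_def)
  note st = f f' e e' assms(5,6) cmp_arr cmp_src cmp_tgt
  note as = cmp_assoc'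
  have d: "cmp C f' (cmp C e' (cmp C e (cmp C f g))) = g"
    using dom by (simp add: as st)
  have fz: "cmp C f' (cmp C f (cmp C f' w)) = cmp C f' w" if "w \<in> arr C" "tgt C w = y" for w
    using arg_cong[OF ff(2), of "\<lambda>r. cmp C r w"] that by (simp add: as st)
  have ez: "cmp C e' (cmp C e (cmp C e' w)) = cmp C e' w" if "w \<in> arr C" "tgt C w = z" for w
    using arg_cong[OF ee(2), of "\<lambda>r. cmp C r w"] that by (simp add: as st)
  let ?w = "cmp C e' (cmp C e (cmp C f g))"
  have w: "?w \<in> arr C" "tgt C ?w = y" by (simp_all add: st)
  have "cmp C f' (cmp C f g) = cmp C f' (cmp C f (cmp C f' ?w))" by (simp only: d)
  also have "\<dots> = g" using fz[OF w] d by simp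
  finally show "cmp C f' (cmp C f g) = g" .
  let ?p = "cmp C f f'" and ?q = "cmp C e' e"
  have "?p \<in> hom C y y" "?q \<in> hom C y y" by (simp_all add: hom_def st)
  moreover have "cmp C ?p ?p = ?p" "cmp C ?q ?q = ?q" by (simp_all add: as st ff ee)
  ultimately have pq: "cmp C ?p ?q = cmp C ?q ?p" by (intro idempotents_commute)
  have c: "cmp C f (cmp C f' (cmp C e' (cmp C e w))) = cmp C e' (cmp C e (cmp C f (cmp C f' w)))"
    if "w \<in> arr C" "tgt C w = y" for w
    using arg_cong[OF pq, of "\<lambda>r. cmp C r w"] that by (simp add: as st)
  have fg: "cmp C f g \<in> arr C" "tgt C (cmp C f g) = y" by (simp_all add: st)
  have "cmp C f g = cmp C f (cmp C f' ?w)" by (simp only: d)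
  also have "\<dots> = cmp C e' (cmp C e (cmp C f (cmp C f' (cmp C f g))))" by (rule c[OF fg])
  finally have r: "cmp C f g = cmp C e' (cmp C e (cmp C f (cmp C f' (cmp C f g))))" .
  have "cmp C (cmp C e' e) (cmp C f g) = cmp C e' (cmp C e (cmp C f g))" by (simp add: as st)
  also have "\<dots> = cmp C f g"
    using r \<open>cmp C f' (cmp C f g) = g\<close> by simp
  finally show "cmp C (cmp C e' e) (cmp C f g) = cmp C f g" .
qed

context monic_functor
begin

abbreviation "canonical \<equiv> zigzag I (\<lambda>x. {a \<in> arr D. tgt D a = Fo x}) (\<lambda>i. cmp D (Fa i))"

text \<open>By \<open>monic\<close> the pseudoinverse of \<open>Fa i\<close> is a left inverse, so
  \<open>Fa i\<close> can be cancelled.\<close>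

lemma injective_diagram_canonical:
  "injective_diagram I (\<lambda>x. {a \<in> arr D. tgt D a = Fo x}) (\<lambda>i. cmp D (Fa i))"
proof (rule functor_injective_diagram[OF I.category_axioms D.category_axioms F])
  fix i a b
  assume i: "i \<in> arr I" and ab: "a \<in> arr D" "b \<in> arr D" "tgt D a = Fo (src I i)" "tgt D b = Fo (src I i)"
    and eq: "cmp D (Fa i) a = cmp D (Fa i) b"
  have "c = cmp D (pinv D (Fa i)) (cmp D (Fa i) c)" if "c \<in> arr D" "tgt D c = Fo (src I i)" for c
  proof -
    have "cmp D (cmp D (pinv D (Fa i)) (Fa i)) c = cmp D (pinv D (Fa i)) (cmp D (Fa i) c)"
      using pinv_Fa(2)[OF i] Fa_hom[OF i] that by (intro D.cmp_assoc') (auto simp: hom_def)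
    then show ?thesis
      using monic[OF i] D.cmp_idn_left[of c "src D c" "tgt D c"] that by (simp add: hom_def)
  qed
  then show "a = b" using ab eq by metis
qed

text \<open>The last premise says that \<open>g\<close> lies in the domain of the whole word.
  \<open>pseudoinverse_domain_split\<close> hands this condition on letter by letter; at a backward
  letter \<open>i\<close> it also exhibits \<open>g\<close> as a value of
  \<open>cmp D (Fa i)\<close>.\<close>

lemma canonical_zigzag:
  "\<lbrakk>path I x w y; g \<in> arr D; tgt D g = Fo x; cmp D (cmp D (pinv D (ev x w)) (ev x w)) g = g\<rbrakk>
    \<Longrightarrow> (g, cmp D (ev x w) g) \<in> canonical x w"
proof (induction w arbitrary: x g)
  case Nil
  then have "cmp D (idn D (Fo x)) g = g"
    using D.cmp_idn_left[of g "src D g" "Fo x"] by (simp add: hom_def)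
  with Nil show ?case by (simp add: Id_on_iff)
next
  case (Cons l w)
  define z where "z = (case l of Fwd i \<Rightarrow> tgt I i | Bwd i \<Rightarrow> src I i)"
  define f where "f = (case l of Fwd i \<Rightarrow> Fa i | Bwd i \<Rightarrow> pinv D (Fa i))"
  define f' where "f' = (case l of Fwd i \<Rightarrow> pinv D (Fa i) | Bwd i \<Rightarrow> Fa i)"
  have w: "path I z w y" and e: "ev x (l # w) = cmp D (ev z w) f"
    using Cons.prems(1) by (cases l; auto simp: z_def f_def)+
  have f: "f \<in> hom D (Fo x) (Fo z)"
    using Cons.prems(1) Fa_hom pinv_Fa(2) by (cases l) (auto simp: f_def z_def)
  have p: "pseudoinverse D f f'"
    using Cons.prems(1) pinv_Fa(1) pseudoinverse_sym[OF Fa_hom pinv_Fa(1)]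
    by (cases l) (auto simp: f_def f'_def)
  have h: "ev z w \<in> hom D (Fo z) (Fo y)" using ev_hom[OF w] .
  then have p': "pseudoinverse D (ev z w) (pinv D (ev z w))"
    by (intro D.pinv_pseudoinverse) (simp add: hom_def)
  have "pinv D (cmp D (ev z w) f) = cmp D f' (pinv D (ev z w))"
    using D.pseudoinverse_cmp[OF f p h p'] D.cmp_hom[OF f h] by (intro D.pinv_eqI) (auto simp: hom_def)
  then have "cmp D (cmp D (cmp D f' (pinv D (ev z w))) (cmp D (ev z w) f)) g = g"
    using Cons.prems(4) e by simp
  note s = D.pseudoinverse_domain_split[OF f p h p' Cons.prems(2,3) this]
  have fg: "cmp D f g \<in> arr D" "tgt D (cmp D f g) = Fo z"
    using f Cons.prems by (auto simp: hom_def D.cmp_arr D.cmp_tgt)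
  have "(cmp D f g, cmp D (ev z w) (cmp D f g)) \<in> canonical z w"
    using Cons.IH[OF w fg s(2)] .
  moreover have "cmp D (ev z w) (cmp D f g) = cmp D (ev x (l # w)) g"
    using f h Cons.prems unfolding e by (simp add: D.cmp_assoc' hom_def)
  ultimately have t: "(cmp D f g, cmp D (ev x (l # w)) g) \<in> canonical z w" by simp
  show ?case
  proof (cases l)
    case (Fwd i)
    with Cons.prems have "i \<in> arr I" "src I i = x" by auto
    then have "(g, cmp D f g) \<in> {(a, cmp D (Fa i) a) |a. a \<in> {a \<in> arr D. tgt D a = Fo (src I i)}}"
      using Cons.prems Fwd by (auto simp: f_def)
    from relcompI[OF this t] show ?thesis by (simp add: Fwd z_def)
  next
    case (Bwd i)
    with Cons.prems have i: "i \<in> arr I" "tgt I i = x" by auto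
    then have "(cmp D (Fa i) (cmp D f g), cmp D f g) \<in>
        {(cmp D (Fa i) a, a) |a. a \<in> {a \<in> arr D. tgt D a = Fo (src I i)}}"
      using fg Bwd by (auto simp: z_def)
    moreover have "cmp D (Fa i) (cmp D f g) = g" using s(1) Bwd by (simp add: f'_def)
    ultimately have "(g, cmp D f g) \<in> {(cmp D (Fa i) a, a) |a. a \<in> {a \<in> arr D. tgt D a = Fo (src I i)}}"
      by simp
    from relcompI[OF this t] show ?thesis by (simp add: Bwd z_def)
  qed
qed

end

context category
begin

lemma monic_functor_left_eta: "monic_functor C (left_fundamental C) (\<lambda>x. x) (left_eta C)"
  by (intro monic_functor.intro monic_functor_axioms.intro category_axioms
      inverse_category_left_fundamental functor_left_eta left_eta_monic)

text \<open>With \<open>d\<close> the pseudoinverse of \<open>c\<close>, the loop takes the domain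
  idempotent \<open>cmp ?L d c\<close> to \<open>cmp ?L c (cmp ?L d c)\<close>, which is
  \<open>c\<close>. If no point is moved, \<open>c\<close> equals this idempotent.\<close>

lemma upward_simply_connected_canonical:
  assumes "\<And>x w. path C x w x \<Longrightarrow>
    zigzag C (\<lambda>x. {a \<in> arr (left_fundamental C). tgt (left_fundamental C) a = x})
      (\<lambda>i. cmp (left_fundamental C) (left_eta C i)) x w \<subseteq> Id"
  shows "upward_simply_connected C"
  unfolding upward_simply_connected_def
proof (intro ballI)
  let ?L = "left_fundamental C"
  fix x c assume c: "x \<in> obj C" "c \<in> hom ?L x x"
  interpret M: monic_functor C ?L "\<lambda>x. x" "left_eta C" by (rule monic_functor_left_eta)
  from c have ca: "c \<in> arr ?L" "src ?L c = x" "tgt ?L c = x" by (auto simp: hom_def)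
  obtain u where u: "u \<in> arr (word_cat C)" "c = left_rel C `` {u}" using ca(1) by (rule left_arrE)
  obtain y w z where w: "u = (y, w, z)" by (cases u)
  with u ca have "y = x" "z = x" using left_quotient(2,3)[OF u(1)] by auto
  with u w have p: "path C x w x" and cw: "c = left_rel C `` {(x, w, x)}" by auto
  \<comment> \<open>The identity functor takes each class to itself, and by uniqueness it also
    evaluates words; so the class of \<open>w\<close> is the product of its letters.\<close>
  have "is_functor ?L ?L (\<lambda>x. x) (\<lambda>c. c)" by (auto simp: is_functor_def hom_def)
  from M.functor_eval_unique[OF this _ p] have ev: "c = M.ev x w" by (simp add: cw)
  let ?d = "pinv ?L c"
  have "pseudoinverse ?L c ?d" using ca(1) by (rule M.D.pinv_pseudoinverse)
  then have d: "?d \<in> arr ?L" "src ?L ?d = x" "tgt ?L ?d = x" "cmp ?L c (cmp ?L ?d c) = c"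
    "cmp ?L ?d (cmp ?L c ?d) = ?d"
    using ca by (auto simp: pseudoinverse_def hom_def)
  let ?g = "cmp ?L ?d c"
  note st = d(1-3) ca M.D.cmp_arr M.D.cmp_src M.D.cmp_tgt
  have g: "?g \<in> arr ?L" "tgt ?L ?g = x" "cmp ?L ?g ?g = ?g"
    using d(4,5) by (simp_all add: st M.D.cmp_assoc')
  have "(?g, cmp ?L c ?g) \<in> M.canonical x w"
    using M.canonical_zigzag[OF p g(1,2)] g(3) by (simp flip: ev)
  then have "?g = cmp ?L c ?g" using assms[OF p] by blast
  then show "cmp ?L c c = c" using d(4) g(3) by simp
qed

text \<open>There are countably many words over a countable alphabet. The canonical diagram
  therefore embeds into any infinite type.\<close>

lemma countable_left_fundamental:
  assumes "countable (arr C)"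
  shows "countable (arr (left_fundamental C))"
proof -
  have "set w \<subseteq> Fwd ` arr C \<union> Bwd ` arr C" if "path C x w y" for x w y
    using that
  proof (induction w arbitrary: x)
    case (Cons l w)
    then show ?case by (cases l) fastforce+
  qed simp
  then have "arr (word_cat C) \<subseteq> obj C \<times> lists (Fwd ` arr C \<union> Bwd ` arr C) \<times> obj C"
    using path_obj by (auto simp: in_lists_conv_set) blast
  moreover have "countable (obj C \<times> lists (Fwd ` arr C \<union> Bwd ` arr C) \<times> obj C)"
    using assms countable_obj[OF category_axioms assms] by (intro countable_SIGMA countable_lists) auto
  ultimately have "countable (arr (word_cat C))" by (rule countable_subset)
  moreover have "arr (left_fundamental C) \<subseteq> (\<lambda>u. left_rel C `` {u}) ` arr (word_cat C)"
    by (auto elim!: left_arrE)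
  ultimately show ?thesis using countable_image countable_subset by blast
qed

text \<open>With the flag \<open>fin\<close> set, the hypothesis concerns diagrams of finite sets
  only; the canonical diagram is then replaced by a finite subdiagram containing the given run. One
  proof thus covers (ii) and its finite variant.\<close>

lemma upward_simply_connected_Inj:
  assumes inf: "infinite (UNIV :: 'x set)" and cnt: "countable (arr C)" and fin: "fin \<Longrightarrow> finite (arr C)"
    and hyp: "\<And>Fo Fa. \<lbrakk>is_functor C (Inj :: ('x set, 'x inj_arr) precategory) Fo Fa;
      fin \<Longrightarrow> \<forall>x\<in>obj C. finite (Fo x)\<rbrakk> \<Longrightarrow> has_cocone C (Inj :: ('x set, 'x inj_arr) precategory) Fo Fa"
  shows "upward_simply_connected C"
proof (rule upward_simply_connected_canonical, rule subrelI)
  let ?L = "left_fundamental C"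
  let ?A = "\<lambda>x. {a \<in> arr ?L. tgt ?L a = x}" and ?m = "\<lambda>i. cmp ?L (left_eta C i)"
  fix x w a b assume w: "path C x w x" and ab: "(a, b) \<in> zigzag C ?A ?m x w"
  interpret M: monic_functor C ?L "\<lambda>x. x" "left_eta C" by (rule monic_functor_left_eta)
  interpret A: injective_diagram C ?A ?m by (rule M.injective_diagram_canonical)
  obtain A' where A': "injective_diagram C A' ?m" "\<And>z. A' z \<subseteq> ?A z" "fin \<Longrightarrow> \<forall>z. finite (A' z)"
    "(a, b) \<in> zigzag C A' ?m x w"
  proof (cases fin)
    case True
    obtain A' where "injective_diagram C A' ?m" "\<forall>z. A' z \<subseteq> ?A z \<and> finite (A' z)"
      "(a, b) \<in> zigzag C A' ?m x w"
      using A.finite_subdiagram[OF fin[OF True] ab w] by (elim exE conjE)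
    then show ?thesis by (intro that[of A']) auto
  next
    case False
    then show ?thesis using that[OF A.injective_diagram_axioms _ _ ab] by simp
  qed
  interpret A': injective_diagram C A' ?m by fact
  have sub: "(\<Union>x\<in>obj C. A' x) \<subseteq> arr ?L" using A'(2) by fastforce
  obtain e :: "('o, 'm) word set \<Rightarrow> 'x" where e: "inj_on e (arr ?L)"
    using countable_inj_infinite[OF countable_left_fundamental[OF cnt] inf] by blast
  note im = A'.image_diagram[OF inj_on_subset[OF e sub]]
  let ?B = "\<lambda>x. e ` A' x" and ?n = "\<lambda>i. e \<circ> ?m i \<circ> inv_into (\<Union>x\<in>obj C. A' x) e"
  interpret B: injective_diagram C ?B ?n by (rule im(1))
  have "zigzag C ?B ?n x w \<subseteq> Id"
    by (rule B.cocone_zigzag[OF hyp[OF B.functor_Inj] w]) (use A'(3) in blast)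
  then have "e a = e b" using im(2)[OF A'(4) w] by blast
  moreover have "a \<in> arr ?L" "b \<in> arr ?L"
    using A'.zigzag_subset[OF w] A'(4) A'(2)[of x] by auto
  ultimately show "(a, b) \<in> Id" using e by (auto dest: inj_onD)
qed

end

section \<open>The monic quotient of a category with amalgamation\<close>

definition equalized :: "('o, 'm) precategory \<Rightarrow> 'm rel" where
  "equalized C = {(a, b). a \<in> arr C \<and> b \<in> arr C \<and> src C a = src C b \<and> tgt C a = tgt C b \<and>
     (\<exists>h\<in>arr C. src C h = tgt C a \<and> cmp C h a = cmp C h b)}"

definition monic_quotient :: "('o, 'm) precategory \<Rightarrow> ('o, 'm set) precategory" where
  "monic_quotient C = quotient_cat C (equalized C)"

locale ap_category = category C for C :: "('o, 'm) precategory" +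
  assumes ap: "has_AP C"
begin

lemma amalgamE:
  assumes "f \<in> arr C" "g \<in> arr C" "src C f = src C g"
  obtains h k where "h \<in> arr C" "k \<in> arr C" "src C h = tgt C f" "src C k = tgt C g" "tgt C h = tgt C k"
    "cmp C h f = cmp C k g"
  using assms ap unfolding has_AP_iff[OF category_axioms] amalgamates_def by blast

text \<open>The arrows equalizing the two pairs have the same source, so they can be amalgamated,
  and the common extension equalizes both pairs.\<close>

lemma equalized_trans:
  assumes "(a, b) \<in> equalized C" "(b, c) \<in> equalized C"
  shows "(a, c) \<in> equalized C"
proof -
  obtain h k where h: "h \<in> arr C" "src C h = tgt C a" "cmp C h a = cmp C h b"
    and k: "k \<in> arr C" "src C k = tgt C b" "cmp C k b = cmp C k c"
    and a: "a \<in> arr C" "b \<in> arr C" "c \<in> arr C" "src C a = src C b" "src C b = src C c"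
    "tgt C a = tgt C b" "tgt C b = tgt C c"
    using assms by (auto simp: equalized_def)
  obtain p q where p: "p \<in> arr C" "q \<in> arr C" "src C p = tgt C h" "src C q = tgt C k" "cmp C p h = cmp C q k"
    by (rule amalgamE[of h k]) (use h k a in auto)
  have "cmp C (cmp C p h) a = cmp C (cmp C p h) b" using h p(1-4) a by (simp add: cmp_assoc')
  also have "\<dots> = cmp C (cmp C p h) c" using k p(1-4) a by (simp add: p(5) cmp_assoc')
  finally show ?thesis
    using cmp_arr[OF h(1) p(1,3)] cmp_src[OF h(1) p(1,3)] h(2) a by (auto simp: equalized_def)
qed

lemma congruence_equalized: "category_congruence C (equalized C)"
proof -
  have sym: "(b, a) \<in> equalized C" if "(a, b) \<in> equalized C" for a b
    using that by (auto simp: equalized_def)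
  have "equiv (arr C) (equalized C)"
  proof (rule equivI)
    show "refl_on (arr C) (equalized C)"
      using idn_hom tgt_obj by (fastforce simp: refl_on_def equalized_def hom_def)
    show "sym (equalized C)" using sym by (rule symI)
    show "trans (equalized C)" using equalized_trans by (rule transI)
  qed (auto simp: equalized_def)
  moreover have "(cmp C g f, cmp C g' f') \<in> equalized C"
    if ff: "(f, f') \<in> equalized C" and gg: "(g, g') \<in> equalized C" and "src C g = tgt C f" for f f' g g'
  \<comment> \<open>The middle term is \<open>cmp C g f'\<close>. Replacing \<open>f\<close> needs
    an amalgam of its equalizing arrow with \<open>g\<close>; replacing \<open>g\<close> is mere
    precomposition.\<close>
  proof (rule equalized_trans)
    from ff gg that have f: "f \<in> arr C" "f' \<in> arr C" "src C f' = src C f" "tgt C f' = tgt C f"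
      and g: "g \<in> arr C" "g' \<in> arr C" "src C g = tgt C f" "src C g' = tgt C f" "tgt C g' = tgt C g"
      by (auto simp: equalized_def)
    obtain h where h: "h \<in> arr C" "src C h = tgt C f" "cmp C h f = cmp C h f'"
      using ff by (auto simp: equalized_def)
    obtain p q where p: "p \<in> arr C" "q \<in> arr C" "src C p = tgt C h" "src C q = tgt C g" "cmp C p h = cmp C q g"
      by (rule amalgamE[of h g]) (use h g in auto)
    have "cmp C q (cmp C g f) = cmp C (cmp C p h) f" using f g p(1-4) by (simp add: p(5) cmp_assoc')
    also have "\<dots> = cmp C (cmp C p h) f'" using f h p(1-4) by (simp add: cmp_assoc')
    also have "\<dots> = cmp C q (cmp C g f')" using f g p(1-4) by (simp add: p(5) cmp_assoc')
    finally show "(cmp C g f, cmp C g f') \<in> equalized C"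
      using f g p by (auto simp: equalized_def cmp_arr cmp_src cmp_tgt intro!: bexI[of _ q])
    obtain k where k: "k \<in> arr C" "src C k = tgt C g" "cmp C k g = cmp C k g'"
      using gg by (auto simp: equalized_def)
    have "cmp C k (cmp C g f') = cmp C (cmp C k g) f'" using f g k(1,2) by (simp add: cmp_assoc')
    also have "\<dots> = cmp C (cmp C k g') f'" by (simp only: k(3))
    also have "\<dots> = cmp C k (cmp C g' f')" using f g k(1,2) by (simp add: cmp_assoc')
    finally show "(cmp C g f', cmp C g' f') \<in> equalized C"
      using f g k(1,2) by (auto simp: equalized_def cmp_arr cmp_src cmp_tgt intro!: bexI[of _ k])
  qed
  moreover have "src C f = src C f' \<and> tgt C f = tgt C f'" if "(f, f') \<in> equalized C" for f f'
    using that by (simp add: equalized_def)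
  ultimately show ?thesis unfolding category_congruence_def by blast
qed

abbreviation "Q \<equiv> monic_quotient C"
abbreviation "cls f \<equiv> equalized C `` {f}"

lemmas monic_quotient = category_quotient_cat[OF category_axioms congruence_equalized,
    folded monic_quotient_def]

lemma obj_monic_quotient [simp]: "obj Q = obj C" and idn_monic_quotient [simp]: "idn Q x = cls (idn C x)"
  by (simp_all add: monic_quotient_def quotient_cat_def)

lemma cls_arr: "f \<in> arr C \<Longrightarrow> cls f \<in> arr Q"
  by (simp add: monic_quotient_def quotient_cat_def quotientI)

lemma cls_arrE: assumes "c \<in> arr Q" obtains f where "f \<in> arr C" "c = cls f"
  using assms by (auto simp: monic_quotient_def quotient_cat_def elim!: quotientE)

lemma cls_eq_iff: "\<lbrakk>f \<in> arr C; g \<in> arr C\<rbrakk> \<Longrightarrow> cls f = cls g \<longleftrightarrow> (f, g) \<in> equalized C"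
  using congruence_equalized[unfolded category_congruence_def, THEN conjunct1] by (rule eq_equiv_class_iff)

lemma functor_cls: "is_functor C Q (\<lambda>x. x) (\<lambda>f. cls f)"
  by (auto simp: is_functor_def hom_def monic_quotient cls_arr)

lemma has_AP_monic_quotient: "has_AP Q"
  unfolding has_AP_iff[OF monic_quotient(1)]
proof (intro ballI impI)
  fix c d assume cd: "c \<in> arr Q" "d \<in> arr Q" "src Q c = src Q d"
  obtain f where f: "f \<in> arr C" "c = cls f" using cd(1) by (rule cls_arrE)
  obtain g where g: "g \<in> arr C" "d = cls g" using cd(2) by (rule cls_arrE)
  have "src C f = src C g" using cd f g monic_quotient(2) by simp
  with f(1) g(1) obtain h k where hk: "h \<in> arr C" "k \<in> arr C" "src C h = tgt C f" "src C k = tgt C g"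
    "tgt C h = tgt C k" "cmp C h f = cmp C k g" by (rule amalgamE)
  then have "amalgamates Q c d (cls h) (cls k)"
    using f g by (simp add: amalgamates_def monic_quotient cls_arr)
  then show "\<exists>h k. amalgamates Q c d h k" by blast
qed

lemma has_JEP_monic_quotient:
  assumes "has_JEP C"
  shows "has_JEP Q"
proof -
  have "cls f \<in> hom Q x y" if "f \<in> hom C x y" for f x y
    using that by (auto simp: hom_def monic_quotient cls_arr)
  then have "hom Q x y \<noteq> {}" if "hom C x y \<noteq> {}" for x y using that by blast
  then show ?thesis
    using assms unfolding has_JEP_iff[OF monic_quotient(1)] has_JEP_iff[OF category_axioms] obj_monic_quotient
    by metis
qed

text \<open>If \<open>k\<close> equalizes \<open>cmp C h f\<close> and \<open>cmp C h g\<close>,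
  then \<open>cmp C k h\<close> equalizes \<open>f\<close> and \<open>g\<close>.\<close>

lemma monic_monic_quotient:
  assumes "c \<in> arr Q" "a \<in> arr Q" "b \<in> arr Q" "tgt Q a = src Q c" "tgt Q b = src Q c"
    and eq: "cmp Q c a = cmp Q c b"
  shows "a = b"
proof -
  obtain h where h: "h \<in> arr C" "c = cls h" using assms(1) by (rule cls_arrE)
  obtain f where f: "f \<in> arr C" "a = cls f" using assms(2) by (rule cls_arrE)
  obtain g where g: "g \<in> arr C" "b = cls g" using assms(3) by (rule cls_arrE)
  have t: "src C h = tgt C f" "src C h = tgt C g" using assms f g h by (auto simp: monic_quotient)
  then have "cls (cmp C h f) = cls (cmp C h g)" using eq f g h by (simp add: monic_quotient)
  then have "(cmp C h f, cmp C h g) \<in> equalized C" using t f g h by (simp add: cls_eq_iff cmp_arr)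
  then obtain k where k: "k \<in> arr C" "src C k = tgt C (cmp C h f)"
    "cmp C k (cmp C h f) = cmp C k (cmp C h g)" "src C (cmp C h f) = src C (cmp C h g)"
    unfolding equalized_def by blast
  have k': "src C k = tgt C h" "src C f = src C g"
    using k(2,4) t f(1) g(1) h(1) by (simp_all add: cmp_src cmp_tgt)
  have "cmp C (cmp C k h) f = cmp C (cmp C k h) g"
    using t f(1) g(1) h(1) k(1,3) k' by (simp add: cmp_assoc')
  moreover have "cmp C k h \<in> arr C" "src C (cmp C k h) = src C h"
    using h(1) k(1) k' by (simp_all add: cmp_arr cmp_src)
  ultimately have "(f, g) \<in> equalized C"
    using t f(1) g(1) k' by (auto simp: equalized_def)
  then show ?thesis using f g by (simp add: cls_eq_iff)
qed

text \<open>A cocone in the quotient satisfies its finitely many generating equations after composition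
  with a single further arrow.\<close>

lemma lift_cocone:
  assumes I: "category I" "finitely_generated I" and F: "is_functor I C Fo Fa"
    and c: "has_cocone I Q Fo (\<lambda>i. cls (Fa i))"
  shows "has_cocone I C Fo Fa"
proof -
  interpret I: category I by fact
  obtain X t where t: "is_cocone I Q Fo (\<lambda>i. cls (Fa i)) X t" using c unfolding has_cocone_def by blast
  have X: "X \<in> obj C" using t by (simp add: is_cocone_def)
  have "\<forall>x\<in>obj I. \<exists>g. g \<in> hom C (Fo x) X \<and> t x = cls g"
  proof
    fix x assume "x \<in> obj I"
    then have tx: "t x \<in> arr Q" "src Q (t x) = Fo x" "tgt Q (t x) = X"
      using t by (auto simp: is_cocone_def hom_def)
    obtain g where "g \<in> arr C" "t x = cls g" using tx(1) by (rule cls_arrE)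
    then show "\<exists>g. g \<in> hom C (Fo x) X \<and> t x = cls g" using tx by (auto simp: hom_def monic_quotient)
  qed
  then obtain s where s: "\<And>x. x \<in> obj I \<Longrightarrow> s x \<in> hom C (Fo x) X" "\<And>x. x \<in> obj I \<Longrightarrow> t x = cls (s x)"
    by metis
  have Fa: "Fa i \<in> arr C" "src C (Fa i) = Fo (src I i)" "tgt C (Fa i) = Fo (tgt I i)" if "i \<in> arr I" for i
    using F that by (auto simp: is_functor_def hom_def)
  have sa: "s x \<in> arr C" "src C (s x) = Fo x" "tgt C (s x) = X" if "x \<in> obj I" for x
    using s(1)[OF that] by (auto simp: hom_def)
  have eq: "(s (src I i), cmp C (s (tgt I i)) (Fa i)) \<in> equalized C" if i: "i \<in> arr I" for i
  proof -
    have "t (src I i) = cmp Q (t (tgt I i)) (cls (Fa i))"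
      using t i by (simp add: is_cocone_def)
    then have "cls (s (src I i)) = cls (cmp C (s (tgt I i)) (Fa i))"
      using s(2) I.src_obj[OF i] I.tgt_obj[OF i] sa Fa[OF i] by (simp add: monic_quotient)
    then show ?thesis
      using I.src_obj[OF i] I.tgt_obj[OF i] sa Fa[OF i] by (simp add: cls_eq_iff cmp_arr)
  qed
  obtain G where G: "finite G" "G \<subseteq> arr I" "arr_closure I G = arr I"
    using I(2) unfolding finitely_generated_def by blast
  have "\<exists>h\<in>arr C. src C h = X \<and> (\<forall>i\<in>G'. cmp C h (s (src I i)) = cmp C h (cmp C (s (tgt I i)) (Fa i)))"
    if "finite G'" "G' \<subseteq> arr I" for G'
    using that
  proof (induction G')
    case empty
    then show ?case using idn_hom[OF X] by (auto simp: hom_def)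
  next
    case (insert j G')
    then obtain h where h: "h \<in> arr C" "src C h = X"
      "\<forall>i\<in>G'. cmp C h (s (src I i)) = cmp C h (cmp C (s (tgt I i)) (Fa i))" by auto
    have j: "j \<in> arr I" "src I j \<in> obj I" "tgt I j \<in> obj I"
      using insert.prems I.src_obj I.tgt_obj by auto
    obtain k where k: "k \<in> arr C" "src C k = X" "cmp C k (s (src I j)) = cmp C k (cmp C (s (tgt I j)) (Fa j))"
      using eq[OF j(1)] sa[OF j(2)] by (auto simp: equalized_def)
    obtain p q where p: "p \<in> arr C" "q \<in> arr C" "src C p = tgt C h" "src C q = tgt C k" "cmp C p h = cmp C q k"
      by (rule amalgamE[of h k]) (use h k in auto)
    have "cmp C (cmp C p h) (s (src I i)) = cmp C (cmp C p h) (cmp C (s (tgt I i)) (Fa i))"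
      if i: "i \<in> insert j G'" for i
    proof -
      have i': "i \<in> arr I" "src I i \<in> obj I" "tgt I i \<in> obj I"
        using i insert.prems I.src_obj I.tgt_obj by auto
      note st = i' sa[OF i'(2)] sa[OF i'(3)] Fa[OF i'(1)] cmp_arr cmp_src cmp_tgt cmp_assoc'
      show ?thesis
      proof (cases "i = j")
        case True
        \<comment> \<open>The equation of the new arrow \<open>j\<close> holds after
          \<open>k\<close>, hence after \<open>cmp C q k\<close>, which is the same arrow as
          \<open>cmp C p h\<close>.\<close>
        have "cmp C (cmp C q k) (s (src I j)) = cmp C (cmp C q k) (cmp C (s (tgt I j)) (Fa j))"
          using k p st[unfolded True] by simp
        then show ?thesis using True p(5) by simp
      next
        case False
        then have "i \<in> G'" using i by simp
        then show ?thesis using h p(1-4) st by simp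
      qed
    qed
    then show ?case
      using cmp_arr[OF h(1) p(1,3)] cmp_src[OF h(1) p(1,3)] h(2) by (intro bexI[of _ "cmp C p h"]) blast+
  qed
  from this[OF G(1,2)] obtain h where h: "h \<in> arr C" "src C h = X"
    "\<And>i. i \<in> G \<Longrightarrow> cmp C h (s (src I i)) = cmp C h (cmp C (s (tgt I i)) (Fa i))" by auto
  have "f \<in> arr I \<and> cmp C h (s (src I f)) = cmp C (cmp C h (s (tgt I f))) (Fa f)" if "f \<in> arr_closure I G" for f
    using that
  proof induction
    case (gen f)
    then have "f \<in> arr I" using G by auto
    then show ?case
      using h(3)[OF gen] sa[OF I.tgt_obj[of f]] Fa[of f] h by (simp add: cmp_assoc')
  next
    case (cmp f g)
    then have fg: "f \<in> arr I" "g \<in> arr I" "src I g = tgt I f" by auto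
    have "cmp C h (s (src I f)) = cmp C (cmp C h (s (src I g))) (Fa f)" using cmp fg by simp
    also have "\<dots> = cmp C (cmp C (cmp C h (s (tgt I g))) (Fa g)) (Fa f)" using cmp by simp
    also have "\<dots> = cmp C (cmp C h (s (tgt I g))) (cmp C (Fa g) (Fa f))"
      using sa[OF I.tgt_obj[OF fg(2)]] Fa[OF fg(1)] Fa[OF fg(2)] fg h
      by (intro cmp_assoc') (auto simp: cmp_arr cmp_src cmp_tgt)
    finally show ?case
      using fg F by (simp add: is_functor_def I.cmp_arr I.cmp_src I.cmp_tgt)
  qed
  then have "is_cocone I C Fo Fa (tgt C h) (\<lambda>x. cmp C h (s x))"
    using h sa tgt_obj unfolding is_cocone_def G(3) by (auto simp: hom_def cmp_arr cmp_src cmp_tgt)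
  then show ?thesis unfolding has_cocone_def by blast
qed

text \<open>A Yoneda argument: the two actions on arrows into \<open>Fo x\<close> agree, and their
  values at the identity are \<open>Fa i\<close> and \<open>Fa j\<close>.\<close>

lemma parallel_arrows_eq:
  assumes I: "category I" "upward_simply_connected I" and F: "is_functor I Q Fo Fa"
    and ij: "i \<in> hom I x y" "j \<in> hom I x y"
  shows "Fa i = Fa j"
proof -
  interpret Q: category Q by (rule monic_quotient(1))
  have Fa: "Fa k \<in> hom Q (Fo (src I k)) (Fo (tgt I k))" if "k \<in> arr I" for k
    using F that by (auto simp: is_functor_def)
  interpret A: injective_diagram I "\<lambda>x. {a \<in> arr Q. tgt Q a = Fo x}" "\<lambda>i. cmp Q (Fa i)"
  proof (rule functor_injective_diagram[OF I(1) monic_quotient(1) F])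
    fix k a b
    assume "k \<in> arr I" "a \<in> arr Q" "b \<in> arr Q" "tgt Q a = Fo (src I k)" "tgt Q b = Fo (src I k)"
      "cmp Q (Fa k) a = cmp Q (Fa k) b"
    then show "a = b" using monic_monic_quotient[of "Fa k" a b] Fa[of k] by (simp add: hom_def)
  qed
  have "x \<in> obj I" using A.hom_obj ij by blast
  then have "Fo x \<in> obj Q" using F unfolding is_functor_def by blast
  then have "idn Q (Fo x) \<in> hom Q (Fo x) (Fo x)" by (rule Q.idn_hom)
  then have "cmp Q (Fa i) (idn Q (Fo x)) = cmp Q (Fa j) (idn Q (Fo x))"
    using ij by (intro A.parallel_maps_eq[OF I(2)]) (auto simp: hom_def)
  then show ?thesis
    using Q.cmp_idn_right Fa[of i] Fa[of j] ij unfolding hom_def by (metis (mono_tags, lifting) mem_Collect_eq)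
qed

end

section \<open>Connectedness\<close>

lemma connected_cat_iff:
  "connected_cat C \<longleftrightarrow> obj C \<noteq> {} \<and>
    (\<forall>x\<in>obj C. \<forall>y\<in>obj C. equivclp (\<lambda>a b. hom C a b \<noteq> {}) x y)"
proof -
  define R where "R = {(x, y) \<in> obj C \<times> obj C. equivclp (\<lambda>a b. hom C a b \<noteq> {}) x y}"
  have R: "equiv (obj C) R"
    unfolding R_def
    by (rule equivI) (auto intro!: refl_onI symI transI intro: equivclp_sym equivclp_trans)
  have c: "connected_cat C \<longleftrightarrow> (\<exists>!K. K \<in> obj C // R)"
    unfolding connected_cat_def components_def R_def ..
  show ?thesis
  proof
    assume "connected_cat C"
    then obtain K where K: "K \<in> obj C // R" "\<And>L. L \<in> obj C // R \<Longrightarrow> L = K"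
      unfolding c by (elim ex1E) blast
    then have "obj C \<noteq> {}" by auto
    moreover have "equivclp (\<lambda>a b. hom C a b \<noteq> {}) x y" if "x \<in> obj C" "y \<in> obj C" for x y
    proof -
      have "R `` {x} = R `` {y}" using K(2)[OF quotientI] that by simp
      then have "(x, y) \<in> R" using eq_equiv_class_iff[OF R that] by simp
      then show ?thesis by (simp add: R_def)
    qed
    ultimately show "obj C \<noteq> {} \<and> (\<forall>x\<in>obj C. \<forall>y\<in>obj C. equivclp (\<lambda>a b. hom C a b \<noteq> {}) x y)" by blast
  next
    assume e: "obj C \<noteq> {} \<and> (\<forall>x\<in>obj C. \<forall>y\<in>obj C. equivclp (\<lambda>a b. hom C a b \<noteq> {}) x y)"
    then have "R `` {x} = obj C" if "x \<in> obj C" for x using that by (auto simp: R_def)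
    then have "L = obj C" if "L \<in> obj C // R" for L using that by (metis quotientE)
    moreover obtain x where "x \<in> obj C" using e by blast
    then have "R `` {x} \<in> obj C // R" by (rule quotientI)
    ultimately show "connected_cat C" unfolding c by blast
  qed
qed

lemma equivclp_invariant:
  assumes "equivclp r x y" "\<And>a b. r a b \<Longrightarrow> f a = f b"
  shows "f x = f y"
  using assms(1)
proof (induction rule: equivclp_induct)
  case (step y z)
  then show ?case using assms(2)[of y z] assms(2)[of z y] by auto
qed simp

lemma equivclp_map:
  assumes "equivclp r x y" "\<And>a b. r a b \<Longrightarrow> equivclp s (f a) (f b)"
  shows "equivclp s (f x) (f y)"
  using assms(1)
proof (induction rule: equivclp_induct)
  case (step y z)
  then have "equivclp s (f y) (f z)" using assms(2)[of y z] assms(2)[of z y] equivclp_sym by metis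
  with step.IH show ?case by (rule equivclp_trans)
qed simp

section \<open>Cocones over tree-like and forest-like posets\<close>

text \<open>For connectedness, the new point reaches each \<open>K k\<close> through the nonempty
  \<open>U k\<close>, and \<open>K k\<close> is connected by induction.\<close>

lemma tree_like_facts:
  assumes "tree_like P r"
  shows tree_like_subset: "r \<subseteq> P \<times> P" and tree_like_refl: "\<And>x. x \<in> P \<Longrightarrow> (x, x) \<in> r"
    and tree_like_connected: "connected_cat (preorder_cat P r)"
proof -
  have "r \<subseteq> P \<times> P \<and> (\<forall>x\<in>P. (x, x) \<in> r) \<and> connected_cat (preorder_cat P r)"
    using assms
  proof induction
    case (adjoin n K r U p)
    let ?P = "insert p (\<Union>k<n. K k)" and ?r = "(\<Union>k<n. r k) \<union> {p} \<times> insert p (\<Union>k<n. U k)"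
    have U: "U k \<subseteq> K k" if "k < n" for k using adjoin.hyps that by (auto simp: upward_closed_in_def)
    have sub: "?r \<subseteq> ?P \<times> ?P" using adjoin.IH U by fastforce
    let ?h = "\<lambda>a b. hom (preorder_cat ?P ?r) a b \<noteq> {}"
    have h: "?h a b" if "(a, b) \<in> ?r" for a b
      using that subsetD[OF sub that] unfolding hom_preorder_cat by blast
    have p: "equivclp ?h p x" if x: "x \<in> K k" and k: "k < n" for k x
    proof -
      obtain u where u: "u \<in> U k" using adjoin.hyps(4)[OF k] unfolding connected_cat_iff by auto
      then have "?h p u" using k by (intro h) auto
      moreover have "equivclp (\<lambda>a b. hom (preorder_cat (K k) (r k)) a b \<noteq> {}) u x"
        using adjoin.IH[OF k] u x U[OF k] unfolding connected_cat_iff by auto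
      then have "equivclp ?h u x"
      proof (rule equivclp_map[where f = "\<lambda>x. x"])
        fix a b assume "hom (preorder_cat (K k) (r k)) a b \<noteq> {}"
        then have "(a, b) \<in> r k" by (auto simp: hom_preorder_cat)
        then have "?h a b" using k by (intro h) auto
        then show "equivclp ?h a b" by (rule r_into_equivclp)
      qed
      with r_into_equivclp[of ?h, OF \<open>?h p u\<close>] show ?thesis by (rule equivclp_trans)
    qed
    then have px: "equivclp ?h p x" if "x \<in> ?P" for x
      using that equivclp_refl[of ?h p] by (elim insertE UN_E) simp_all
    have "equivclp ?h x y" if "x \<in> ?P" "y \<in> ?P" for x y
      using equivclp_trans[OF equivclp_sym[OF px] px] that .
    then have "connected_cat (preorder_cat ?P ?r)" unfolding connected_cat_iff by simp
    moreover have "\<forall>x\<in>?P. (x, x) \<in> ?r" using adjoin.IH by blast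
    ultimately show ?case using sub by blast
  qed
  then show "r \<subseteq> P \<times> P" "\<And>x. x \<in> P \<Longrightarrow> (x, x) \<in> r" "connected_cat (preorder_cat P r)" by auto
qed

lemma functor_preorder_subset:
  assumes "is_functor (preorder_cat P r) C Fo Fa" "K \<subseteq> P" "s \<subseteq> r"
  shows "is_functor (preorder_cat K s) C Fo Fa"
proof -
  have "f \<in> arr (preorder_cat P r)" if "f \<in> arr (preorder_cat K s)" for f
    using that assms(2,3) by auto
  then show ?thesis
    using assms unfolding is_functor_def by (simp add: subset_iff del: preorder_cat_simps(2))
qed

lemma functor_preorder_arrow:
  assumes "is_functor (preorder_cat P r) C Fo Fa" "(x, y) \<in> r" "x \<in> P" "y \<in> P"
  shows "Fa (x, y) \<in> hom C (Fo x) (Fo y)"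
proof -
  have "(x, y) \<in> arr (preorder_cat P r)" using assms by simp
  then show ?thesis using assms(1) unfolding is_functor_def by fastforce
qed

text \<open>Each \<open>K k\<close> has a cocone by induction. As \<open>U k\<close> is connected,
  the composites from \<open>p\<close> through the points of \<open>U k\<close> to the vertex of
  this cocone all agree. So \<open>p\<close> has a single arrow \<open>m k\<close> to each vertex,
  and amalgamating these arrows makes all legs compatible.\<close>

lemma cocone_tree_like:
  assumes "tree_like P r" "ap_category C"
  shows "is_functor (preorder_cat P r) C Fo Fa \<Longrightarrow> has_cocone (preorder_cat P r) C Fo Fa"
  using assms(1)
proof induction
  case (adjoin n K r U p)
  interpret ap_category C by fact
  let ?P = "insert p (\<Union>k<n. K k)" and ?r = "(\<Union>k<n. r k) \<union> {p} \<times> insert p (\<Union>k<n. U k)"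
  note F = adjoin.prems
  have U: "U k \<subseteq> K k" if "k < n" for k using adjoin.hyps that by (auto simp: upward_closed_in_def)
  have r: "r k \<subseteq> K k \<times> K k" "\<And>x. x \<in> K k \<Longrightarrow> (x, x) \<in> r k" if "k < n" for k
    using tree_like_facts[OF adjoin.hyps(1)[OF that]] by auto
  have "has_cocone (preorder_cat (K k) (r k)) C Fo Fa" if "k < n" for k
    by (rule adjoin.IH[OF that], rule functor_preorder_subset[OF F]) (use that in auto)
  then obtain X t where t: "\<And>k. k < n \<Longrightarrow> is_cocone (preorder_cat (K k) (r k)) C Fo Fa (X k) (t k)"
    unfolding has_cocone_def by metis
  have th: "t k x \<in> hom C (Fo x) (X k)" if "k < n" "x \<in> K k" for k x
    using t that by (simp add: is_cocone_def)
  have tc: "t k x = cmp C (t k y) (Fa (x, y))" if "k < n" "(x, y) \<in> r k" for k x y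
  proof -
    have "(x, y) \<in> arr (preorder_cat (K k) (r k))" using that r by auto
    then show ?thesis using t[OF that(1)] unfolding is_cocone_def by fastforce
  qed
  have Fp: "Fa (p, u) \<in> hom C (Fo p) (Fo u)" if "k < n" "u \<in> U k" for k u
    by (rule functor_preorder_arrow[OF F]) (use that U[OF that(1)] in auto)
  have "\<exists>m. m \<in> hom C (Fo p) (X k) \<and> (\<forall>u\<in>U k. cmp C (t k u) (Fa (p, u)) = m)" if k: "k < n" for k
  proof -
    let ?f = "\<lambda>u. cmp C (t k u) (Fa (p, u))"
    have step: "?f u = ?f v" if "hom (preorder_cat (U k) (r k)) u v \<noteq> {}" for u v
    proof -
      from that have uv: "u \<in> U k" "v \<in> U k" "(u, v) \<in> r k"
        by (auto simp: hom_preorder_cat split: if_splits)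
      then have K: "u \<in> K k" "v \<in> K k" using U[OF k] by auto
      have Fuv: "Fa (u, v) \<in> hom C (Fo u) (Fo v)"
        by (rule functor_preorder_arrow[OF F]) (use uv k K in auto)
      have "(p, u) \<in> arr (preorder_cat ?P ?r)" "(u, v) \<in> arr (preorder_cat ?P ?r)" using uv K k by auto
      then have "Fa (p, v) = cmp C (Fa (u, v)) (Fa (p, u))"
        using F unfolding is_functor_def by fastforce
      then show ?thesis
        using tc[OF k uv(3)] cmp_assoc[OF Fp[OF k uv(1)] Fuv th[OF k K(2)]] by simp
    qed
    obtain u where u: "u \<in> U k" using adjoin.hyps(4)[OF k] unfolding connected_cat_iff by auto
    have "?f u = ?f v" if "v \<in> U k" for v
    proof -
      have "equivclp (\<lambda>a b. hom (preorder_cat (U k) (r k)) a b \<noteq> {}) u v"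
        using adjoin.hyps(4)[OF k] u that unfolding connected_cat_iff by simp
      then show ?thesis using step by (rule equivclp_invariant)
    qed
    moreover have "?f u \<in> hom C (Fo p) (X k)"
      using cmp_hom[OF Fp[OF k u] th[OF k]] u U[OF k] by blast
    ultimately show ?thesis by (intro exI[of _ "?f u"]) auto
  qed
  then obtain m where m: "\<And>k. k < n \<Longrightarrow> m k \<in> hom C (Fo p) (X k)"
    "\<And>k u. \<lbrakk>k < n; u \<in> U k\<rbrakk> \<Longrightarrow> cmp C (t k u) (Fa (p, u)) = m k" by metis
  have Fop: "Fo p \<in> obj C" using F by (simp add: is_functor_def)
  then obtain Y g where g: "g \<in> hom C (Fo p) Y" "\<And>k. k < n \<Longrightarrow> \<exists>h\<in>hom C (X k) Y. cmp C h (m k) = g"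
    using wide_amalgamation[OF category_axioms ap, of "Fo p" n m X] m(1) by blast
  then obtain h where h: "\<And>k. k < n \<Longrightarrow> h k \<in> hom C (X k) Y" "\<And>k. k < n \<Longrightarrow> cmp C (h k) (m k) = g"
    by metis
  \<comment> \<open>By disjointness each point other than \<open>p\<close> lies in exactly one
    \<open>K k\<close>, so the legs of the separate cocones can be glued.\<close>
  define i where "i x = (THE k. k < n \<and> x \<in> K k)" for x
  have i: "i x = k" if "k < n" "x \<in> K k" for k x
    unfolding i_def
    by (rule the_equality) (use that adjoin.hyps(2) in \<open>auto simp: disjoint_family_on_def\<close>)
  define s where "s x = (if x = p then g else cmp C (h (i x)) (t (i x) x))" for x
  have sp: "s p = g" by (simp add: s_def)
  have sK: "s x = cmp C (h k) (t k x)" if "k < n" "x \<in> K k" for k x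
    using i[OF that] adjoin.hyps(5) that by (auto simp: s_def)
  have "is_cocone (preorder_cat ?P ?r) C Fo Fa Y s"
    unfolding is_cocone_def
  proof (intro conjI ballI)
    show "Y \<in> obj C" using g(1) hom_obj by blast
    show "s x \<in> hom C (Fo x) Y" if "x \<in> obj (preorder_cat ?P ?r)" for x
      using that sp sK g(1) cmp_hom[OF th h(1)] by auto
    fix a assume "a \<in> arr (preorder_cat ?P ?r)"
    then have "(\<exists>k<n. a \<in> r k) \<or> a = (p, p) \<or> (\<exists>k<n. \<exists>u\<in>U k. a = (p, u))" by auto
    then consider k x y where "k < n" "a = (x, y)" "(x, y) \<in> r k" | "a = (p, p)"
      | k u where "k < n" "u \<in> U k" "a = (p, u)" by (metis surj_pair)
    then show "s (src (preorder_cat ?P ?r) a) = cmp C (s (tgt (preorder_cat ?P ?r) a)) (Fa a)"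
    proof cases
      case 1
      then have K: "x \<in> K k" "y \<in> K k" using r by auto
      have Fxy: "Fa (x, y) \<in> hom C (Fo x) (Fo y)"
        by (rule functor_preorder_arrow[OF F]) (use 1 K in auto)
      show ?thesis
        using 1 sK[OF 1(1) K(1)] sK[OF 1(1) K(2)] tc[OF 1(1,3)] cmp_assoc[OF Fxy th[OF 1(1) K(2)] h(1)[OF 1(1)]]
        by simp
    next
      case 2
      have "Fa (p, p) = idn C (Fo p)" using F by (simp add: is_functor_def)
      then show ?thesis using 2 sp cmp_idn_right[OF g(1)] by simp
    next
      case 3
      then have K: "u \<in> K k" using U by auto
      show ?thesis
        using 3 sp sK[OF 3(1) K] m(2)[OF 3(1,2)] h(2)[OF 3(1)]
          cmp_assoc[OF Fp[OF 3(1,2)] th[OF 3(1) K] h(1)[OF 3(1)]]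
        by simp
    qed
  qed
  then show ?case unfolding has_cocone_def by blast
qed

lemma forest_likeE:
  assumes "forest_like P r"
  obtains n :: nat and K s where "\<And>k. k < n \<Longrightarrow> tree_like (K k) (s k)" "disjoint_family_on K {..<n}"
    "P = (\<Union>k<n. K k)" "r = (\<Union>k<n. s k)"
  using assms that unfolding forest_like_def by blast

text \<open>No relation crosses between two trees, so once the JEP has mapped the vertices of their
  cocones to one object, no further equation has to be met.\<close>

lemma cocone_forest_like:
  assumes P: "forest_like P r" and C: "ap_category C" "has_JEP C"
    and F: "is_functor (preorder_cat P r) C Fo Fa"
  shows "has_cocone (preorder_cat P r) C Fo Fa"
proof -
  interpret ap_category C by fact
  obtain n :: nat and K s where K: "\<And>k. k < n \<Longrightarrow> tree_like (K k) (s k)" "disjoint_family_on K {..<n}"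
    "P = (\<Union>k<n. K k)" "r = (\<Union>k<n. s k)" using P by (rule forest_likeE) blast
  have s: "s k \<subseteq> K k \<times> K k" if "k < n" for k using tree_like_subset[OF K(1)[OF that]] .
  have "has_cocone (preorder_cat (K k) (s k)) C Fo Fa" if "k < n" for k
    by (rule cocone_tree_like[OF K(1)[OF that] C(1)], rule functor_preorder_subset[OF F])
      (use that K(3,4) in auto)
  then obtain X t where t: "\<And>k. k < n \<Longrightarrow> is_cocone (preorder_cat (K k) (s k)) C Fo Fa (X k) (t k)"
    unfolding has_cocone_def by metis
  have th: "t k x \<in> hom C (Fo x) (X k)" if "k < n" "x \<in> K k" for k x
    using t that by (simp add: is_cocone_def)
  have tc: "t k x = cmp C (t k y) (Fa (x, y))" if "k < n" "(x, y) \<in> s k" for k x y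
  proof -
    have "(x, y) \<in> arr (preorder_cat (K k) (s k))" using that s by auto
    then show ?thesis using t[OF that(1)] unfolding is_cocone_def by fastforce
  qed
  have "\<forall>k\<in>{..<n}. X k \<in> obj C" using t by (simp add: is_cocone_def)
  then obtain Y where Y: "Y \<in> obj C" "\<forall>k\<in>{..<n}. hom C (X k) Y \<noteq> {}"
    using joint_embedding_finite[OF category_axioms _ _ finite_lessThan[of n], of X] C(2)
    unfolding has_JEP_iff[OF category_axioms] by blast
  then have "\<forall>k. \<exists>h. k < n \<longrightarrow> h \<in> hom C (X k) Y" by blast
  then obtain h where h: "\<And>k. k < n \<Longrightarrow> h k \<in> hom C (X k) Y" by metis
  define i where "i x = (THE k. k < n \<and> x \<in> K k)" for x
  have i: "i x = k" if "k < n" "x \<in> K k" for k x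
    unfolding i_def
    by (rule the_equality) (use that K(2) in \<open>auto simp: disjoint_family_on_def\<close>)
  define g where "g x = cmp C (h (i x)) (t (i x) x)" for x
  have g: "g x = cmp C (h k) (t k x)" if "k < n" "x \<in> K k" for k x
    using i[OF that] by (simp add: g_def)
  have "is_cocone (preorder_cat P r) C Fo Fa Y g"
    unfolding is_cocone_def
  proof (intro conjI ballI)
    show "Y \<in> obj C" by fact
    show "g x \<in> hom C (Fo x) Y" if "x \<in> obj (preorder_cat P r)" for x
      using that K(3) g cmp_hom[OF th h] by auto
    fix a assume a: "a \<in> arr (preorder_cat P r)"
    then obtain k x y where k: "k < n" "a = (x, y)" "(x, y) \<in> s k" using K(4) by auto
    then have xy: "x \<in> K k" "y \<in> K k" using s by auto
    have Fxy: "Fa (x, y) \<in> hom C (Fo x) (Fo y)"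
      by (rule functor_preorder_arrow[OF F]) (use k xy K in auto)
    show "g (src (preorder_cat P r) a) = cmp C (g (tgt (preorder_cat P r) a)) (Fa a)"
      using k g[OF k(1) xy(1)] g[OF k(1) xy(2)] tc[OF k(1,3)] cmp_assoc[OF Fxy th[OF k(1) xy(2)] h[OF k(1)]]
      by simp
  qed
  then show ?thesis unfolding has_cocone_def by blast
qed

text \<open>Membership in one of the trees is constant along zigzags, so connectedness leaves
  exactly one tree.\<close>

lemma forest_like_connected:
  assumes "forest_like P r" "connected_cat (preorder_cat P r)"
  shows "tree_like P r"
proof -
  obtain n :: nat and K s where K: "\<And>k. k < n \<Longrightarrow> tree_like (K k) (s k)" "disjoint_family_on K {..<n}"
    "P = (\<Union>k<n. K k)" "r = (\<Union>k<n. s k)" using assms(1) by (rule forest_likeE) blast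
  have s: "s k \<subseteq> K k \<times> K k" if "k < n" for k using tree_like_subset[OF K(1)[OF that]] .
  have ne: "K k \<noteq> {}" if "k < n" for k
    using tree_like_connected[OF K(1)[OF that]] unfolding connected_cat_iff by simp
  have one: "k = l" if kl: "k < n" "l < n" for k l
  proof -
    obtain x y where xy: "x \<in> K k" "y \<in> K l" using ne kl by blast
    have disj: "j = k" if "x \<in> K j" "x \<in> K k" "j < n" "k < n" for x j k
      using K(2) that unfolding disjoint_family_on_def by blast
    have "equivclp (\<lambda>a b. hom (preorder_cat P r) a b \<noteq> {}) x y"
      using assms(2) xy kl K(3) unfolding connected_cat_iff by auto
    then have "(x \<in> K k) = (y \<in> K k)"
    proof (rule equivclp_invariant)
      fix a b assume "hom (preorder_cat P r) a b \<noteq> {}"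
      then have "(a, b) \<in> r" by (auto simp: hom_preorder_cat split: if_splits)
      then obtain j where "j < n" "a \<in> K j" "b \<in> K j" using K(4) s by blast
      then show "(a \<in> K k) = (b \<in> K k)" using disj kl by blast
    qed
    then show ?thesis using xy kl disj by blast
  qed
  have "n \<noteq> 0" using assms(2) K(3) unfolding connected_cat_iff by auto
  then have "{..<n} = {0}" using one by auto
  then show ?thesis using K by auto
qed

section \<open>Posets with simply-connected upward-closed subsets\<close>

lemma tree_imp_forest_like:
  assumes "tree_like P r"
  shows "forest_like P r"
  unfolding forest_like_def
  by (rule exI[of _ 1], rule exI[of _ "\<lambda>_. P"], rule exI[of _ "\<lambda>_. r"])
    (use assms in \<open>auto simp: disjoint_family_on_def\<close>)

lemma forest_like_empty: "forest_like {} {}"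
  unfolding forest_like_def by (rule exI[of _ 0]) (auto simp: disjoint_family_on_def)

lemma forest_like_Un:
  assumes "forest_like P r" "forest_like P' r'" "P \<inter> P' = {}"
  shows "forest_like (P \<union> P') (r \<union> r')"
proof -
  obtain n :: nat and K s where K: "\<And>k. k < n \<Longrightarrow> tree_like (K k) (s k)" "disjoint_family_on K {..<n}"
    "P = (\<Union>k<n. K k)" "r = (\<Union>k<n. s k)" using assms(1) by (rule forest_likeE) blast
  obtain n' :: nat and K' s' where K': "\<And>k. k < n' \<Longrightarrow> tree_like (K' k) (s' k)" "disjoint_family_on K' {..<n'}"
    "P' = (\<Union>k<n'. K' k)" "r' = (\<Union>k<n'. s' k)" using assms(2) by (rule forest_likeE) blast
  define L where "L k = (if k < n then K k else K' (k - n))" for k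
  define t where "t k = (if k < n then s k else s' (k - n))" for k
  have split: "(\<Union>k<n + n'. if k < n then f k else g (k - n)) = (\<Union>k<n. f k) \<union> (\<Union>k<n'. g k)"
    for f g :: "nat \<Rightarrow> 'z set"
  proof -
    have "k < n' \<Longrightarrow> n + k < n + n' \<and> \<not> n + k < n \<and> n + k - n = k" for k by simp
    then show ?thesis by (fastforce split: if_splits)
  qed
  have "tree_like (L k) (t k)" if "k < n + n'" for k
    using K(1) K'(1) that by (auto simp: L_def t_def)
  moreover have "disjoint_family_on L {..<n + n'}"
    unfolding disjoint_family_on_def
  proof (intro ballI impI)
    fix a b assume "a \<in> {..<n + n'}" "b \<in> {..<n + n'}" "a \<noteq> b"
    moreover have "K a \<subseteq> P" if "a < n" for a using K(3) that by blast
    moreover have "K' a \<subseteq> P'" if "a < n'" for a using K'(3) that by blast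
    moreover have "a - n < n'" if "a < n + n'" "\<not> a < n" for a using that by linarith
    moreover have "a - n \<noteq> b - n" if "\<not> a < n" "\<not> b < n" using \<open>a \<noteq> b\<close> that by linarith
    ultimately show "L a \<inter> L b = {}"
      using K(2) K'(2) assms(3) unfolding L_def disjoint_family_on_def
      by (cases "a < n"; cases "b < n") (simp_all, blast+)
  qed
  moreover have "P \<union> P' = (\<Union>k<n + n'. L k)" "r \<union> r' = (\<Union>k<n + n'. t k)"
    unfolding L_def t_def split by (simp_all add: K K')
  ultimately show ?thesis unfolding forest_like_def by blast
qed


section \<open>Words modulo the relations of the fundamental groupoid\<close>

context category
begin

lemma pi1_rel_hom:
  "(u, v) \<in> pi1_rel C \<Longrightarrow>
    u \<in> hom (word_cat C) (src (word_cat C) u) (tgt (word_cat C) u) \<and>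
    v \<in> hom (word_cat C) (src (word_cat C) u) (tgt (word_cat C) u)"
proof (induction rule: pi1_rel.induct)
  case (cmp i j)
  then have "cmp C j i \<in> hom C (src C i) (tgt C j)"
    by (intro cmp_hom[of _ _ "tgt C i"]) (auto simp: hom_def)
  then show ?case using cmp tgt_obj by (auto simp: word_of_def hom_def)
next
  case (idn x)
  then show ?case using idn_hom[of x] by (auto simp: word_of_def hom_def)
qed (auto simp: hom_def path_append word_of_def src_obj tgt_obj)

lemma congruence_pi1_rel: "category_congruence (word_cat C) (pi1_rel C)"
proof -
  have "equiv (arr (word_cat C)) (pi1_rel C)"
  proof (rule equivI)
    show "pi1_rel C \<subseteq> arr (word_cat C) \<times> arr (word_cat C)"
      by (rule subrelI) (use pi1_rel_hom in \<open>auto simp: hom_def\<close>)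
    show "refl_on (arr (word_cat C)) (pi1_rel C)"
      by (auto simp: refl_on_def intro: pi1_rel.refl)
  qed (auto intro!: symI transI intro: pi1_rel.sym pi1_rel.trans)
  moreover have "src (word_cat C) u = src (word_cat C) v \<and> tgt (word_cat C) u = tgt (word_cat C) v"
    if "(u, v) \<in> pi1_rel C" for u v
    using pi1_rel_hom[OF that] by (auto simp: hom_def)
  ultimately show ?thesis
    unfolding category_congruence_def by (blast intro: pi1_rel.cong)
qed

lemmas pi1_quotient = category_quotient_cat[OF category_word_cat congruence_pi1_rel,
    folded pi1_def]

abbreviation "pi1_class u \<equiv> pi1_rel C `` {u}"

lemma pi1_class_eq_iff:
  "\<lbrakk>u \<in> arr (word_cat C); v \<in> arr (word_cat C)\<rbrakk> \<Longrightarrow> pi1_class u = pi1_class v \<longleftrightarrow> (u, v) \<in> pi1_rel C"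
  using congruence_pi1_rel[unfolded category_congruence_def, THEN conjunct1] by (rule eq_equiv_class_iff)

lemma obj_pi1 [simp]: "obj (pi1 C) = obj C"
  by (simp add: pi1_def quotient_cat_def)

lemma pi1_class_arr: "u \<in> arr (word_cat C) \<Longrightarrow> pi1_class u \<in> arr (pi1 C)"
  by (simp add: pi1_def quotient_cat_def quotientI)

lemma hom_pi1: "hom (pi1 C) x y = {pi1_class (x, w, y) |w. path C x w y}"
proof -
  have "\<exists>w. c = pi1_class (x, w, y) \<and> path C x w y" if c: "c \<in> hom (pi1 C) x y" for c
  proof -
    from c obtain u where u: "u \<in> arr (word_cat C)" "c = pi1_class u"
      by (auto simp: hom_def pi1_def quotient_cat_def elim!: quotientE)
    then show ?thesis
      using c pi1_quotient(2,3)[OF u(1)] by (cases u) (auto simp: hom_def)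
  qed
  moreover have "pi1_class (x, w, y) \<in> hom (pi1 C) x y" if "path C x w y" for w
    using that pi1_quotient(2,3)[of "(x, w, y)"] pi1_class_arr[of "(x, w, y)"] by (simp add: hom_def)
  ultimately show ?thesis by blast
qed

lemma simply_connected_cat_iff:
  "simply_connected_cat C \<longleftrightarrow>
    (\<forall>x y w w'. path C x w y \<longrightarrow> path C x w' y \<longrightarrow> ((x, w, y), (x, w', y)) \<in> pi1_rel C)"
proof
  assume s: "simply_connected_cat C"
  show "\<forall>x y w w'. path C x w y \<longrightarrow> path C x w' y \<longrightarrow> ((x, w, y), (x, w', y)) \<in> pi1_rel C"
  proof (intro allI impI)
    fix x y w w' assume w: "path C x w y" "path C x w' y"
    then have "pi1_class (x, w, y) \<in> hom (pi1 C) x y" "pi1_class (x, w', y) \<in> hom (pi1 C) x y"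
      unfolding hom_pi1 by blast+
    moreover have "x \<in> obj C" "y \<in> obj C" using path_obj[OF w(1)] by auto
    ultimately have "pi1_class (x, w, y) = pi1_class (x, w', y)"
      using s unfolding simply_connected_cat_def by blast
    then show "((x, w, y), (x, w', y)) \<in> pi1_rel C" using w by (simp add: pi1_class_eq_iff)
  qed
next
  assume s: "\<forall>x y w w'. path C x w y \<longrightarrow> path C x w' y \<longrightarrow> ((x, w, y), (x, w', y)) \<in> pi1_rel C"
  show "simply_connected_cat C"
    unfolding simply_connected_cat_def
  proof (intro ballI)
    fix x y f g assume fg: "f \<in> hom (pi1 C) x y" "g \<in> hom (pi1 C) x y"
    obtain w where w: "path C x w y" "f = pi1_class (x, w, y)" using fg(1) unfolding hom_pi1 by blast
    obtain w' where w': "path C x w' y" "g = pi1_class (x, w', y)" using fg(2) unfolding hom_pi1 by blast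
    show "f = g" using s w w' by (simp add: pi1_class_eq_iff)
  qed
qed

end

section \<open>Parity as an obstruction to contracting a loop\<close>

primrec label :: "'m letter \<Rightarrow> 'm" where
  "label (Fwd i) = i"
| "label (Bwd i) = i"

text \<open>A cocycle \<open>c\<close> with values in the two-element group (\<open>\<noteq>\<close> is its addition) evaluated on a word.\<close>

primrec parity :: "('m \<Rightarrow> bool) \<Rightarrow> 'm letter list \<Rightarrow> bool" where
  "parity c [] \<longleftrightarrow> False"
| "parity c (l # w) \<longleftrightarrow> (c (label l) \<noteq> parity c w)"

lemma parity_append: "parity c (u @ v) \<longleftrightarrow> (parity c u \<noteq> parity c v)"
  by (induction u) auto

lemma parity_False: "(\<And>l. l \<in> set w \<Longrightarrow> \<not> c (label l)) \<Longrightarrow> \<not> parity c w"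
  by (induction w) auto

text \<open>The hypotheses are the relations for identities and composites. Those for inverses come
  for free, since each element of the two-element group is its own inverse and a backward letter
  counts like a forward one.\<close>

lemma (in category) parity_pi1_rel:
  assumes "\<And>x. x \<in> obj C \<Longrightarrow> \<not> c (idn C x)"
    and "\<And>i j. \<lbrakk>i \<in> arr C; j \<in> arr C; src C j = tgt C i\<rbrakk> \<Longrightarrow> c (cmp C j i) \<longleftrightarrow> (c i \<noteq> c j)"
  shows "(u, v) \<in> pi1_rel C \<Longrightarrow> parity c (fst (snd u)) = parity c (fst (snd v))"
proof (induction rule: pi1_rel.induct)
  case (cong u u' v v')
  have "fst (snd (cmp (word_cat C) v u)) = fst (snd u) @ fst (snd v)" for u v
    by (cases u, cases v) simp
  then show ?case using cong.IH by (simp add: parity_append)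
qed (auto simp: word_of_def assms)

text \<open>Turns connectedness of a part into a word over the larger poset that uses only relations
  of that part, so that a cocycle can be evaluated on it.\<close>

lemma equivclp_path:
  assumes "equivclp (\<lambda>a b. hom (preorder_cat K s) a b \<noteq> {}) x y" "x \<in> K" "K \<subseteq> P" "s \<subseteq> r"
  shows "\<exists>w. path (preorder_cat P r) x w y \<and> (\<forall>l\<in>set w. label l \<in> s)"
  using assms(1)
proof (induction rule: converse_equivclp_induct)
  case base
  have "y \<in> K"
    using equivclp_invariant[OF assms(1), of "\<lambda>a. a \<in> K"] assms(2) by (auto simp: hom_preorder_cat)
  then show ?case using assms(3) by (intro exI[of _ "[]"]) auto
next
  case (step a b)
  then obtain w where w: "path (preorder_cat P r) b w y" "\<forall>l\<in>set w. label l \<in> s" by blast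
  from step(1) have "(a, b) \<in> s \<inter> K \<times> K \<or> (b, a) \<in> s \<inter> K \<times> K" by (auto simp: hom_preorder_cat)
  then show ?case
  proof
    assume "(a, b) \<in> s \<inter> K \<times> K"
    then show ?thesis using w assms(3,4) by (intro exI[of _ "Fwd (a, b) # w"]) auto
  next
    assume "(b, a) \<in> s \<inter> K \<times> K"
    then show ?thesis using w assms(3,4) by (intro exI[of _ "Bwd (b, a) # w"]) auto
  qed
qed

text \<open>The induction passes to smaller upward-closed subsets: a component and its complement if
  \<open>P\<close> is disconnected, otherwise \<open>P\<close> without a minimal point
  \<open>p\<close>. In the second case the trees of the remainder serve as the \<open>K k\<close>,
  the points of \<open>K k\<close> above \<open>p\<close> as \<open>U k\<close>, and only the
  connectedness of \<open>U k\<close> needs an argument.\<close>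

lemma forest_like_simply_connected:
  assumes "finite P" "partial_order_on P r"
    and "\<And>U. upward_closed_in P r U \<Longrightarrow> simply_connected_cat (preorder_cat U r)"
  shows "forest_like P r"
  using assms
proof (induction P arbitrary: r rule: finite_psubset_induct)
  case (psubset P)
  note po = psubset.prems(1)
  have r: "r \<subseteq> P \<times> P" "\<And>x. x \<in> P \<Longrightarrow> (x, x) \<in> r" "trans r" "antisym r"
    using po by (auto simp: partial_order_on_def preorder_on_def refl_on_def)
  let ?J = "preorder_cat P r"
  interpret J: category ?J
    using po by (intro category_preorder_cat) (simp add: partial_order_on_def)
  have IH: "forest_like U (r \<inter> U \<times> U)" if U: "U \<subset> P" "upward_closed_in P r U" for U
  proof (rule psubset.IH[OF U(1)])
    show "partial_order_on U (r \<inter> U \<times> U)"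
      using r U(1) unfolding partial_order_on_def preorder_on_def
      by (auto simp: refl_on_def trans_def antisym_def)
    fix V assume V: "upward_closed_in U (r \<inter> U \<times> U) V"
    then have "upward_closed_in P r V" using U unfolding upward_closed_in_def by blast
    moreover have "preorder_cat V (r \<inter> U \<times> U) = preorder_cat V r"
      using V unfolding preorder_cat_def upward_closed_in_def by auto
    ultimately show "simply_connected_cat (preorder_cat V (r \<inter> U \<times> U))"
      using psubset.prems(2) by simp
  qed
  show ?case
  proof (cases "connected_cat ?J")
    case False
    show ?thesis
    proof (cases "P = {}")
      case True
      then show ?thesis using r(1) forest_like_empty by simp
    next
      case ne: False
      let ?e = "equivclp (\<lambda>a b. hom ?J a b \<noteq> {})"
      obtain x y where xy: "x \<in> P" "y \<in> P" "\<not> ?e x y"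
        using False ne unfolding connected_cat_iff by auto
      define K where "K = {z \<in> P. ?e x z}"
      have eK: "a \<in> K \<longleftrightarrow> b \<in> K" if "(a, b) \<in> r" for a b
      proof -
        have "a \<in> P" "b \<in> P" using that r(1) by auto
        moreover from this have e: "?e a b" using that by (intro r_into_equivclp) (simp add: hom_preorder_cat)
        ultimately show ?thesis
          using equivclp_trans[OF _ e] equivclp_trans[OF _ equivclp_sym[OF e]] unfolding K_def by blast
      qed
      have "x \<in> K" "y \<notin> K" "K \<subseteq> P" using xy by (auto simp: K_def)
      then have "K \<subset> P" "P - K \<subset> P" using xy by blast+
      moreover have "upward_closed_in P r K" "upward_closed_in P r (P - K)"
        using eK \<open>K \<subseteq> P\<close> unfolding upward_closed_in_def by blast+
      ultimately have "forest_like (K \<union> (P - K)) (r \<inter> K \<times> K \<union> r \<inter> (P - K) \<times> (P - K))"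
        by (intro forest_like_Un IH) auto
      moreover have "K \<union> (P - K) = P" using \<open>K \<subseteq> P\<close> by blast
      moreover have "r \<inter> K \<times> K \<union> r \<inter> (P - K) \<times> (P - K) = r" using eK r(1) by blast
      ultimately show ?thesis by simp
    qed
  next
    case conn: True
    then have ne: "P \<noteq> {}" unfolding connected_cat_iff by simp
    have "\<exists>p\<in>P. \<forall>q\<in>P. q \<noteq> p \<longrightarrow> \<not> ((q, p) \<in> r \<and> q \<noteq> p)"
      using psubset.hyps r(3,4) ne
      by (intro Finite_Set.bex_min_element) (auto simp: asymp_on_def transp_on_def antisym_def dest: transD)
    then obtain p where p: "p \<in> P" "\<And>q. (q, p) \<in> r \<Longrightarrow> q = p" using r(1) by blast
    let ?r' = "r \<inter> (P - {p}) \<times> (P - {p})"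
    have "forest_like (P - {p}) ?r'"
      using p by (intro IH) (auto simp: upward_closed_in_def)
    then obtain n :: nat and K s where K: "\<And>k. k < n \<Longrightarrow> tree_like (K k) (s k)" "disjoint_family_on K {..<n}"
      "P - {p} = (\<Union>k<n. K k)" "?r' = (\<Union>k<n. s k)" by (rule forest_likeE) blast
    have s: "s k \<subseteq> K k \<times> K k" if "k < n" for k using tree_like_subset[OF K(1)[OF that]] .
    have KP: "K k \<subseteq> P" "p \<notin> K k" if "k < n" for k using K(3) that by blast+
    have sr: "s k \<subseteq> r" if "k < n" for k using K(4) that by blast
    have disj: "j = k" if "x \<in> K j" "x \<in> K k" "j < n" "k < n" for x j k
      using K(2) that unfolding disjoint_family_on_def by blast
    have same: "(a, b) \<in> s k" if "(a, b) \<in> r" "a \<noteq> p" "k < n" "a \<in> K k \<or> b \<in> K k" for a b k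
    proof -
      have "b \<noteq> p" using p(2) that by blast
      then have "(a, b) \<in> ?r'" using that r(1) by auto
      then obtain j where j: "j < n" "(a, b) \<in> s j" using K(4) by blast
      then have "a \<in> K j" "b \<in> K j" using s by blast+
      then have "j = k" using disj j that by blast
      then show ?thesis using j by simp
    qed
    define U where "U k = {u \<in> K k. (p, u) \<in> r}" for k
    have up: "upward_closed_in (K k) (s k) (U k)" if "k < n" for k
      using sr[OF that] r(3) unfolding upward_closed_in_def U_def by (blast dest: transD)
    have Uc: "connected_cat (preorder_cat (U k) (s k))" if k: "k < n" for k
    proof -
      let ?e = "equivclp (\<lambda>a b. hom (preorder_cat (U k) (s k)) a b \<noteq> {})"
      have "U k \<noteq> {}"
      proof
        \<comment> \<open>With no point of \<open>K k\<close> above \<open>p\<close> and none below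
          it by minimality, \<open>K k\<close> is closed under zigzags in \<open>P\<close> and
          misses \<open>p\<close>, against connectedness of \<open>P\<close>.\<close>
        assume empty: "U k = {}"
        obtain x where x: "x \<in> K k" using tree_like_connected[OF K(1)[OF k]] unfolding connected_cat_iff by auto
        then have "equivclp (\<lambda>a b. hom ?J a b \<noteq> {}) x p"
          using conn p(1) KP(1)[OF k] unfolding connected_cat_iff by auto
        then have "x \<in> K k \<longleftrightarrow> p \<in> K k"
        proof (rule equivclp_invariant)
          fix a b assume "hom ?J a b \<noteq> {}"
          then have ab: "(a, b) \<in> r" by (auto simp: hom_preorder_cat)
          show "a \<in> K k \<longleftrightarrow> b \<in> K k"
          proof (cases "a = p")
            case True
            then show ?thesis using ab empty KP(2)[OF k] by (auto simp: U_def)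
          next
            case False
            then show ?thesis using same[OF ab False k] s[OF k] by blast
          qed
        qed
        then show False using x KP(2)[OF k] by simp
      qed
      moreover have "?e u v" if uv: "u \<in> U k" "v \<in> U k" for u v
      proof (rule ccontr)
        assume nuv: "\<not> ?e u v"
        \<comment> \<open>\<open>A\<close> is the component of \<open>u\<close> in
          \<open>U k\<close>, and \<open>c\<close> marks the arrows from \<open>p\<close> into
          \<open>A\<close>. This is a cocycle because an arrow between points strictly above
          \<open>p\<close> neither enters nor leaves \<open>A\<close>.\<close>
        define A where "A = {z \<in> U k. ?e u z}"
        define c where "c i \<longleftrightarrow> fst i = p \<and> snd i \<in> A" for i
        have AK: "A \<subseteq> K k" by (auto simp: A_def U_def)
        have Aiff: "b \<in> A \<longleftrightarrow> d \<in> A" if bd: "(b, d) \<in> r" "(p, b) \<in> r" "b \<noteq> p" for b d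
        proof -
          have pd: "(p, d) \<in> r" using bd r(3) by (blast dest: transD)
          have "b \<in> A \<longleftrightarrow> d \<in> A" if "b \<in> K k \<or> d \<in> K k"
          proof -
            have sk: "(b, d) \<in> s k" using same[OF bd(1,3) k that] .
            then have "b \<in> U k" "d \<in> U k" using s[OF k] bd(2) pd unfolding U_def by blast+
            moreover from this have e: "?e b d" using sk by (intro r_into_equivclp) (simp add: hom_preorder_cat)
            ultimately show ?thesis
              using equivclp_trans[OF _ e] equivclp_trans[OF _ equivclp_sym[OF e]] unfolding A_def by blast
          qed
          then show ?thesis using AK by blast
        qed
        have c1: "\<not> c (idn ?J x)" if "x \<in> obj ?J" for x using AK KP(2)[OF k] by (auto simp: c_def)
        have c2: "c (cmp ?J j i) \<longleftrightarrow> (c i \<noteq> c j)" if ar: "i \<in> arr ?J" "j \<in> arr ?J" "src ?J j = tgt ?J i" for i j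
        proof -
          obtain a b d where ij: "i = (a, b)" "j = (b, d)" using ar(3) by (cases i, cases j) auto
          then have rr: "(a, b) \<in> r" "(b, d) \<in> r" using ar by auto
          have pA: "p \<notin> A" using AK KP(2)[OF k] by blast
          consider "a = p" "b = p" | "a = p" "b \<noteq> p" | "a \<noteq> p" "b \<noteq> p" using p(2) rr(1) by blast
          then show ?thesis using rr Aiff pA by cases (auto simp: c_def ij)
        qed
        have ukvk: "u \<in> K k" "v \<in> K k" "(p, u) \<in> r" "(p, v) \<in> r" using uv by (auto simp: U_def)
        then have "equivclp (\<lambda>a b. hom (preorder_cat (K k) (s k)) a b \<noteq> {}) u v"
          using tree_like_connected[OF K(1)[OF k]] unfolding connected_cat_iff by simp
        then obtain w where w: "path ?J u w v" "\<forall>l\<in>set w. label l \<in> s k"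
          using equivclp_path[OF _ ukvk(1) KP(1)[OF k] sr[OF k]] by blast
        have "\<not> c (label l)" if "l \<in> set w" for l
          using w(2) that s[OF k] KP(2)[OF k] unfolding c_def by fastforce
        then have "\<not> parity c w" by (rule parity_False)
        moreover have "u \<in> A" "v \<notin> A" using uv nuv by (auto simp: A_def)
        \<comment> \<open>The loop goes from \<open>p\<close> to \<open>u\<close>, through
          \<open>K k\<close> to \<open>v\<close>, and back to \<open>p\<close>; only its first
          letter is marked.\<close>
        ultimately have par: "parity c (Fwd (p, u) # w @ [Bwd (p, v)])" by (simp add: parity_append c_def)
        have "path ?J v [Bwd (p, v)] p" using ukvk p(1) KP(1)[OF k] by auto
        then have "path ?J u (w @ [Bwd (p, v)]) p" using w(1) unfolding J.path_append by blast
        then have "path ?J p (Fwd (p, u) # w @ [Bwd (p, v)]) p" using ukvk p(1) KP(1)[OF k] by auto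
        moreover have "path ?J p [] p" using p(1) by simp
        moreover have "simply_connected_cat ?J"
          using r(1) by (intro psubset.prems(2)) (auto simp: upward_closed_in_def)
        ultimately have "((p, Fwd (p, u) # w @ [Bwd (p, v)], p), (p, [], p)) \<in> pi1_rel ?J"
          unfolding J.simply_connected_cat_iff by blast
        from J.parity_pi1_rel[of c, OF c1 c2 this] par show False by simp
      qed
      ultimately show ?thesis unfolding connected_cat_iff by simp
    qed
    have "tree_like (insert p (\<Union>k<n. K k)) ((\<Union>k<n. s k) \<union> {p} \<times> insert p (\<Union>k<n. U k))"
      by (rule tree_like.adjoin) (use K up Uc KP in auto)
    moreover have "insert p (\<Union>k<n. K k) = P" using K(3) p(1) by blast
    moreover have "(\<Union>k<n. s k) \<union> {p} \<times> insert p (\<Union>k<n. U k) = r"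
    proof -
      have "(\<Union>k<n. U k) = {u \<in> P - {p}. (p, u) \<in> r}" unfolding K(3) U_def by blast
      then show ?thesis using p r(1,2) unfolding K(4)[symmetric] by auto
    qed
    ultimately show ?thesis using tree_imp_forest_like by simp
  qed
qed

section \<open>Upward-closed subsets of the skeleton\<close>

context category
begin

lemma functor_pi1: "is_functor C (pi1 C) (\<lambda>x. x) (\<lambda>i. pi1_class (word_of C i))"
proof -
  have "pi1_class (word_of C i) \<in> hom (pi1 C) (src C i) (tgt C i)" if "i \<in> arr C" for i
    using word_of_facts[OF that] by (simp add: hom_def pi1_quotient pi1_class_arr)
  moreover have "pi1_class (word_of C (idn C x)) = idn (pi1 C) x" if "x \<in> obj C" for x
  proof -
    have "(word_of C (idn C x), idn (word_cat C) x) \<in> pi1_rel C" using that by (rule pi1_rel.idn)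
    moreover have "idn C x \<in> arr C" using idn_hom[OF that] by (simp add: hom_def)
    ultimately show ?thesis
      using that word_of_facts(1) by (simp add: pi1_class_eq_iff pi1_def quotient_cat_def)
  qed
  moreover have "pi1_class (word_of C (cmp C j i)) = cmp (pi1 C) (pi1_class (word_of C j)) (pi1_class (word_of C i))"
    if "i \<in> arr C" "j \<in> arr C" "src C j = tgt C i" for i j
  proof -
    interpret W: category "word_cat C" by (rule category_word_cat)
    have "(word_of C (cmp C j i), cmp (word_cat C) (word_of C j) (word_of C i)) \<in> pi1_rel C"
      using that by (rule pi1_rel.cmp)
    then show ?thesis
      using that by (simp add: pi1_quotient(4) word_of_facts pi1_class_eq_iff cmp_arr W.cmp_arr)
  qed
  ultimately show ?thesis by (simp add: is_functor_def)
qed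

lemma pi1_class_snoc:
  assumes v: "path C z v (src C i)" and i: "i \<in> arr C"
  shows "cmp (pi1 C) (pi1_class (word_of C i)) (pi1_class (z, v, src C i)) =
    pi1_class (z, v @ [Fwd i], tgt C i)"
  using pi1_quotient(4)[of "(z, v, src C i)" "word_of C i"] v i word_of_facts[OF i]
  by (simp add: word_of_def)

lemma pi1_class_Bwd_Fwd:
  assumes v: "path C z v (tgt C i)" and i: "i \<in> arr C"
  shows "pi1_class (z, v @ [Bwd i, Fwd i], tgt C i) = pi1_class (z, v, tgt C i)"
proof -
  have "((z, v, tgt C i), (z, v, tgt C i)) \<in> pi1_rel C" using v by (intro pi1_rel.refl) simp
  from pi1_rel.cong[OF this pi1_rel.inv_right[OF i]]
  have "((z, v @ [Bwd i, Fwd i], tgt C i), (z, v, tgt C i)) \<in> pi1_rel C" by (simp add: word_of_def)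
  then show ?thesis
    using v i tgt_obj by (subst pi1_class_eq_iff) (auto simp: path_append src_obj)
qed

lemma pi1_class_Fwd_Bwd:
  assumes v: "path C z v (src C i)" and i: "i \<in> arr C"
  shows "pi1_class (z, v @ [Fwd i, Bwd i], src C i) = pi1_class (z, v, src C i)"
proof -
  have "((z, v, src C i), (z, v, src C i)) \<in> pi1_rel C" using v by (intro pi1_rel.refl) simp
  from pi1_rel.cong[OF this pi1_rel.inv_left[OF i]]
  have "((z, v @ [Fwd i, Bwd i], src C i), (z, v, src C i)) \<in> pi1_rel C" by (simp add: word_of_def)
  then show ?thesis
    using v i tgt_obj by (subst pi1_class_eq_iff) (auto simp: path_append src_obj)
qed

abbreviation "pi1_fibre \<equiv> \<lambda>x. {c \<in> arr (pi1 C). tgt (pi1 C) c = x}"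
abbreviation "pi1_map \<equiv> \<lambda>i. cmp (pi1 C) (pi1_class (word_of C i))"

lemma pi1_fibre: "pi1_fibre x = {pi1_class (z, v, x) |z v. path C z v x}"
proof -
  have "pi1_fibre x = (\<Union>z. hom (pi1 C) z x)" by (auto simp: hom_def)
  then show ?thesis unfolding hom_pi1 by blast
qed

text \<open>Appending a forward letter is undone by appending the corresponding backward
  letter.\<close>

lemma injective_diagram_pi1: "injective_diagram C pi1_fibre pi1_map"
proof (rule functor_injective_diagram[OF category_axioms pi1_quotient(1) functor_pi1])
  fix i a b
  assume i: "i \<in> arr C" and ab: "a \<in> arr (pi1 C)" "b \<in> arr (pi1 C)" "tgt (pi1 C) a = src C i"
    "tgt (pi1 C) b = src C i" and eq: "pi1_map i a = pi1_map i b"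
  have "a \<in> pi1_fibre (src C i)" "b \<in> pi1_fibre (src C i)" using ab by auto
  then obtain z v z' v' where a: "a = pi1_class (z, v, src C i)" "path C z v (src C i)"
    and b: "b = pi1_class (z', v', src C i)" "path C z' v' (src C i)" unfolding pi1_fibre by blast
  have p: "path C z (v @ [Fwd i]) (tgt C i)" "path C z' (v' @ [Fwd i]) (tgt C i)"
    using a b i by (auto simp: path_append tgt_obj)
  have "((z, v @ [Fwd i], tgt C i), (z', v' @ [Fwd i], tgt C i)) \<in> pi1_rel C"
    using eq a b i p by (simp add: pi1_class_snoc pi1_class_eq_iff)
  moreover have B: "(tgt C i, [Bwd i], src C i) \<in> arr (word_cat C)" using i src_obj by simp
  ultimately have "((z, v @ [Fwd i, Bwd i], src C i), (z', v' @ [Fwd i, Bwd i], src C i)) \<in> pi1_rel C"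
    using pi1_rel.cong[OF _ pi1_rel.refl[OF B]] by fastforce
  then have "pi1_class (z, v @ [Fwd i, Bwd i], src C i) = pi1_class (z', v' @ [Fwd i, Bwd i], src C i)"
    using a b i by (subst pi1_class_eq_iff) (auto simp: path_append src_obj tgt_obj)
  then show "a = b" using a b i by (simp add: pi1_class_Fwd_Bwd)
qed

text \<open>In the groupoid a word acts by concatenation and is defined everywhere, backward letters
  included. A loop that moves no point is therefore trivial.\<close>

lemma pi1_zigzag:
  "\<lbrakk>path C x w y; path C z v x\<rbrakk> \<Longrightarrow>
    (pi1_class (z, v, x), pi1_class (z, v @ w, y)) \<in> zigzag C pi1_fibre pi1_map x w"
proof (induction w arbitrary: x v)
  case Nil
  then have "pi1_class (z, v, x) \<in> pi1_fibre x" unfolding pi1_fibre by blast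
  with Nil show ?case by (simp add: Id_on_iff)
next
  case (Cons l w)
  show ?case
  proof (cases l)
    case (Fwd i)
    with Cons.prems have i: "i \<in> arr C" "src C i = x" "path C (tgt C i) w y" by auto
    then have p: "path C z (v @ [Fwd i]) (tgt C i)" using Cons.prems by (auto simp: path_append tgt_obj)
    have "pi1_class (z, v, x) \<in> pi1_fibre x" using Cons.prems unfolding pi1_fibre by blast
    then have "(pi1_class (z, v, x), pi1_class (z, v @ [Fwd i], tgt C i)) \<in>
        {(a, pi1_map i a) |a. a \<in> pi1_fibre (src C i)}"
      using i Cons.prems pi1_class_snoc[of z v i] by auto
    from relcompI[OF this Cons.IH[OF i(3) p]] show ?thesis by (simp add: Fwd)
  next
    case (Bwd i)
    with Cons.prems have i: "i \<in> arr C" "tgt C i = x" "path C (src C i) w y" by auto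
    then have p: "path C z (v @ [Bwd i]) (src C i)" using Cons.prems by (auto simp: path_append src_obj)
    then have f: "pi1_class (z, v @ [Bwd i], src C i) \<in> pi1_fibre (src C i)" unfolding pi1_fibre by blast
    have "pi1_map i (pi1_class (z, v @ [Bwd i], src C i)) = pi1_class (z, v, x)"
      using pi1_class_snoc[OF p i(1)] pi1_class_Bwd_Fwd[of z v i] i Cons.prems by simp
    with f have "(pi1_class (z, v, x), pi1_class (z, v @ [Bwd i], src C i)) \<in>
        {(pi1_map i a, a) |a. a \<in> pi1_fibre (src C i)}" by force
    from relcompI[OF this Cons.IH[OF i(3) p]] show ?thesis by (simp add: Bwd)
  qed
qed

end

section \<open>Extension of diagrams by empty sets\<close>

lemma category_preorder_restrict:
  assumes "preorder_on P r" "U \<subseteq> P"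
  shows "category (preorder_cat U r)"
proof -
  have "preorder_on U (r \<inter> U \<times> U)"
    using assms by (auto simp: preorder_on_def refl_on_def trans_def)
  moreover have "preorder_cat U (r \<inter> U \<times> U) = preorder_cat U r" by (auto simp: preorder_cat_def)
  ultimately show ?thesis using category_preorder_cat by metis
qed

text \<open>Objects whose representative lies outside \<open>U\<close> carry the empty set, where
  all conditions are vacuous; by \<open>up\<close> no arrow leads from a nonempty set to such an
  object.\<close>

lemma pullback_injective_diagram:
  assumes I: "category I" and A: "injective_diagram (preorder_cat U r) A m"
    and supp: "\<And>x. A x \<noteq> {} \<Longrightarrow> x \<in> U"
    and up: "\<And>i. \<lbrakk>i \<in> arr I; rep (src I i) \<in> U\<rbrakk> \<Longrightarrow> (rep (src I i), rep (tgt I i)) \<in> r \<inter> U \<times> U"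
  shows "injective_diagram I (\<lambda>x. A (rep x)) (\<lambda>i. m (rep (src I i), rep (tgt I i)))"
proof -
  interpret I: category I by fact
  interpret A: injective_diagram "preorder_cat U r" A m by fact
  have ar: "(rep (src I i), rep (tgt I i)) \<in> arr (preorder_cat U r)"
    if "i \<in> arr I" "c \<in> A (rep (src I i))" for i c
    using up[OF that(1)] supp that(2) by auto
  show ?thesis
  proof
    fix i c assume "i \<in> arr I" "c \<in> A (rep (src I i))"
    then show "m (rep (src I i), rep (tgt I i)) c \<in> A (rep (tgt I i))"
      using A.map_in[OF ar, of i c c] by simp
  next
    fix i assume i: "i \<in> arr I"
    show "inj_on (m (rep (src I i), rep (tgt I i))) (A (rep (src I i)))"
    proof (cases "A (rep (src I i)) = {}")
      case False
      then show ?thesis using A.map_inj[OF ar[OF i]] by auto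
    qed simp
  next
    fix x c assume x: "x \<in> obj I" and c: "c \<in> A (rep x)"
    have "src I (idn I x) = x" "tgt I (idn I x) = x" using I.idn_hom[OF x] by (simp_all add: hom_def)
    moreover have "rep x \<in> U" using supp c by blast
    ultimately show "m (rep (src I (idn I x)), rep (tgt I (idn I x))) c = c"
      using A.map_idn[of "rep x" c] c by simp
  next
    fix i j c assume i: "i \<in> arr I" and j: "j \<in> arr I" and ij: "src I j = tgt I i"
      and c: "c \<in> A (rep (src I i))"
    note a = ar[OF i c]
    have "m (rep (src I i), rep (tgt I i)) c \<in> A (rep (src I j))" using A.map_in[OF a, of c] c ij by simp
    note b = ar[OF j this]
    show "m (rep (src I (cmp I j i)), rep (tgt I (cmp I j i))) c =
        m (rep (src I j), rep (tgt I j)) (m (rep (src I i), rep (tgt I i)) c)"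
      using A.map_cmp[OF a b] c ij I.cmp_src[OF i j ij] I.cmp_tgt[OF i j ij] by simp
  qed
qed

text \<open>Each letter of the poset lifts to an arrow of \<open>I\<close> between the same objects.
  Any such arrow will do, since the pulled-back maps depend only on the end points.\<close>

lemma zigzag_pullback:
  assumes rep: "\<And>x. x \<in> U \<Longrightarrow> x \<in> obj I \<and> rep x = x"
    and r: "\<And>p q. \<lbrakk>(p, q) \<in> r; p \<in> U; q \<in> U\<rbrakk> \<Longrightarrow> hom I p q \<noteq> {}"
    and w: "path (preorder_cat U r) x w y"
  shows "\<exists>w'. path I x w' y \<and>
    zigzag I (\<lambda>x. A (rep x)) (\<lambda>i. m (rep (src I i), rep (tgt I i))) x w' =
      zigzag (preorder_cat U r) A m x w"
  using w
proof (induction w arbitrary: x)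
  case Nil
  then show ?case using rep by (intro exI[of _ "[]"]) auto
next
  case (Cons l w)
  show ?case
  proof (cases l)
    case (Fwd e)
    with Cons.prems obtain z where e: "e = (x, z)" "(x, z) \<in> r" "x \<in> U" "z \<in> U"
      and w: "path (preorder_cat U r) z w y" by (cases e) auto
    obtain w' where w': "path I z w' y" "zigzag I (\<lambda>x. A (rep x)) (\<lambda>i. m (rep (src I i), rep (tgt I i))) z w' =
        zigzag (preorder_cat U r) A m z w" using Cons.IH[OF w] by blast
    obtain i where "i \<in> arr I" "src I i = x" "tgt I i = z" using r[OF e(2-4)] by (auto simp: hom_def)
    then show ?thesis using w' rep e by (intro exI[of _ "Fwd i # w'"]) (simp add: Fwd)
  next
    case (Bwd e)
    with Cons.prems obtain z where e: "e = (z, x)" "(z, x) \<in> r" "z \<in> U" "x \<in> U"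
      and w: "path (preorder_cat U r) z w y" by (cases e) auto
    obtain w' where w': "path I z w' y" "zigzag I (\<lambda>x. A (rep x)) (\<lambda>i. m (rep (src I i), rep (tgt I i))) z w' =
        zigzag (preorder_cat U r) A m z w" using Cons.IH[OF w] by blast
    obtain i where "i \<in> arr I" "src I i = z" "tgt I i = x" using r[OF e(2-4)] by (auto simp: hom_def)
    then show ?thesis using w' rep e by (intro exI[of _ "Bwd i # w'"]) (simp add: Bwd)
  qed
qed

text \<open>The fibres of the fundamental groupoid of an upward-closed subset extend by empty sets to a
  diagram of injections, because no arrow leaves the subset.\<close>

lemma upward_closed_simply_connected:
  assumes I: "category I" "upward_simply_connected I"
    and P: "preorder_on P r" "P \<subseteq> obj I" "\<And>p. p \<in> P \<Longrightarrow> rep p = p"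
    and r: "\<And>i. i \<in> arr I \<Longrightarrow> (rep (src I i), rep (tgt I i)) \<in> r"
      "\<And>p q. (p, q) \<in> r \<Longrightarrow> hom I p q \<noteq> {}"
    and U: "upward_closed_in P r U"
  shows "simply_connected_cat (preorder_cat U r)"
proof -
  have UP: "U \<subseteq> P" using U by (simp add: upward_closed_in_def)
  let ?J = "preorder_cat U r"
  interpret J: category ?J using P(1) UP by (rule category_preorder_restrict)
  interpret A: injective_diagram ?J J.pi1_fibre J.pi1_map by (rule J.injective_diagram_pi1)
  have B: "injective_diagram I (\<lambda>x. J.pi1_fibre (rep x)) (\<lambda>i. J.pi1_map (rep (src I i), rep (tgt I i)))"
  proof (rule pullback_injective_diagram[OF I(1) A.injective_diagram_axioms])
    show "x \<in> U" if "J.pi1_fibre x \<noteq> {}" for x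
      using that J.path_obj unfolding J.pi1_fibre by fastforce
    show "(rep (src I i), rep (tgt I i)) \<in> r \<inter> U \<times> U" if "i \<in> arr I" "rep (src I i) \<in> U" for i
      using r(1)[OF that(1)] that(2) P(1) U unfolding preorder_on_def upward_closed_in_def by blast
  qed
  have loop: "A.zz x w \<subseteq> Id" if w: "path ?J x w x" for x w
  proof -
    have "\<exists>w'. path I x w' x \<and> zigzag I (\<lambda>x. J.pi1_fibre (rep x))
        (\<lambda>i. J.pi1_map (rep (src I i), rep (tgt I i))) x w' = A.zz x w"
      by (rule zigzag_pullback[OF _ _ w]) (use P(2,3) UP r(2) in auto)
    then obtain w' where "path I x w' x" and e: "zigzag I (\<lambda>x. J.pi1_fibre (rep x))
        (\<lambda>i. J.pi1_map (rep (src I i), rep (tgt I i))) x w' = A.zz x w" by (elim exE conjE)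
    from injective_diagram.zigzag_loop[OF B I(2) this(1)] show ?thesis unfolding e .
  qed
  show ?thesis
    unfolding J.simply_connected_cat_iff
  proof (intro allI impI)
    fix x y w w' assume w: "path ?J x w y" and w': "path ?J x w' y"
    have x: "path ?J x [] x" using J.path_obj[OF w] by simp
    \<comment> \<open>The class of \<open>w\<close> is followed back along \<open>w\<close> to the
      class of the empty word and then out along \<open>w'\<close>. The combined word is a loop at
      \<open>y\<close>, which moves no point.\<close>
    have "(J.pi1_class (x, w, y), J.pi1_class (x, [], x)) \<in> A.zz y (rev (map flip w))"
      using J.pi1_zigzag[OF w x] unfolding A.zigzag_inv[OF w] append_Nil by (rule converseI)
    moreover have "(J.pi1_class (x, [], x), J.pi1_class (x, w', y)) \<in> A.zz x w'"
      using J.pi1_zigzag[OF w' x] unfolding append_Nil .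
    ultimately have "(J.pi1_class (x, w, y), J.pi1_class (x, w', y)) \<in> A.zz y (rev (map flip w) @ w')"
      unfolding A.zigzag_append[OF J.path_inv[OF w] w'] by (rule relcompI)
    moreover have "path ?J y (rev (map flip w) @ w') y" using J.path_inv[OF w] w' J.path_append by blast
    ultimately have "J.pi1_class (x, w, y) = J.pi1_class (x, w', y)" using loop by blast
    then show "((x, w, y), (x, w', y)) \<in> pi1_rel ?J" using w w' by (simp add: J.pi1_class_eq_iff)
  qed
qed

section \<open>Finitely many objects, and the skeleton of the preorder reflection\<close>

lemma finite_obj_finitely_generated:
  assumes "category I" "finitely_generated I"
  shows "finite (obj I)"
proof -
  interpret category I by fact
  obtain G where G: "finite G" "G \<subseteq> arr I" "arr_closure I G = arr I"
    using assms(2) unfolding finitely_generated_def by blast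
  have "f \<in> arr I \<and> src I f \<in> src I ` G" if "f \<in> arr_closure I G" for f
    using that
  proof induction
    case (gen f)
    then show ?case using G(2) by blast
  next
    case (cmp f g)
    then show ?case by (simp add: cmp_arr cmp_src)
  qed
  then have "src I ` arr I \<subseteq> src I ` G" unfolding G(3) by blast
  moreover have "obj I \<subseteq> src I ` arr I" using idn_hom by (force simp: hom_def)
  ultimately show ?thesis using G(1) by (meson finite_imageI finite_subset)
qed

lemma ex_skeleton:
  assumes "category I"
  shows "\<exists>P r rep. P \<subseteq> obj I \<and> partial_order_on P r \<and> (\<forall>p\<in>P. rep p = p) \<and>
    (\<forall>x\<in>obj I. rep x \<in> P \<and> hom I x (rep x) \<noteq> {} \<and> hom I (rep x) x \<noteq> {}) \<and>
    (\<forall>p q. (p, q) \<in> r \<longleftrightarrow> p \<in> P \<and> q \<in> P \<and> hom I p q \<noteq> {})"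
proof -
  interpret category I by fact
  define le where "le x y \<longleftrightarrow> hom I x y \<noteq> {}" for x y
  have le_refl: "le x x" if "x \<in> obj I" for x using idn_hom[OF that] by (auto simp: le_def)
  have le_trans: "le x z" if "le x y" "le y z" for x y z using that cmp_hom unfolding le_def by blast
  define rep where "rep x = (SOME y. y \<in> obj I \<and> le x y \<and> le y x)" for x
  have rep: "rep x \<in> obj I" "le x (rep x)" "le (rep x) x" if "x \<in> obj I" for x
    using someI[of "\<lambda>y. y \<in> obj I \<and> le x y \<and> le y x" x] that le_refl[OF that] by (auto simp: rep_def)
  \<comment> \<open>Mutually reachable objects have equivalent choice predicates, so
    \<open>SOME\<close> selects the same representative for both.\<close>
  have eq: "rep x = rep y" if "le x y" "le y x" for x y
  proof -
    have "(z \<in> obj I \<and> le x z \<and> le z x) = (z \<in> obj I \<and> le y z \<and> le z y)" for z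
      using that le_trans by blast
    then show ?thesis by (simp add: rep_def)
  qed
  define P where "P = rep ` obj I"
  define r where "r = {(p, q). p \<in> P \<and> q \<in> P \<and> le p q}"
  have PO: "P \<subseteq> obj I" using rep by (auto simp: P_def)
  have idem: "rep p = p" if p: "p \<in> P" for p
  proof -
    obtain x where x: "x \<in> obj I" "p = rep x" using p by (auto simp: P_def)
    then show ?thesis using eq[OF rep(2,3)[OF x(1)]] by simp
  qed
  have "partial_order_on P r"
    unfolding partial_order_on_def preorder_on_def
  proof (intro conjI)
    show "refl_on P r" using PO le_refl by (auto simp: refl_on_def r_def)
    show "trans r" using le_trans by (auto simp: trans_def r_def)
    show "antisym r"
    proof (rule antisymI)
      fix p q assume "(p, q) \<in> r" "(q, p) \<in> r"
      then have "p \<in> P" "q \<in> P" "rep p = rep q" using eq by (auto simp: r_def)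
      then show "p = q" by (simp add: idem)
    qed
  qed (auto simp: r_def)
  moreover have "rep x \<in> P" if "x \<in> obj I" for x using that by (simp add: P_def)
  moreover have "(p, q) \<in> r \<longleftrightarrow> p \<in> P \<and> q \<in> P \<and> le p q" for p q by (simp add: r_def)
  ultimately have "P \<subseteq> obj I \<and> partial_order_on P r \<and> (\<forall>p\<in>P. rep p = p) \<and>
    (\<forall>x\<in>obj I. rep x \<in> P \<and> le x (rep x) \<and> le (rep x) x) \<and>
    (\<forall>p q. (p, q) \<in> r \<longleftrightarrow> p \<in> P \<and> q \<in> P \<and> le p q)"
    using PO idem rep(2,3) by simp
  then show ?thesis unfolding le_def by (intro exI)
qed

section \<open>Cocones over upward-simply-connected categories\<close>

text \<open>The disjunction serves both halves of the theorem: with the JEP the skeleton may be a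
  forest of several trees, while connectedness of \<open>I\<close> makes it a single tree, for which
  amalgamation is enough.\<close>

lemma has_cocone_upward_simply_connected:
  assumes I: "category I" "finitely_generated I" "upward_simply_connected I"
    and C: "category C" "has_AP C" "has_JEP C \<or> connected_cat I"
    and F: "is_functor I C Fo Fa"
  shows "has_cocone I C Fo Fa"
proof -
  interpret I: category I by fact
  interpret C: ap_category C by (rule ap_category.intro[OF C(1) ap_category_axioms.intro[OF C(2)]])
  interpret Q: ap_category C.Q
    by (rule ap_category.intro[OF C.monic_quotient(1) ap_category_axioms.intro[OF C.has_AP_monic_quotient]])
  obtain P r rep where P12: "P \<subseteq> obj I" "partial_order_on P r" and P3: "\<forall>p\<in>P. rep p = p"
    and reps: "\<forall>x\<in>obj I. rep x \<in> P \<and> hom I x (rep x) \<noteq> {} \<and> hom I (rep x) x \<noteq> {}"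
    and rs: "\<forall>p q. (p, q) \<in> r \<longleftrightarrow> p \<in> P \<and> q \<in> P \<and> hom I p q \<noteq> {}"
    using ex_skeleton[OF I(1)] by (elim exE conjE)
  have P: "P \<subseteq> obj I" "partial_order_on P r" "\<And>p. p \<in> P \<Longrightarrow> rep p = p" using P12 P3 by simp_all
  have rep: "rep x \<in> P" "hom I x (rep x) \<noteq> {}" "hom I (rep x) x \<noteq> {}" if "x \<in> obj I" for x
    using bspec[OF reps that] by simp_all
  have r: "(p, q) \<in> r \<longleftrightarrow> p \<in> P \<and> q \<in> P \<and> hom I p q \<noteq> {}" for p q
    using rs by blast
  have rep_r: "(rep x, rep y) \<in> r" if ne: "hom I x y \<noteq> {}" for x y
  proof -
    obtain g where g: "g \<in> hom I x y" using ne by blast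
    then have xy: "x \<in> obj I" "y \<in> obj I" using I.hom_obj by blast+
    obtain f where f: "f \<in> hom I (rep x) x" using rep(3)[OF xy(1)] by blast
    obtain h where h: "h \<in> hom I y (rep y)" using rep(2)[OF xy(2)] by blast
    have "cmp I h (cmp I g f) \<in> hom I (rep x) (rep y)" using I.cmp_hom[OF I.cmp_hom[OF f g] h] .
    then have "hom I (rep x) (rep y) \<noteq> {}" by blast
    then show ?thesis using r rep(1) xy by simp
  qed
  have "finite P" using finite_subset[OF P(1) finite_obj_finitely_generated[OF I(1,2)]] .
  then have forest: "forest_like P r"
  proof (rule forest_like_simply_connected[OF _ P(2)])
    fix U assume "upward_closed_in P r U"
    then show "simply_connected_cat (preorder_cat U r)"
    proof (rule upward_closed_simply_connected[OF I(1,3) _ P(1,3), rotated -1])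
      show "preorder_on P r" using P(2) by (simp add: partial_order_on_def)
      show "(rep (src I i), rep (tgt I i)) \<in> r" if "i \<in> arr I" for i
        using rep_r I.arr_hom[OF that] by blast
    qed (use r in auto)
  qed
  define F' where "F' i = C.cls (Fa i)" for i
  have F': "is_functor I C.Q Fo F'"
    using functor_comp[OF F C.functor_cls] by (simp add: F'_def[abs_def] comp_def)
  have F'h: "F' i \<in> hom C.Q (Fo x) (Fo y)" if "i \<in> hom I x y" for i x y
    using F' that unfolding is_functor_def by (auto simp: hom_def)
  have par: "F' i = F' j" if "i \<in> hom I x y" "j \<in> hom I x y" for i j x y
    using C.parallel_arrows_eq[OF I(1,3) F' that] .
  have F'c: "F' (cmp I j i) = cmp C.Q (F' j) (F' i)" if "i \<in> hom I x y" "j \<in> hom I y z" for i j x y z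
    using F' that unfolding is_functor_def by (auto simp: hom_def)
  \<comment> \<open>An arbitrary arrow for each comparable pair. By \<open>par\<close> its image in
    the quotient does not depend on the choice, which makes \<open>G\<close> a functor on the
    skeleton.\<close>
  define a where "a x y = (SOME i. i \<in> hom I x y)" for x y
  have a: "a x y \<in> hom I x y" if "hom I x y \<noteq> {}" for x y using that by (simp add: a_def some_in_eq)
  define G where "G e = F' (a (fst e) (snd e))" for e
  have G: "is_functor (preorder_cat P r) C.Q Fo G"
    unfolding is_functor_def
  proof (intro conjI ballI impI)
    fix p assume "p \<in> obj (preorder_cat P r)"
    then have p: "p \<in> obj I" using P(1) by auto
    then show "Fo p \<in> obj C.Q" using F' unfolding is_functor_def by blast
    have "hom I p p \<noteq> {}" using I.idn_hom[OF p] by blast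
    from par[OF a[OF this] I.idn_hom[OF p]] have "G (p, p) = F' (idn I p)" by (simp add: G_def)
    then show "G (idn (preorder_cat P r) p) = idn C.Q (Fo p)" using F' p unfolding is_functor_def by simp
  next
    fix e assume "e \<in> arr (preorder_cat P r)"
    then have "hom I (fst e) (snd e) \<noteq> {}" using r[of "fst e" "snd e"] by simp
    from F'h[OF a[OF this]]
    show "G e \<in> hom C.Q (Fo (src (preorder_cat P r) e)) (Fo (tgt (preorder_cat P r) e))" by (simp add: G_def)
  next
    fix e d assume "e \<in> arr (preorder_cat P r)" "d \<in> arr (preorder_cat P r)"
      and "src (preorder_cat P r) d = tgt (preorder_cat P r) e"
    moreover obtain x y z where "e = (x, y)" "d = (y, z)"
      using \<open>src (preorder_cat P r) d = tgt (preorder_cat P r) e\<close> by (cases e, cases d) auto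
    ultimately have e: "e = (x, y)" "d = (y, z)" "hom I x y \<noteq> {}" "hom I y z \<noteq> {}"
      by (simp_all add: r)
    note c = I.cmp_hom[OF a[OF e(3)] a[OF e(4)]]
    then have "hom I x z \<noteq> {}" by blast
    from par[OF a[OF this] c] have "F' (a x z) = F' (cmp I (a y z) (a x y))" .
    then show "G (cmp (preorder_cat P r) d e) = cmp C.Q (G d) (G e)"
      using F'c[OF a[OF e(3)] a[OF e(4)]] by (simp add: G_def e)
  qed
  have "has_cocone (preorder_cat P r) C.Q Fo G"
  proof (cases "has_JEP C")
    case True
    then show ?thesis
      using cocone_forest_like[OF forest Q.ap_category_axioms C.has_JEP_monic_quotient G] by blast
  next
    case False
    then have conn: "connected_cat I" using C(3) by blast
    have "connected_cat (preorder_cat P r)"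
      unfolding connected_cat_iff
    proof (intro conjI ballI)
      show "obj (preorder_cat P r) \<noteq> {}" using conn rep(1) unfolding connected_cat_iff by auto
      fix p q assume "p \<in> obj (preorder_cat P r)" "q \<in> obj (preorder_cat P r)"
      then have pq: "p \<in> P" "q \<in> P" by auto
      then have "equivclp (\<lambda>a b. hom I a b \<noteq> {}) p q" using conn P(1) unfolding connected_cat_iff by blast
      then have "equivclp (\<lambda>a b. hom (preorder_cat P r) a b \<noteq> {}) (rep p) (rep q)"
      proof (rule equivclp_map)
        fix x y assume "hom I x y \<noteq> {}"
        then have "(rep x, rep y) \<in> r" by (rule rep_r)
        then have "hom (preorder_cat P r) (rep x) (rep y) \<noteq> {}" using r unfolding hom_preorder_cat by blast
        then show "equivclp (\<lambda>a b. hom (preorder_cat P r) a b \<noteq> {}) (rep x) (rep y)" by (rule r_into_equivclp)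
      qed
      then show "equivclp (\<lambda>a b. hom (preorder_cat P r) a b \<noteq> {}) p q" using P(3) pq by simp
    qed
    from cocone_tree_like[OF forest_like_connected[OF forest this] Q.ap_category_axioms G] show ?thesis .
  qed
  then obtain X t where t: "is_cocone (preorder_cat P r) C.Q Fo G X t" unfolding has_cocone_def by blast
  have th: "t p \<in> hom C.Q (Fo p) X" if "p \<in> P" for p using t that by (simp add: is_cocone_def)
  \<comment> \<open>Every object enters the cocone through a chosen arrow to its
    representative.\<close>
  define s where "s x = cmp C.Q (t (rep x)) (F' (a x (rep x)))" for x
  have "is_cocone I C.Q Fo F' X s"
    unfolding is_cocone_def
  proof (intro conjI ballI)
    show "X \<in> obj C.Q" using t unfolding is_cocone_def by blast
    show "s x \<in> hom C.Q (Fo x) X" if "x \<in> obj I" for x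
      unfolding s_def using Q.cmp_hom[OF F'h[OF a[OF rep(2)[OF that]]] th[OF rep(1)[OF that]]] .
    fix i assume i: "i \<in> arr I"
    let ?x = "src I i" and ?y = "tgt I i"
    have ih: "i \<in> hom I ?x ?y" using i by (rule I.arr_hom)
    have xy: "?x \<in> obj I" "?y \<in> obj I" using i I.src_obj I.tgt_obj by auto
    have rxy: "(rep ?x, rep ?y) \<in> r" using ih rep_r by blast
    then have hr: "hom I (rep ?x) (rep ?y) \<noteq> {}" using r by blast
    have ax: "a ?x (rep ?x) \<in> hom I ?x (rep ?x)" and ay: "a ?y (rep ?y) \<in> hom I ?y (rep ?y)"
      using a rep(2) xy by auto
    have ar: "a (rep ?x) (rep ?y) \<in> hom I (rep ?x) (rep ?y)" using a[OF hr] .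
    have "(rep ?x, rep ?y) \<in> arr (preorder_cat P r)" using rxy r by auto
    then have tr: "t (rep ?x) = cmp C.Q (t (rep ?y)) (F' (a (rep ?x) (rep ?y)))"
      using t unfolding is_cocone_def by (fastforce simp: G_def)
    have "s ?x = cmp C.Q (t (rep ?y)) (cmp C.Q (F' (a (rep ?x) (rep ?y))) (F' (a ?x (rep ?x))))"
      unfolding s_def tr using Q.cmp_assoc[OF F'h[OF ax] F'h[OF ar] th[OF rep(1)[OF xy(2)]]] by simp
    also have "\<dots> = cmp C.Q (t (rep ?y)) (F' (cmp I (a (rep ?x) (rep ?y)) (a ?x (rep ?x))))"
      by (simp only: F'c[OF ax ar])
    \<comment> \<open>The chosen arrows need not be natural in \<open>I\<close>, but both composites
      run from \<open>?x\<close> to \<open>rep ?y\<close>, and parallel arrows have equal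
      images.\<close>
    also have "F' (cmp I (a (rep ?x) (rep ?y)) (a ?x (rep ?x))) = F' (cmp I (a ?y (rep ?y)) i)"
      by (rule par[OF I.cmp_hom[OF ax ar] I.cmp_hom[OF ih ay]])
    also have "cmp C.Q (t (rep ?y)) (F' (cmp I (a ?y (rep ?y)) i)) = cmp C.Q (s ?y) (F' i)"
      unfolding s_def F'c[OF ih ay]
      using Q.cmp_assoc[OF F'h[OF ih] F'h[OF ay] th[OF rep(1)[OF xy(2)]]] .
    finally show "s ?x = cmp C.Q (s ?y) (F' i)" .
  qed
  then have "has_cocone I C.Q Fo F'" unfolding has_cocone_def by blast
  then show ?thesis unfolding F'_def by (rule C.lift_cocone[OF I(1,2) F])
qed

text \<open>Discrete categories have the AP, as their spans are pairs of equal identities. Over two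
  objects they carry a diagram that separates the component of \<open>x\<close> from the rest and so
  has no cocone; the discrete category without objects excludes \<open>obj I = {}\<close>.\<close>

lemma connected_cat_if_AP_cocones:
  assumes inf: "infinite (UNIV :: 'o set)" "infinite (UNIV :: 'm set)" and I: "category I"
    and hyp: "\<And>C :: ('o, 'm) precategory. \<lbrakk>category C; has_AP C\<rbrakk> \<Longrightarrow> diagrams_have_cocones I C"
  shows "connected_cat I"
proof -
  interpret I: category I by fact
  let ?D = "\<lambda>S :: nat set. preorder_cat S (Id_on S)"
  have D: "category (?D S)" for S
    by (rule category_preorder_cat) (auto simp: preorder_on_def refl_on_def trans_def)
  have "has_AP (?D S)" for S
    unfolding has_AP_iff[OF D]
  proof (intro ballI impI)
    fix f g assume "f \<in> arr (?D S)" "g \<in> arr (?D S)" "src (?D S) f = src (?D S) g"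
    then have "amalgamates (?D S) f g f g" by (auto simp: amalgamates_def)
    then show "\<exists>h k. amalgamates (?D S) f g h k" by blast
  qed
  then have cocone: "has_cocone I (?D S) Fo Fa" if "finite S" "is_functor I (?D S) Fo Fa" for S Fo Fa
    using diagrams_have_cocones_countable[of False I, OF inf hyp I D] that
    unfolding diagrams_have_cocones_def by (auto simp: countable_finite)
  let ?e = "equivclp (\<lambda>a b. hom I a b \<noteq> {})"
  have "?e x y" if xy: "x \<in> obj I" "y \<in> obj I" for x y
  proof (rule ccontr)
    assume n: "\<not> ?e x y"
    define Fo where "Fo z = (if ?e x z then 0 else 1 :: nat)" for z
    have "Fo (src I i) = Fo (tgt I i)" if "i \<in> arr I" for i
    proof -
      have "hom I (src I i) (tgt I i) \<noteq> {}" using I.arr_hom[OF that] by blast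
      then have e: "?e (src I i) (tgt I i)" by (rule r_into_equivclp)
      have "?e x (src I i) \<longleftrightarrow> ?e x (tgt I i)"
        using equivclp_trans[OF _ e] equivclp_trans[OF _ equivclp_sym[OF e]] by blast
      then show ?thesis by (simp add: Fo_def)
    qed
    then have "is_functor I (?D {0, 1}) Fo (\<lambda>i. (Fo (src I i), Fo (tgt I i)))"
      unfolding is_functor_def using I.idn_hom
      by (auto simp: hom_def Fo_def I.cmp_src I.cmp_tgt)
    then have "has_cocone I (?D {0, 1}) Fo (\<lambda>i. (Fo (src I i), Fo (tgt I i)))"
      by (intro cocone) simp_all
    then obtain X t where "is_cocone I (?D {0, 1}) Fo (\<lambda>i. (Fo (src I i), Fo (tgt I i))) X t"
      unfolding has_cocone_def by (elim exE)
    then have "t x \<in> hom (?D {0, 1}) (Fo x) X" "t y \<in> hom (?D {0, 1}) (Fo y) X"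
      using xy by (auto simp: is_cocone_def)
    then have "Fo x = Fo y" by (auto simp: hom_def)
    then show False using n by (simp add: Fo_def)
  qed
  moreover have "obj I \<noteq> {}"
  proof
    assume e: "obj I = {}"
    then have "arr I = {}" using I.src_obj by blast
    with e have "is_functor I (?D {}) (\<lambda>_. 0) (\<lambda>_. (0, 0))" by (simp add: is_functor_def)
    then show False using cocone[of "{}"] by (auto simp: has_cocone_def is_cocone_def)
  qed
  ultimately show ?thesis unfolding connected_cat_iff by blast
qed

section \<open>The equivalences assembled\<close>

lemma finitely_generated_preorder_cat:
  assumes "finite P" "preorder_on P r"
  shows "finitely_generated (preorder_cat P r)"
proof -
  interpret category "preorder_cat P r" using assms(2) by (rule category_preorder_cat)
  let ?A = "arr (preorder_cat P r)"
  have "f \<in> ?A" if "f \<in> arr_closure (preorder_cat P r) ?A" for f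
    using that by induction (use cmp_arr in blast)+
  then have "arr_closure (preorder_cat P r) ?A = ?A" by (auto intro: arr_closure.gen)
  moreover have "finite ?A" using assms(1) by simp
  ultimately show ?thesis unfolding finitely_generated_def by blast
qed

text \<open>A cycle: cocones in all categories with AP and JEP give cocones in \<open>Inj\<close>,
  these make loops idempotent, and idempotent loops give all cocones. Diagrams of finite sets offer
  a second way into the cycle when there are finitely many arrows; \<open>all_AP\<close> enters it
  as the stronger form of \<open>all_AP_JEP\<close>.\<close>

lemma amalgamable_shape_equivalences:
  fixes I :: "('i, 'a) precategory"
  assumes inf: "infinite (UNIV :: 'o set)" "infinite (UNIV :: 'm set)" "infinite (UNIV :: 'x set)"
    and I: "category I" "finitely_generated I"
  defines "J \<equiv> Inj :: ('x set, 'x inj_arr) precategory"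
  defines "all_AP_JEP \<equiv> \<forall>C :: ('o, 'm) precategory. category C \<and> has_AP C \<and> has_JEP C \<longrightarrow> diagrams_have_cocones I C"
    and "all_AP \<equiv> \<forall>C :: ('o, 'm) precategory. category C \<and> has_AP C \<longrightarrow> diagrams_have_cocones I C"
  shows "all_AP_JEP \<longleftrightarrow> diagrams_have_cocones I J"
    and "diagrams_have_cocones I J \<longleftrightarrow> upward_simply_connected I"
    and "finite (arr I) \<Longrightarrow> diagrams_have_cocones I J \<longleftrightarrow>
      (\<forall>Fo Fa. is_functor I J Fo Fa \<and> (\<forall>x\<in>obj I. finite (Fo x)) \<longrightarrow> has_cocone I J Fo Fa)"
    and "all_AP \<longleftrightarrow> connected_cat I \<and> upward_simply_connected I"
proof -
  have cnt: "countable (arr I)" using countable_finitely_generated[OF I] .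
  have 1: "diagrams_have_cocones I J" if all_AP_JEP
    unfolding J_def
    by (rule diagrams_have_cocones_all_types[OF inf(1,2) _ I(1) cnt category_Inj
          has_AP_Inj[OF inf(3)] has_JEP_Inj[OF inf(3)]])
      (use that in \<open>simp add: all_AP_JEP_def\<close>)
  have 2: "upward_simply_connected I" if "diagrams_have_cocones I J"
    by (rule category.upward_simply_connected_Inj[OF I(1) inf(3) cnt, of False])
      (use that in \<open>auto simp: J_def diagrams_have_cocones_def\<close>)
  have 3: all_AP_JEP if "upward_simply_connected I"
    using has_cocone_upward_simply_connected[OF I that]
    by (auto simp: all_AP_JEP_def diagrams_have_cocones_def)
  have 4: "upward_simply_connected I" if "finite (arr I)"
    "\<forall>Fo Fa. is_functor I J Fo Fa \<and> (\<forall>x\<in>obj I. finite (Fo x)) \<longrightarrow> has_cocone I J Fo Fa"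
    by (rule category.upward_simply_connected_Inj[OF I(1) inf(3) cnt, of True])
      (use that in \<open>auto simp: J_def\<close>)
  have 5: all_AP if "connected_cat I" "upward_simply_connected I"
    using has_cocone_upward_simply_connected[OF I that(2)] that(1)
    by (auto simp: all_AP_def diagrams_have_cocones_def)
  have 6: "connected_cat I" if all_AP
    by (rule connected_cat_if_AP_cocones[OF inf(1,2) I(1)]) (use that in \<open>simp add: all_AP_def\<close>)
  have 7: all_AP_JEP if all_AP using that by (simp add: all_AP_JEP_def all_AP_def)
  show "all_AP_JEP \<longleftrightarrow> diagrams_have_cocones I J" using 1 2 3 by blast
  show "diagrams_have_cocones I J \<longleftrightarrow> upward_simply_connected I" using 1 2 3 by blast
  show "diagrams_have_cocones I J \<longleftrightarrow>
      (\<forall>Fo Fa. is_functor I J Fo Fa \<and> (\<forall>x\<in>obj I. finite (Fo x)) \<longrightarrow> has_cocone I J Fo Fa)"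
    if "finite (arr I)"
    using 1 3 4[OF that] unfolding diagrams_have_cocones_def by blast
  show "all_AP \<longleftrightarrow> connected_cat I \<and> upward_simply_connected I" using 1 2 5 6 7 by blast
qed

text \<open>The way from forests back to loops runs through cocones: a forest-like poset has them in
  every category on \<open>nat\<close> with AP and JEP, hence in \<open>Inj\<close> over
  \<open>nat\<close>, and these force loops to be idempotent. Any infinite types would do in place
  of \<open>nat\<close>.\<close>

lemma upward_simply_connected_poset:
  assumes "finite P" "partial_order_on P r"
  shows "upward_simply_connected (preorder_cat P r) \<longleftrightarrow>
      (\<forall>U. upward_closed_in P r U \<longrightarrow> simply_connected_cat (preorder_cat U r))"
    and "(\<forall>U. upward_closed_in P r U \<longrightarrow> simply_connected_cat (preorder_cat U r)) \<longleftrightarrow> forest_like P r"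
proof -
  have po: "preorder_on P r" using assms(2) by (simp add: partial_order_on_def)
  let ?J = "preorder_cat P r"
  note J = category_preorder_cat[OF po]
  \<comment> \<open>A poset is its own skeleton, so the identity serves as the choice of
    representatives.\<close>
  have 1: "simply_connected_cat (preorder_cat U r)"
    if "upward_simply_connected ?J" "upward_closed_in P r U" for U
    by (rule upward_closed_simply_connected[OF J that(1) po, of "\<lambda>x. x"])
      (use that(2) po in \<open>auto simp: hom_preorder_cat preorder_on_def\<close>)
  have 2: "forest_like P r"
    if "\<forall>U. upward_closed_in P r U \<longrightarrow> simply_connected_cat (preorder_cat U r)"
    using forest_like_simply_connected[OF assms] that by blast
  have 3: "upward_simply_connected ?J" if "forest_like P r"
  proof -
    have n: "infinite (UNIV :: nat set)" by simp
    have "diagrams_have_cocones ?J C" if "category C" "has_AP C" "has_JEP C" for C :: "(nat, nat) precategory"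
      unfolding diagrams_have_cocones_def
      using cocone_forest_like[OF \<open>forest_like P r\<close> ap_category.intro[OF that(1) ap_category_axioms.intro[OF that(2)]] that(3)]
      by blast
    then show ?thesis
      using amalgamable_shape_equivalences(1,2)[OF n n n J finitely_generated_preorder_cat[OF assms(1) po]]
      by blast
  qed
  show "upward_simply_connected ?J \<longleftrightarrow>
      (\<forall>U. upward_closed_in P r U \<longrightarrow> simply_connected_cat (preorder_cat U r))"
    using 1 2 3 by blast
  show "(\<forall>U. upward_closed_in P r U \<longrightarrow> simply_connected_cat (preorder_cat U r)) \<longleftrightarrow> forest_like P r"
    using 1 2 3 by blast
qed

theorem theorem1p1:
  assumes "infinite (UNIV :: 'o set)" and "infinite (UNIV :: 'm set)" and "infinite (UNIV :: 'x set)"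
  shows
    "(\<forall>I :: ('i, 'a) precategory. category I \<and> finitely_generated I \<longrightarrow>
        ((\<forall>C :: ('o, 'm) precategory. category C \<and> has_AP C \<and> has_JEP C \<longrightarrow> diagrams_have_cocones I C)
           \<longleftrightarrow> diagrams_have_cocones I (Inj :: ('x set, 'x inj_arr) precategory)) \<and>
        (diagrams_have_cocones I (Inj :: ('x set, 'x inj_arr) precategory)
           \<longleftrightarrow> upward_simply_connected I) \<and>
        (finite (arr I) \<longrightarrow>
           (diagrams_have_cocones I (Inj :: ('x set, 'x inj_arr) precategory)
              \<longleftrightarrow> (\<forall>Fo Fa. is_functor I (Inj :: ('x set, 'x inj_arr) precategory) Fo Fa \<and>
                      (\<forall>x\<in>obj I. finite (Fo x)) \<longrightarrow>
                    has_cocone I (Inj :: ('x set, 'x inj_arr) precategory) Fo Fa))) \<and>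
        ((\<forall>C :: ('o, 'm) precategory. category C \<and> has_AP C \<longrightarrow> diagrams_have_cocones I C)
           \<longleftrightarrow> connected_cat I \<and> diagrams_have_cocones I (Inj :: ('x set, 'x inj_arr) precategory)) \<and>
        ((\<forall>C :: ('o, 'm) precategory. category C \<and> has_AP C \<longrightarrow> diagrams_have_cocones I C)
           \<longleftrightarrow> connected_cat I \<and> upward_simply_connected I)) \<and>
     (\<forall>(P :: 'p set) r. finite P \<and> partial_order_on P r \<longrightarrow>
        ((\<forall>C :: ('o, 'm) precategory. category C \<and> has_AP C \<and> has_JEP C
              \<longrightarrow> diagrams_have_cocones (preorder_cat P r) C)
           \<longleftrightarrow> diagrams_have_cocones (preorder_cat P r) (Inj :: ('x set, 'x inj_arr) precategory)) \<and>
        (diagrams_have_cocones (preorder_cat P r) (Inj :: ('x set, 'x inj_arr) precategory)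
           \<longleftrightarrow> upward_simply_connected (preorder_cat P r)) \<and>
        (upward_simply_connected (preorder_cat P r)
           \<longleftrightarrow> (\<forall>U. upward_closed_in P r U \<longrightarrow> simply_connected_cat (preorder_cat U r))) \<and>
        ((\<forall>U. upward_closed_in P r U \<longrightarrow> simply_connected_cat (preorder_cat U r))
           \<longleftrightarrow> forest_like P r) \<and>
        ((\<forall>C :: ('o, 'm) precategory. category C \<and> has_AP C \<longrightarrow> diagrams_have_cocones (preorder_cat P r) C)
           \<longleftrightarrow> connected_cat (preorder_cat P r) \<and>
               (\<forall>U. upward_closed_in P r U \<longrightarrow> simply_connected_cat (preorder_cat U r))) \<and>
        ((\<forall>C :: ('o, 'm) precategory. category C \<and> has_AP C \<longrightarrow> diagrams_have_cocones (preorder_cat P r) C)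
           \<longleftrightarrow> connected_cat (preorder_cat P r) \<and> forest_like P r))"
  (is "(\<forall>I. ?fg I \<longrightarrow> ?shape I) \<and> (\<forall>P r. ?fin P r \<longrightarrow> ?poset P r)")
proof (rule conjI; intro allI; rule impI)
  fix I :: "('i, 'a) precategory"
  assume "?fg I"
  note E = amalgamable_shape_equivalences[OF assms conjunct1[OF this] conjunct2[OF this]]
  show "?shape I"
  proof (intro conjI)
    show "finite (arr I) \<longrightarrow> (diagrams_have_cocones I (Inj :: ('x set, 'x inj_arr) precategory) \<longleftrightarrow>
        (\<forall>Fo Fa. is_functor I (Inj :: ('x set, 'x inj_arr) precategory) Fo Fa \<and>
          (\<forall>x\<in>obj I. finite (Fo x)) \<longrightarrow> has_cocone I (Inj :: ('x set, 'x inj_arr) precategory) Fo Fa))"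
      using E(3) by blast
  qed (use E(1,2,4) in blast)+
next
  fix P :: "'p set" and r
  assume "?fin P r"
  then have P: "finite P" "partial_order_on P r" "preorder_on P r" by (simp_all add: partial_order_on_def)
  note E = amalgamable_shape_equivalences(1,2,4)[OF assms category_preorder_cat[OF P(3)]
      finitely_generated_preorder_cat[OF P(1,3)]]
  show "?poset P r"
    using upward_simply_connected_poset[OF P(1,2)] E by (intro conjI) blast+
qed

end
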